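(* Let $k>0$ and let $\lambda$ be a partition. Then $$p_k\,s_\lambda(\mathbf p\,\|\,\boldsymbol\alpha;\boldsymbol\beta)=p_k\bigl(\boldsymbol\alpha_{S(\lambda)}/(-\boldsymbol\alpha_{T(\lambda)})\bigr)\,s_\lambda(\mathbf p\,\|\,\boldsymbol\alpha;\boldsymbol\beta)+\sum_{\nu}(-1)^{\mathrm{ht}(\nu/\lambda)-1}A_{j,i}^{-k}\,s_\nu(\mathbf p\,\|\,\boldsymbol\alpha;\boldsymbol\beta),$$ where the sum is over all partitions $\nu$ such that $\nu/\lambda$ is a nonempty ribbon and $[i,j)$ is the content interval of $\nu/\lambda$; and $$k\frac{\partial}{\partial p_k}s_\lambda(\mathbf p\,\|\,\boldsymbol\alpha;\boldsymbol\beta)=p_k\bigl(\boldsymbol\beta_{S(\lambda)}/(-\boldsymbol\beta_{T(\lambda)})\bigr)\,s_\lambda(\mathbf p\,\|\,\boldsymbol\alpha;\boldsymbol\beta)+\sum_{\mu}(-1)^{\mathrm{ht}(\lambda/\mu)-1}A_{ij}^{k}\,s_\mu(\mathbf p\,\|\,\boldsymbol\alpha;\boldsymbol\beta),$$ where the sum is over all partitions $\mu$ such that $\lambda/\mu$ is a nonempty ribbon and $[i,j)$ is the content interval of $\lambda/\mu$.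
   Context: $\boldsymbol\alpha=(\alpha_i)_{i\in\mathbb Z}$, $\boldsymbol\beta=(\beta_i)_{i\in\mathbb Z}$ are sequences in $\mathbb C$. For $k\in\mathbb Z$, $(z;\boldsymbol\alpha)^k=\prod_{i=1}^k(1-z\alpha_i)$ if $k\ge 0$ and $\prod_{i=k+1}^{0}(1-z\alpha_i)^{-1}$ if $k<0$; $(z|\boldsymbol\beta)^k=\prod_{i=1}^k(z-\beta_i)$ if $k\ge0$ and $\prod_{i=k+1}^0(z-\beta_i)^{-1}$ if $k<0$. The Clifford algebra is generated by $\psi_i,\psi_i^*$ ($i\in\mathbb Z$) with $[\psi_i,\psi_j]_+=[\psi_i^*,\psi_j^*]_+=0$, $[\psi_i,\psi_j^*]_+=\delta_{ij}$. The charge $0$ Fock space has basis $|\lambda\rangle=v_{\lambda_1}\wedge v_{\lambda_2-1}\wedge v_{\lambda_3-2}\wedge\cdots$ over partitions; $\psi_j$ acts by $v_j\wedge$, $\psi_j^*$ by contraction against $v_j$; $\langle\lambda|$ is the dual basis. Normal ordering: $:\!\psi_i\psi_j^*\!:\,=\psi_i\psi_j^*$ if $i>0$, $=-\psi_j^*\psi_i$ if $i\le0$. Coefficients, with $e_r,h_s$ elementary and complete homogeneous symmetric polynomials ($1$ in degree $0$, and $0$ in positive degree when there are no variables): for $k>0$, $i\ne j$, $A_{ij}^k=(1-\alpha_j\beta_j)\sum_{r-s=j-i-k}e_r(-\alpha_{i+1},\dots,-\alpha_{j-1})h_s(\beta_i,\dots,\beta_j)$ (zero if $j<i$), $A_{ij}^{-k}=(1-\alpha_j\beta_j)\sum_{r-s=j-i+k}h_r(\alpha_j,\dots,\alpha_i)e_s(-\beta_{j+1},\dots,-\beta_{i-1})$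 (zero if $j>i$), $A_{ii}^k=\beta_i^k$, $A_{ii}^{-k}=\alpha_i^k$. Deformed currents: $J_k^{(\boldsymbol\alpha;\boldsymbol\beta)}=\sum_{i,j}A_{ij}^k:\!\psi_i\psi_j^*\!:$ for $k\neq 0$; equivalently the coefficient of $z^{-k}$ in $:\!\psi(z|\boldsymbol\alpha;\boldsymbol\beta)\psi^*(z|\boldsymbol\alpha;\boldsymbol\beta)\!:$ (expanded for $|\beta_a|<|z|<|\alpha_b^{-1}|$, all $a,b$), where $\psi(z|\boldsymbol\alpha;\boldsymbol\beta)=\sum_i z\frac{(z|\boldsymbol\beta)^{i-1}}{(z;\boldsymbol\alpha)^i}\psi_i$, $\psi^*(w|\boldsymbol\alpha;\boldsymbol\beta)=\sum_j(1-\alpha_j\beta_j)\frac{(w;\boldsymbol\alpha)^{j-1}}{(w|\boldsymbol\beta)^j}\psi_j^*$. $H_+(\mathbf p|\boldsymbol\alpha;\boldsymbol\beta)=\sum_{k\ge1}\frac{p_k}{k}J_k^{(\boldsymbol\alpha;\boldsymbol\beta)}$ with indeterminates $\mathbf p=(p_1,p_2,\dots)$, and $s_\lambda(\mathbf p\,\|\,\boldsymbol\alpha;\boldsymbol\beta)=\langle\varnothing|e^{H_+(\mathbf p|\boldsymbol\alpha;\boldsymbol\beta)}|\lambda\rangle$. Combinatorics: the content of a box in row $R$ and column $C$ is $C-R$. A ribbon is a connected skew shape with at most one box on each diagonal; its contents form an interval $i,i+1,\dots,j-1$, and $[i,j)$ is its content interval; $\mathrm{ht}$ is the number of distinct rows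 it occupies. For $A,B\subset\mathbb Z$ finite, $p_k(\boldsymbol\beta_A/(-\boldsymbol\beta_B))=\sum_{i\in A}\beta_i^k-\sum_{i\in B}\beta_i^k$ (similarly for $\boldsymbol\alpha$). $S(\lambda)=\{\lambda_i-i+1\mid\lambda_i\ge i\}$, $T(\lambda)=\{i-\lambda_i'\mid\lambda_i'\ge i\}$, $\lambda'$ the conjugate partition. Standing assumption: the formulas $\langle\varnothing|\psi(z|\boldsymbol\alpha;\boldsymbol\beta)\psi^*(w|\boldsymbol\alpha;\boldsymbol\beta)|\varnothing\rangle=\frac z{z-w}$ (expanded in $w/z$) and $\langle\varnothing|\psi^*(w|\boldsymbol\alpha;\boldsymbol\beta)\psi(z|\boldsymbol\alpha;\boldsymbol\beta)|\varnothing\rangle=\frac z{w-z}$ (expanded in $z/w$) are valid, and the infinite sums arising in products of operators (in particular the possibly infinite sum over $\nu$) are taken to converge accordingly. *)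

theory Defs
  imports
    "HOL-Computational_Algebra.Formal_Laurent_Series"
    "HOL-Analysis.Infinite_Sum"
    "HOL-Library.Groups_Big_Fun"
    "HOL-Library.Multiset"
begin

section \<open>Partitions, skew shapes and ribbons\<close>

text \<open>Everything is indexed from 0: \<open>lam i\<close> is the part usually written \<open>\<lambda>\<^sub>i\<^sub>+\<^sub>1\<close>, and the box in
  row \<open>R\<close> and column \<open>C\<close> is \<open>(R - 1, C - 1)\<close>, which does not change its content.\<close>

definition is_partition :: "(nat \<Rightarrow> nat) \<Rightarrow> bool" where
  "is_partition lam \<longleftrightarrow> antimono lam \<and> finite {i. lam i \<noteq> 0}"

definition empty_partition :: "nat \<Rightarrow> nat" where
  "empty_partition = (\<lambda>_. 0)"

definition conj_part :: "(nat \<Rightarrow> nat) \<Rightarrow> nat \<Rightarrow> nat" where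
  "conj_part lam c = card {r. c < lam r}"

definition skew_boxes :: "(nat \<Rightarrow> nat) \<Rightarrow> (nat \<Rightarrow> nat) \<Rightarrow> (nat \<times> nat) set" where
  "skew_boxes nu lam = {(r, c). lam r \<le> c \<and> c < nu r}"

definition content :: "nat \<times> nat \<Rightarrow> int" where
  "content = (\<lambda>(r, c). int c - int r)"

definition share_edge :: "nat \<times> nat \<Rightarrow> nat \<times> nat \<Rightarrow> bool" where
  "share_edge = (\<lambda>(r, c) (r', c'). \<bar>int r - int r'\<bar> + \<bar>int c - int c'\<bar> = 1)"

definition connected_boxes :: "(nat \<times> nat) set \<Rightarrow> bool" where
  "connected_boxes D \<longleftrightarrow>
     (\<forall>x\<in>D. \<forall>y\<in>D. (x, y) \<in> {(u, v). u \<in> D \<and> v \<in> D \<and> share_edge u v}\<^sup>*)"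

definition nonempty_ribbon :: "(nat \<Rightarrow> nat) \<Rightarrow> (nat \<Rightarrow> nat) \<Rightarrow> bool" where
  "nonempty_ribbon nu lam \<longleftrightarrow>
     (\<forall>r. lam r \<le> nu r) \<and> skew_boxes nu lam \<noteq> {} \<and>
     connected_boxes (skew_boxes nu lam) \<and> inj_on content (skew_boxes nu lam)"

definition height :: "(nat \<Rightarrow> nat) \<Rightarrow> (nat \<Rightarrow> nat) \<Rightarrow> nat" where
  "height nu lam = card (fst ` skew_boxes nu lam)"

text \<open>The content interval of a nonempty ribbon is \<open>[content_lo, content_hi)\<close>.\<close>

definition content_lo :: "(nat \<Rightarrow> nat) \<Rightarrow> (nat \<Rightarrow> nat) \<Rightarrow> int" where
  "content_lo nu lam = Min (content ` skew_boxes nu lam)"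

definition content_hi :: "(nat \<Rightarrow> nat) \<Rightarrow> (nat \<Rightarrow> nat) \<Rightarrow> int" where
  "content_hi nu lam = Max (content ` skew_boxes nu lam) + 1"

definition S_set :: "(nat \<Rightarrow> nat) \<Rightarrow> int set" where
  "S_set lam = {int (lam i) - int i | i. Suc i \<le> lam i}"

definition T_set :: "(nat \<Rightarrow> nat) \<Rightarrow> int set" where
  "T_set lam = {int (Suc i) - int (conj_part lam i) | i. Suc i \<le> conj_part lam i}"

definition super_power_sum :: "nat \<Rightarrow> (int \<Rightarrow> complex) \<Rightarrow> int set \<Rightarrow> int set \<Rightarrow> complex" where
  "super_power_sum k x A B = (\<Sum>i\<in>A. x i ^ k) - (\<Sum>i\<in>B. x i ^ k)"


section \<open>Fermionic Fock space\<close>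

text \<open>The semi-infinite wedge \<open>v\<^bsub>s\<^sub>1\<^esub> \<and> v\<^bsub>s\<^sub>2\<^esub> \<and> \<dots>\<close> with \<open>s\<^sub>1 > s\<^sub>2 > \<dots>\<close> is identified with the set
  \<open>{s\<^sub>1, s\<^sub>2, \<dots>}\<close>, and a vector with its coordinate function on such sets. Fock space proper
  consists of the finitely supported functions living on sets that differ from
  \<open>{\<dots>, -1, 0}\<close> in finitely many elements; all charges occur, since \<open>\<psi>\<^sub>i\<close> and \<open>\<psi>\<^sub>i\<^sup>*\<close> change the charge.\<close>

type_synonym fock = "int set \<Rightarrow> complex"

definition maya :: "(nat \<Rightarrow> nat) \<Rightarrow> int set" where
  "maya lam = range (\<lambda>i. int (lam i) - int i)"

definition ket :: "(nat \<Rightarrow> nat) \<Rightarrow> fock" where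
  "ket lam = (\<lambda>S. if S = maya lam then 1 else 0)"

definition bra :: "(nat \<Rightarrow> nat) \<Rightarrow> fock \<Rightarrow> complex" where
  "bra lam v = v (maya lam)"

text \<open>In coordinates: \<open>\<psi>\<^sub>j\<close> sends the basis vector of \<open>S - {j}\<close> to plus or minus that of \<open>S\<close> when
  \<open>j \<in> S\<close>, and \<open>\<psi>\<^sub>j\<^sup>*\<close> sends that of \<open>insert j S\<close> to plus or minus that of \<open>S\<close> when \<open>j \<notin> S\<close>; the
  sign counts the factors standing to the left of \<open>v\<^sub>j\<close>.\<close>

definition psi :: "int \<Rightarrow> fock \<Rightarrow> fock" where
  "psi j v = (\<lambda>S. if j \<in> S then (-1) ^ card {s \<in> S. j < s} * v (S - {j}) else 0)"

definition psi_star :: "int \<Rightarrow> fock \<Rightarrow> fock" where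
  "psi_star j v = (\<lambda>S. if j \<notin> S then (-1) ^ card {s \<in> S. j < s} * v (insert j S) else 0)"

definition normal_ordered :: "int \<Rightarrow> int \<Rightarrow> fock \<Rightarrow> fock" where
  "normal_ordered i j v =
     (if i > 0 then psi i (psi_star j v) else (\<lambda>S. - psi_star j (psi i v) S))"


section \<open>Deformed currents\<close>

definition elem_sym :: "nat \<Rightarrow> (int \<Rightarrow> complex) \<Rightarrow> int set \<Rightarrow> complex" where
  "elem_sym r x I = (\<Sum>X | X \<subseteq> I \<and> card X = r. \<Prod>a\<in>X. x a)"

definition comp_sym :: "nat \<Rightarrow> (int \<Rightarrow> complex) \<Rightarrow> int set \<Rightarrow> complex" where
  "comp_sym s x I = (\<Sum>M | set_mset M \<subseteq> I \<and> size M = s. prod_mset (image_mset x M))"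

text \<open>\<open>A \<alpha> \<beta> k i j\<close> is \<open>A\<^sub>i\<^sub>j\<^sup>k\<close>, for \<open>k \<noteq> 0\<close> of either sign. The bounds on \<open>r\<close>, respectively \<open>s\<close>, make
  the index sets finite; they only discard elementary symmetric polynomials of degree larger
  than the number of variables.\<close>

definition A :: "(int \<Rightarrow> complex) \<Rightarrow> (int \<Rightarrow> complex) \<Rightarrow> int \<Rightarrow> int \<Rightarrow> int \<Rightarrow> complex" where
  "A \<alpha> \<beta> k i j =
    (if i = j then (if k > 0 then \<beta> i ^ nat k else \<alpha> i ^ nat (- k))
     else if k > 0 then
       (if j < i then 0
        else (1 - \<alpha> j * \<beta> j) *
          (\<Sum>(r, s) \<in> {(r, s). r \<le> card {i+1..j-1} \<and> int r - int s = j - i - k}.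
             elem_sym r (\<lambda>a. - \<alpha> a) {i+1..j-1} * comp_sym s \<beta> {i..j}))
     else
       (if j > i then 0
        else (1 - \<alpha> j * \<beta> j) *
          (\<Sum>(r, s) \<in> {(r, s). s \<le> card {j+1..i-1} \<and> int r - int s = j - i - k}.
             comp_sym r \<alpha> {j..i} * elem_sym s (\<lambda>a. - \<beta> a) {j+1..i-1})))"

text \<open>For finitely supported \<open>v\<close> in Fock space and a fixed \<open>S\<close> only finitely many pairs \<open>(i, j)\<close>
  contribute.\<close>

definition J :: "(int \<Rightarrow> complex) \<Rightarrow> (int \<Rightarrow> complex) \<Rightarrow> int \<Rightarrow> fock \<Rightarrow> fock" where
  "J \<alpha> \<beta> k v = (\<lambda>S. Sum_any (\<lambda>(i, j). A \<alpha> \<beta> k i j * normal_ordered i j v S))"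


section \<open>Formal power series in the indeterminates \<open>p\<^sub>1, p\<^sub>2, \<dots>\<close>\<close>

text \<open>A series is its coefficient function on monomials, the multiset \<open>{#k\<^sub>1, \<dots>, k\<^sub>n#}\<close> standing
  for \<open>p\<^bsub>k\<^sub>1\<^esub> \<cdots> p\<^bsub>k\<^sub>n\<^esub>\<close>. There is no indeterminate \<open>p\<^sub>0\<close>: all series below have zero
  coefficients at multisets containing 0.\<close>

type_synonym pseries = "nat multiset \<Rightarrow> complex"

definition p_mult :: "nat \<Rightarrow> pseries \<Rightarrow> pseries" where
  "p_mult k f = (\<lambda>M. if k \<in># M then f (M - {#k#}) else 0)"

definition p_deriv :: "nat \<Rightarrow> pseries \<Rightarrow> pseries" where
  "p_deriv k f = (\<lambda>M. of_nat (Suc (count M k)) * f (add_mset k M))"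

text \<open>Series with coefficients in Fock space, and the operator \<open>H\<^sub>+ = (\<Sum>k\<ge>1. p\<^sub>k / k * J\<^sub>k)\<close> on them:
  only those \<open>k\<close> that occur in \<open>M\<close> contribute to the coefficient at \<open>M\<close>.\<close>

type_synonym fock_series = "nat multiset \<Rightarrow> fock"

definition const_series :: "fock \<Rightarrow> fock_series" where
  "const_series v = (\<lambda>M. if M = {#} then v else (\<lambda>_. 0))"

definition H_plus ::
    "(int \<Rightarrow> complex) \<Rightarrow> (int \<Rightarrow> complex) \<Rightarrow> fock_series \<Rightarrow> fock_series" where
  "H_plus \<alpha> \<beta> F = (\<lambda>M S. \<Sum>k | k \<in># M \<and> k \<ge> 1. J \<alpha> \<beta> (int k) (F (M - {#k#})) S / of_nat k)"

text \<open>\<open>H\<^sub>+\<close> raises the degree in \<open>p\<close> by one, so only finitely many terms of the exponential series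
  contribute to a given coefficient.\<close>

definition exp_H_plus ::
    "(int \<Rightarrow> complex) \<Rightarrow> (int \<Rightarrow> complex) \<Rightarrow> fock_series \<Rightarrow> fock_series" where
  "exp_H_plus \<alpha> \<beta> F = (\<lambda>M S. Sum_any (\<lambda>n::nat. (H_plus \<alpha> \<beta> ^^ n) F M S / fact n))"

definition schur ::
    "(int \<Rightarrow> complex) \<Rightarrow> (int \<Rightarrow> complex) \<Rightarrow> (nat \<Rightarrow> nat) \<Rightarrow> pseries" where
  "schur \<alpha> \<beta> lam = (\<lambda>M. bra empty_partition (exp_H_plus \<alpha> \<beta> (const_series (ket lam)) M))"


section \<open>The vacuum expectation formulas\<close>

text \<open>\<open>(z;\<alpha>)\<^sup>k\<close> and \<open>(z|\<beta>)\<^sup>k\<close>, over an arbitrary field.\<close>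

definition semi_pow :: "'a::field \<Rightarrow> (int \<Rightarrow> 'a) \<Rightarrow> int \<Rightarrow> 'a" where
  "semi_pow z a k =
     (if k \<ge> 0 then \<Prod>i\<in>{1..k}. 1 - z * a i else \<Prod>i\<in>{k+1..0}. inverse (1 - z * a i))"

definition bar_pow :: "'a::field \<Rightarrow> (int \<Rightarrow> 'a) \<Rightarrow> int \<Rightarrow> 'a" where
  "bar_pow z b k =
     (if k \<ge> 0 then \<Prod>i\<in>{1..k}. z - b i else \<Prod>i\<in>{k+1..0}. inverse (z - b i))"

text \<open>The coefficients of \<open>\<psi>\<^sub>i\<close> in \<open>\<psi>(z|\<alpha>;\<beta>)\<close> and of \<open>\<psi>\<^sub>j\<^sup>*\<close> in \<open>\<psi>\<^sup>*(w|\<alpha>;\<beta>)\<close>.\<close>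

definition psi_coeff :: "'a::field \<Rightarrow> (int \<Rightarrow> 'a) \<Rightarrow> (int \<Rightarrow> 'a) \<Rightarrow> int \<Rightarrow> 'a" where
  "psi_coeff z a b i = z * bar_pow z b (i - 1) / semi_pow z a i"

definition psi_star_coeff :: "'a::field \<Rightarrow> (int \<Rightarrow> 'a) \<Rightarrow> (int \<Rightarrow> 'a) \<Rightarrow> int \<Rightarrow> 'a" where
  "psi_star_coeff w a b j = (1 - a j * b j) * semi_pow w a (j - 1) / bar_pow w b j"

text \<open>The rational functions above are expanded by evaluating them in the field of formal Laurent
  series: at \<open>z = fls_X\<close> for the expansion at 0, with \<open>n\<close>-th coefficient that of \<open>z\<^sup>n\<close>, and at
  \<open>z = fls_X_inv\<close> for the expansion at infinity, with \<open>n\<close>-th coefficient that of \<open>z\<^sup>-\<^sup>n\<close>.\<close>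

definition psi_at_0 :: "(int \<Rightarrow> complex) \<Rightarrow> (int \<Rightarrow> complex) \<Rightarrow> int \<Rightarrow> complex fls" where
  "psi_at_0 \<alpha> \<beta> = psi_coeff fls_X (\<lambda>i. fls_const (\<alpha> i)) (\<lambda>i. fls_const (\<beta> i))"

definition psi_at_inf :: "(int \<Rightarrow> complex) \<Rightarrow> (int \<Rightarrow> complex) \<Rightarrow> int \<Rightarrow> complex fls" where
  "psi_at_inf \<alpha> \<beta> = psi_coeff fls_X_inv (\<lambda>i. fls_const (\<alpha> i)) (\<lambda>i. fls_const (\<beta> i))"

definition psi_star_at_0 :: "(int \<Rightarrow> complex) \<Rightarrow> (int \<Rightarrow> complex) \<Rightarrow> int \<Rightarrow> complex fls" where
  "psi_star_at_0 \<alpha> \<beta> = psi_star_coeff fls_X (\<lambda>i. fls_const (\<alpha> i)) (\<lambda>i. fls_const (\<beta> i))"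

definition psi_star_at_inf :: "(int \<Rightarrow> complex) \<Rightarrow> (int \<Rightarrow> complex) \<Rightarrow> int \<Rightarrow> complex fls" where
  "psi_star_at_inf \<alpha> \<beta> = psi_star_coeff fls_X_inv (\<lambda>i. fls_const (\<alpha> i)) (\<lambda>i. fls_const (\<beta> i))"

text \<open>The vacuum expectation of \<open>\<psi>(z) \<psi>\<^sup>*(w)\<close> is \<open>z / (z - w) = (\<Sum>n\<ge>0. w\<^sup>n z\<^sup>-\<^sup>n)\<close>, coefficientwise at
  \<open>z\<^sup>-\<^sup>m w\<^sup>n\<close>, as an unconditionally convergent sum over the pairs of modes \<open>(i, j)\<close>. The modes that
  contribute (\<open>i = j \<le> 0\<close>) have poles in \<open>z\<close> only at the \<open>\<beta>\<^sub>a\<close> and in \<open>w\<close> only at the \<open>\<alpha>\<^sub>b\<^sup>-\<^sup>1\<close>, so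
  that expanding in \<open>w / z\<close> means expanding in \<open>z\<close> at infinity and in \<open>w\<close> at 0.\<close>

definition vev_psi_psi_star :: "(int \<Rightarrow> complex) \<Rightarrow> (int \<Rightarrow> complex) \<Rightarrow> bool" where
  "vev_psi_psi_star \<alpha> \<beta> \<longleftrightarrow>
     (\<forall>m n :: int.
        ((\<lambda>(i, j). fls_nth (psi_at_inf \<alpha> \<beta> i) m * fls_nth (psi_star_at_0 \<alpha> \<beta> j) n *
            bra empty_partition (psi i (psi_star j (ket empty_partition))))
         has_sum (if m = n \<and> n \<ge> 0 then 1 else 0)) UNIV)"

text \<open>Likewise, the vacuum expectation of \<open>\<psi>\<^sup>*(w) \<psi>(z)\<close> is \<open>z / (w - z) = (\<Sum>n\<ge>1. z\<^sup>n w\<^sup>-\<^sup>n)\<close>,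
  coefficientwise at \<open>w\<^sup>-\<^sup>m z\<^sup>n\<close>.\<close>

definition vev_psi_star_psi :: "(int \<Rightarrow> complex) \<Rightarrow> (int \<Rightarrow> complex) \<Rightarrow> bool" where
  "vev_psi_star_psi \<alpha> \<beta> \<longleftrightarrow>
     (\<forall>m n :: int.
        ((\<lambda>(i, j). fls_nth (psi_star_at_inf \<alpha> \<beta> j) m * fls_nth (psi_at_0 \<alpha> \<beta> i) n *
            bra empty_partition (psi_star j (psi i (ket empty_partition))))
         has_sum (if m = n \<and> n \<ge> 1 then 1 else 0)) UNIV)"

end

theory Submission
  imports Defs
begin

text \<open>The coefficients \<open>A\<^sup>k\<close> with \<open>k > 0\<close> are the powers of one upper triangular matrix, those with
  \<open>k < 0\<close> the powers of one lower triangular matrix. The currents \<open>J\<^sub>k\<close> with \<open>k > 0\<close> therefore commute, so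
  that \<open>k \<partial>/\<partial>p\<^sub>k\<close> of \<open>s\<^sub>\<lambda>\<close> is \<open>\<langle>\<emptyset>|e\<^sup>H J\<^sub>k|\<lambda>\<rangle>\<close>; and \<open>J\<^sub>k|\<lambda>\<rangle>\<close> is read off from the bead diagram of \<open>\<lambda>\<close>,
  in which adding or removing a ribbon moves one bead.

  Multiplication by \<open>p\<^sub>k\<close> corresponds to \<open>\<langle>\<emptyset>|e\<^sup>H J\<^sub>-\<^sub>k|\<lambda>\<rangle>\<close> together with \<open>[J\<^sub>l, J\<^sub>-\<^sub>k] = k \<delta>\<^sub>k\<^sub>l\<close>, and here the sums
  over intermediate states are infinite. For every monomial in \<open>p\<close> the array
  \<open>\<langle>\<emptyset>|e\<^sup>H :\<psi>\<^sub>i\<psi>\<^sub>j\<^sup>*:|\<lambda>\<rangle>\<close> turns out to be a finite sum of products \<open>u\<^sub>i w\<^sub>j\<close>, where \<open>u\<close> and \<open>w\<close> are finitely supported up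
  to Laurent coefficients of the modes of \<open>\<psi>\<^sup>*(z)\<close> and \<open>\<psi>(z)\<close> at infinity. Since \<open>A\<^sup>-\<^sup>k\<close> splits in the same way
  into Laurent coefficients at \<open>0\<close>, the vacuum expectation formulas give both the absolute
  convergence of the sums and their values. The identity then follows by induction on the
  monomial, each step being one commutator with a current \<open>J\<^sub>l\<close>.\<close>

section \<open>Mode sequences\<close>

text \<open>The vacuum formulas give biorthogonality only for modes based at index 0, whereas row p
  of A^1 is, up to a multiple of a unit vector, a mode based at p; so every base point is needed.
  Changing the base multiplies series by a quotient whose denominator may have constant term 0 (some
  \<open>a s\<close> may vanish), so only convergence and null limits are transported that way; the
  values come from the telescoping identity \<open>row_mode_product_step\<close>, which rests on ab
  + gh = 1. Infinite matrix products need not be associative. The substitute is that A^1 shifts the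
  Laurent index of a mode by one and A^(-1) undoes this: u A^1 A^(-k-1) = u A^(-k) for rows and
  A^(-k-1) A^1 w = A^(-k) w for columns, checked on unit vectors and modes and extended linearly.
  Both orders give the same number, so A^(-k) with k >= 1 has trace zero against commutators with
  the A^l. The factor k in [J_k, J_(-k)] = k is a count: the central term of a commutator with J_l
  is a sum of exactly l products of modes, each pairing to 1 if l = k and to 0 otherwise.\<close>

definition pole_fps :: "complex \<Rightarrow> complex fps" where
  "pole_fps b = inverse (1 - fps_const b * fps_X)"

lemma pole_fps_mult: "pole_fps b * (1 - fps_const b * fps_X) = 1"
  unfolding pole_fps_def by (rule inverse_mult_eq_1) simp

lemma pole_fps_nth: "fps_nth (pole_fps b) n = b ^ n"
proof -
  have "pole_fps b = Abs_fps (\<lambda>n. b ^ n)"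
  proof -
    have "Abs_fps (\<lambda>n. b ^ n) * (1 - fps_const b * fps_X) = 1"
    proof (rule fps_ext)
      fix n show "fps_nth (Abs_fps (\<lambda>n. b ^ n) * (1 - fps_const b * fps_X)) n = fps_nth 1 n"
        by (cases n) (simp_all add: right_diff_distrib mult.assoc[symmetric])
    qed
    then have "pole_fps b = Abs_fps (\<lambda>n. b ^ n) * (pole_fps b * (1 - fps_const b * fps_X))"
      by (metis mult.commute mult.left_commute mult_1_right)
    then show ?thesis
      by (simp only: pole_fps_mult mult_1_right)
  qed
  then show ?thesis by simp
qed

text \<open>With \<open>(a, b) = (\<alpha>, \<beta>)\<close> and the series variable \<open>1/z\<close> this is the product of the
  \<open>(1 - z \<alpha>\<^sub>s) / (z - \<beta>\<^sub>s)\<close>; with \<open>(a, b) = (\<beta>, \<alpha>)\<close> and the series variable \<open>z\<close> it is the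
  product of the inverses.\<close>

definition zero_pole :: "(int \<Rightarrow> complex) \<Rightarrow> (int \<Rightarrow> complex) \<Rightarrow> int \<Rightarrow> int \<Rightarrow> complex fps" where
  "zero_pole a b m n = (\<Prod>s\<in>{m<..n}. (fps_X - fps_const (a s)) * pole_fps (b s))"

lemma zero_pole_self [simp]: "n \<le> m \<Longrightarrow> zero_pole a b m n = 1"
  by (simp add: zero_pole_def)

lemma zero_pole_split:
  assumes "m \<le> k" "k \<le> n"
  shows "zero_pole a b m n = zero_pole a b m k * zero_pole a b k n"
proof -
  have "{m<..n} = {m<..k} \<union> {k<..n}" using assms by auto
  then show ?thesis unfolding zero_pole_def
    by (simp add: prod.union_disjoint ivl_disj_int)
qed

lemma zero_pole_step:
  assumes "m < n"
  shows "zero_pole a b m n = zero_pole a b m (n - 1) * ((fps_X - fps_const (a n)) * pole_fps (b n))"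
proof -
  have "{n - 1<..n} = {n}" by auto
  then show ?thesis using zero_pole_split[of m "n - 1" n a b] assms by (simp add: zero_pole_def)
qed

lemma zero_pole_neq_0: "zero_pole a b m n \<noteq> 0"
proof -
  have "fps_X - fps_const c \<noteq> 0" for c :: complex
  proof
    assume "fps_X - fps_const c = 0"
    then have "fps_nth (fps_X - fps_const c) 1 = 0" by simp
    then show False by simp
  qed
  moreover have "pole_fps c \<noteq> 0" for c using pole_fps_mult[of c] by auto
  ultimately show ?thesis unfolding zero_pole_def by auto
qed

text \<open>Under s -> 1 - s the half-open interval from m to n becomes the one from -n to -m, again
  open on the left. Every passage from rows to columns rests on this.\<close>

lemma zero_pole_reflect:
  "zero_pole (\<lambda>s. a (1 - s)) (\<lambda>s. b (1 - s)) m n = zero_pole a b (- n) (- m)"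
  unfolding zero_pole_def
  by (rule prod.reindex_bij_witness[where i = "\<lambda>s. 1 - s" and j = "\<lambda>s. 1 - s"]) auto

text \<open>For \<open>N = 0\<close> these are the Laurent coefficients of the modes of \<open>\<psi>\<^sup>*\<close> with positive index,
  respectively of \<open>\<psi>\<close> with nonpositive index, at infinity; with \<open>\<alpha>\<close> and \<open>\<beta>\<close> exchanged, \<open>col_mode\<close>
  and \<open>row_mode\<close> give those of \<open>\<psi>\<^sup>*\<close> and \<open>\<psi>\<close> at 0.\<close>

definition row_mode ::
    "(int \<Rightarrow> complex) \<Rightarrow> (int \<Rightarrow> complex) \<Rightarrow> (int \<Rightarrow> complex) \<Rightarrow> int \<Rightarrow> nat \<Rightarrow> int \<Rightarrow> complex" where
  "row_mode a b h N n i =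
     (if N < i then h i * fps_nth (fps_X * zero_pole a b N (i - 1) * pole_fps (b i)) n else 0)"

definition col_mode ::
    "(int \<Rightarrow> complex) \<Rightarrow> (int \<Rightarrow> complex) \<Rightarrow> (int \<Rightarrow> complex) \<Rightarrow> int \<Rightarrow> nat \<Rightarrow> int \<Rightarrow> complex" where
  "col_mode a b g N m j =
     (if j \<le> N then g j * fps_nth (zero_pole a b j N * pole_fps (b j)) m else 0)"

text \<open>\<open>A\<^sup>k\<close> is \<open>tri \<alpha> \<beta> 1 c k\<close> and \<open>A\<^sup>-\<^sup>k\<close> is the transpose of \<open>tri \<beta> \<alpha> c 1 k\<close>, where
  \<open>c\<^sub>i = 1 - \<alpha>\<^sub>i \<beta>\<^sub>i\<close>. General weights with \<open>g\<^sub>i h\<^sub>i = c\<^sub>i\<close> cover both cases, and the reflection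
  \<open>s \<mapsto> 1 - s\<close> of the index set turns statements about rows into statements about columns.\<close>

definition tri ::
    "(int \<Rightarrow> complex) \<Rightarrow> (int \<Rightarrow> complex) \<Rightarrow> (int \<Rightarrow> complex) \<Rightarrow> (int \<Rightarrow> complex) \<Rightarrow>
     nat \<Rightarrow> int \<Rightarrow> int \<Rightarrow> complex" where
  "tri a b g h k i j =
     (if i = j then b i ^ k
      else if i < j then g i * h j *
        fps_nth (fps_X * zero_pole a b i (j - 1) * (pole_fps (b i) * pole_fps (b j))) k
      else 0)"

abbreviation flip :: "(int \<Rightarrow> complex) \<Rightarrow> int \<Rightarrow> complex" where
  "flip a \<equiv> \<lambda>s. a (1 - s)"

lemma tri_flip: "tri (flip a) (flip b) (flip h) (flip g) k i j = tri a b g h k (1 - j) (1 - i)"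
  by (simp add: tri_def zero_pole_reflect mult_ac)

text \<open>The \<open>Suc m\<close> accounts for the factor \<open>fps_X\<close> that
  \<open>row_mode\<close> has and \<open>col_mode\<close> lacks.\<close>

lemma col_mode_flip: "col_mode a b g N m j = row_mode (flip a) (flip b) (flip g) (- N) (Suc m) (1 - j)"
  by (simp add: col_mode_def row_mode_def zero_pole_reflect mult.assoc)

lemma row_mode_0 [simp]: "row_mode a b h N 0 i = 0"
  by (simp add: row_mode_def mult.assoc)

lemma tri_below [simp]: "j < i \<Longrightarrow> tri a b g h k i j = 0"
  by (simp add: tri_def)

lemma tri_0: "tri a b g h 0 i j = (if i = j then 1 else 0)"
  by (simp add: tri_def mult.assoc)

text \<open>Cutting the product over the indices between j and i at N factors the generating series,
  and the Cauchy product then separates the variables: on the quadrant j <= N < i the matrix is a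
  sum of k + 1 products of a function of j and a function of i.\<close>

lemma tri_split:
  assumes "j \<le> N" "N < i"
  shows "tri a b g h k j i = (\<Sum>m\<le>k. col_mode a b g N m j * row_mode a b h N (k - m) i)"
proof -
  define F G where "F = zero_pole a b j N * pole_fps (b j)"
    and "G = fps_X * zero_pole a b N (i - 1) * pole_fps (b i)"
  have "fps_X * zero_pole a b j (i - 1) * (pole_fps (b j) * pole_fps (b i)) = F * G"
    using zero_pole_split[of j N "i - 1" a b] assms unfolding F_def G_def by (simp add: mult_ac)
  then have "tri a b g h k j i = g j * h i * fps_nth (F * G) k"
    using assms by (simp add: tri_def)
  also have "\<dots> = (\<Sum>m\<le>k. (g j * fps_nth F m) * (h i * fps_nth G (k - m)))"
    by (simp add: fps_mult_nth atMost_atLeast0 sum_distrib_left mult_ac)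
  finally show ?thesis using assms
    by (simp add: col_mode_def row_mode_def flip: F_def G_def)
qed

lemma tri_row:
  assumes "i < j"
  shows "tri a b g h k i j = g i * (\<Sum>m\<le>k. b i ^ m * row_mode a b h i (k - m) j)"
  using tri_split[of i i j a b g h k] assms
  by (simp add: col_mode_def pole_fps_nth sum_distrib_left mult_ac)

section \<open>Coefficient recursions and the matrix powers\<close>

lemma row_mode_rec:
  assumes "N < i"
  shows "row_mode a b h N (Suc n) i = b i * row_mode a b h N n i + h i * fps_nth (zero_pole a b N (i - 1)) n"
proof -
  define P F where "P = zero_pole a b N (i - 1)" and "F = fps_X * P * pole_fps (b i)"
  have rm: "row_mode a b h N n i = h i * fps_nth F n" for n
    using assms by (simp only: row_mode_def F_def P_def if_True)
  have "F * (1 - fps_const (b i) * fps_X) = fps_X * P"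
    using pole_fps_mult[of "b i"] unfolding F_def by (simp only: mult.assoc mult_1_right)
  then have "F = fps_X * (fps_const (b i) * F + P)"
    by (simp add: algebra_simps)
  then have "fps_nth F (Suc n) = fps_nth (fps_X * (fps_const (b i) * F + P)) (Suc n)"
    by (rule arg_cong)
  also have "\<dots> = b i * fps_nth F n + fps_nth P n"
    by simp
  finally show ?thesis by (simp add: rm algebra_simps flip: P_def)
qed

text \<open>Expanding (X - a)/(1 - bX) by means of 1/(1 - bX) = 1 + bX/(1 - bX) produces the
  coefficient 1 - ab, which is where the two weights g and h enter.\<close>

lemma zero_pole_rec:
  assumes "N < i" "g i * h i = 1 - a i * b i"
  shows "fps_nth (zero_pole a b N i) n = g i * row_mode a b h N n i - a i * fps_nth (zero_pole a b N (i - 1)) n"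
proof -
  define P Q F where "P = zero_pole a b N (i - 1)" and "Q = pole_fps (b i)" and "F = fps_X * P * Q"
  have rm: "row_mode a b h N n i = h i * fps_nth F n" for n
    using assms by (simp only: row_mode_def F_def P_def Q_def if_True)
  have "Q = 1 + fps_const (b i) * fps_X * Q"
    using pole_fps_mult[of "b i"] unfolding Q_def by (simp add: algebra_simps)
  then have e: "P * Q = P + fps_const (b i) * F"
    unfolding F_def by (metis (no_types, opaque_lifting) distrib_left mult.assoc mult.commute mult_1_right)
  have "zero_pole a b N i = F - fps_const (a i) * (P * Q)"
    using zero_pole_step[of N i a b] assms by (simp add: algebra_simps P_def Q_def F_def)
  also have "fps_nth \<dots> n = fps_nth F n - a i * (fps_nth P n + b i * fps_nth F n)"
    by (simp only: e) simp
  also have "\<dots> = g i * h i * fps_nth F n - a i * fps_nth P n"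
    unfolding assms(2) by (simp add: algebra_simps)
  finally show ?thesis by (simp add: rm flip: P_def)
qed

text \<open>Here (X - a) is multiplied out instead of the pole. This form cancels the boundary terms
  in \<open>mode_low_Suc\<close> and \<open>unit_low\<close>.\<close>

lemma row_mode_zero_pole:
  assumes "N < i"
  shows "a i * row_mode a b h N (Suc n) i - row_mode a b h N n i = - h i * fps_nth (zero_pole a b N i) n"
proof -
  define P F where "P = zero_pole a b N (i - 1) * pole_fps (b i)" and "F = fps_X * P"
  have "zero_pole a b N i = F - fps_const (a i) * P"
    using zero_pole_step[of N i a b] assms unfolding P_def F_def by (simp add: algebra_simps)
  then have Z: "fps_nth (zero_pole a b N i) n = fps_nth F n - a i * fps_nth P n"
    by simp
  have F: "fps_nth F (Suc n) = fps_nth P n"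
    by (simp add: F_def)
  have "row_mode a b h N n i = h i * fps_nth F n" for n
    using assms by (simp only: row_mode_def F_def P_def if_True mult.assoc)
  then show ?thesis by (simp only: F Z) (simp add: algebra_simps)
qed

lemma tri_1: "i < j \<Longrightarrow> tri a b g h (Suc 0) i j = g i * h j * fps_nth (zero_pole a b i (j - 1)) 0"
  by (simp add: tri_def mult.assoc pole_fps_nth)

locale weights =
  fixes a b g h :: "int \<Rightarrow> complex"
  assumes weights: "g i * h i = 1 - a i * b i"
begin

text \<open>Raising i by one multiplies the constant terms by \<open>- a (i + 1)\<close> and adds
  one summand, which is the recursion \<open>zero_pole_rec\<close>. With n >= 1 the induction starts
  correctly: the empty sum must equal coefficient n of the series 1.\<close>

lemma row_mode_partial:
  assumes "n \<ge> 1" "N \<le> i"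
  shows "(\<Sum>s\<in>{N<..i}. g s * row_mode a b h N n s * fps_nth (zero_pole a b s i) 0) = fps_nth (zero_pole a b N i) n"
  using assms(2)
proof (induction i rule: int_ge_induct)
  case base
  then show ?case using assms by simp
next
  case (step i)
  have "{N<..i + 1} = insert (i + 1) {N<..i}" using step by auto
  moreover have "fps_nth (zero_pole a b s (i + 1)) 0 = - a (i + 1) * fps_nth (zero_pole a b s i) 0"
    if "s \<in> {N<..i}" for s
    using zero_pole_step[of s "i + 1" a b] that by (simp add: pole_fps_nth)
  ultimately have "(\<Sum>s\<in>{N<..i + 1}. g s * row_mode a b h N n s * fps_nth (zero_pole a b s (i + 1)) 0)
     = g (i + 1) * row_mode a b h N n (i + 1)
       + - a (i + 1) * (\<Sum>s\<in>{N<..i}. g s * row_mode a b h N n s * fps_nth (zero_pole a b s i) 0)"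
    by (simp add: sum_distrib_left mult_ac)
  then show ?case
    using step zero_pole_rec[of N "i + 1" g h a b n] weights by simp
qed

text \<open>So A^1 acts on a row mode by raising its Laurent index. For n = 0 the left side is 0
  while the right side need not be. The lower limit m is free because the mode vanishes up to
  N.\<close>

lemma row_mode_tri:
  assumes "n \<ge> 1" "m \<le> N + 1"
  shows "(\<Sum>s\<in>{m..i}. row_mode a b h N n s * tri a b g h 1 s i) = row_mode a b h N (Suc n) i"
proof (cases "N < i")
  case True
  have "{m..i} \<supseteq> {N<..i}" using assms by auto
  moreover have "row_mode a b h N n s = 0" if "s \<in> {m..i} - {N<..i}" for s
    using that by (auto simp: row_mode_def)
  ultimately have "(\<Sum>s\<in>{m..i}. row_mode a b h N n s * tri a b g h 1 s i)
     = (\<Sum>s\<in>{N<..i}. row_mode a b h N n s * tri a b g h 1 s i)"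
    by (intro sum.mono_neutral_right) auto
  also have "{N<..i} = insert i {N<..i - 1}" using True by auto
  also have "(\<Sum>s\<in>\<dots>. row_mode a b h N n s * tri a b g h 1 s i)
     = row_mode a b h N n i * b i + (\<Sum>s\<in>{N<..i - 1}. row_mode a b h N n s * tri a b g h 1 s i)"
    by (simp add: tri_def)
  also have "(\<Sum>s\<in>{N<..i - 1}. row_mode a b h N n s * tri a b g h 1 s i)
     = h i * (\<Sum>s\<in>{N<..i - 1}. g s * row_mode a b h N n s * fps_nth (zero_pole a b s (i - 1)) 0)"
    by (simp add: sum_distrib_left tri_1 mult_ac)
  also have "\<dots> = h i * fps_nth (zero_pole a b N (i - 1)) n"
    using True assms by (subst row_mode_partial) auto
  finally show ?thesis using row_mode_rec[OF True, of a b h n] by (simp add: mult_ac)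
next
  case False
  then show ?thesis by (simp add: row_mode_def)
qed

lemma tri_Suc_right:
  "tri a b g h (Suc k) i j = (\<Sum>m\<in>{i..j}. tri a b g h k i m * tri a b g h 1 m j)"
proof -
  consider "j < i" | "i = j" | "i < j" by linarith
  then show ?thesis
  proof cases
    case 3
    \<comment> \<open>Row i of the k-th matrix is a multiple of a unit vector plus modes based at i,
      on which \<open>row_mode_tri\<close> acts. The summand t = k drops out because
      \<open>row_mode\<close> vanishes at Laurent index 0.\<close>
    have row: "tri a b g h k i m = b i ^ k * (if m = i then 1 else 0)
        + g i * (\<Sum>t<k. b i ^ t * row_mode a b h i (k - t) m)" if "m \<ge> i" for m
    proof (cases "m = i")
      case True
      then show ?thesis by (simp add: tri_def row_mode_def)
    next
      case False
      then show ?thesis using that tri_row[of i m a b g h k] by (simp add: lessThan_Suc_atMost[symmetric])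
    qed
    have "(\<Sum>m\<in>{i..j}. tri a b g h k i m * tri a b g h 1 m j)
      = (\<Sum>m\<in>{i..j}. b i ^ k * (if m = i then tri a b g h 1 m j else 0)
          + g i * (\<Sum>t<k. b i ^ t * (row_mode a b h i (k - t) m * tri a b g h 1 m j)))"
      by (rule sum.cong) (auto simp: row algebra_simps sum_distrib_left)
    also have "\<dots> = b i ^ k * tri a b g h 1 i j
        + g i * (\<Sum>t<k. b i ^ t * (\<Sum>m\<in>{i..j}. row_mode a b h i (k - t) m * tri a b g h 1 m j))"
      using 3 by (simp add: sum.distrib sum_distrib_left[symmetric] sum.delta)
         (simp add: sum_distrib_left sum.swap[of _ "{i..j}"])
    also have "\<dots> = b i ^ k * tri a b g h 1 i j + g i * (\<Sum>t<k. b i ^ t * row_mode a b h i (Suc k - t) j)"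
    proof -
      have "(\<Sum>m\<in>{i..j}. row_mode a b h i (k - t) m * tri a b g h 1 m j) = row_mode a b h i (Suc k - t) j"
        if "t < k" for t
        using that by (subst row_mode_tri) (auto simp: Suc_diff_le)
      then show ?thesis by simp
    qed
    also have "\<dots> = tri a b g h (Suc k) i j"
      using 3 tri_row[of i j a b g h "Suc k"] tri_row[of i j a b g h 1]
      by (simp add: lessThan_Suc_atMost[symmetric] algebra_simps)
    finally show ?thesis by simp
  qed (simp_all add: tri_def)
qed

end

section \<open>Change of the base point\<close>

text \<open>Stripping the largest power X^d from D leaves an invertible series. The coefficients G
  and the shift d depend only on D and E, so a whole family of series is covered by the same finite
  combinations.\<close>

lemma fps_quotient_nth:
  fixes D E :: "'a::field fps"
  assumes "D \<noteq> 0"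
  obtains G d where "\<And>F F' n. F' * D = F * E \<Longrightarrow> fps_nth F' n = (\<Sum>s\<le>n + d. G s * fps_nth F (n + d - s))"
proof -
  define d where "d = subdegree D"
  define U where "U = inverse (fps_shift d D)"
  have D: "D = fps_shift d D * fps_X ^ d"
    unfolding d_def by (rule subdegree_decompose)
  have "fps_nth (fps_shift d D) 0 \<noteq> 0"
    using assms by (simp add: d_def)
  then have U: "fps_shift d D * U = 1"
    unfolding U_def by (rule inverse_mult_eq_1')
  have "fps_nth F' n = (\<Sum>s\<le>n + d. fps_nth (E * U) s * fps_nth F (n + d - s))" if "F' * D = F * E" for F F' n
  proof -
    have "F * (E * U) = F' * D * U" using that by (simp only: mult.assoc)
    also have "\<dots> = F' * fps_X ^ d * (fps_shift d D * U)"
      by (subst D) (simp only: mult_ac)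
    finally have "F' * fps_X ^ d = (E * U) * F"
      by (simp only: U mult_1_right) (simp only: mult.commute)
    then have "fps_nth (F' * fps_X ^ d) (n + d) = fps_nth ((E * U) * F) (n + d)"
      by (rule arg_cong)
    then have "fps_nth F' n = fps_nth ((E * U) * F) (n + d)"
      by (simp only: fps_X_power_mult_right_nth) simp
    also have "\<dots> = (\<Sum>s\<le>n + d. fps_nth (E * U) s * fps_nth F (n + d - s))"
      by (simp only: fps_mult_nth[of "E * U"] atMost_atLeast0)
    finally show ?thesis .
  qed
  then show ?thesis by (rule that)
qed

text \<open>The class \<open>C\<close> will be that of the summable families and that of the null sequences. A change
  of the base point multiplies a family of series by \<open>E / D\<close>, where \<open>D\<close> need not be invertible.\<close>

lemma coeff_class_quotient:
  fixes F F' G :: "int \<Rightarrow> complex fps"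
  assumes zero: "C (\<lambda>_. 0)" and add: "\<And>u v. C u \<Longrightarrow> C v \<Longrightarrow> C (\<lambda>i. u i + v i)"
    and scale: "\<And>c u. C u \<Longrightarrow> C (\<lambda>i. c * u i)"
    and base: "\<And>n m. C (\<lambda>i. fps_nth (F i) n * fps_nth (G i) m)"
    and rel: "\<And>i. F' i * D = F i * E" and "D \<noteq> 0"
  shows "C (\<lambda>i. fps_nth (F' i) n * fps_nth (G i) m)"
proof -
  obtain H d where H: "\<And>F F' n. F' * D = F * E \<Longrightarrow> fps_nth F' n = (\<Sum>s\<le>n + d. H s * fps_nth F (n + d - s))"
    by (rule fps_quotient_nth[OF \<open>D \<noteq> 0\<close>, of E]) (rule that)
  have "C (\<lambda>i. \<Sum>s\<in>S. H s * (fps_nth (F i) (n + d - s) * fps_nth (G i) m))" if "finite S" for S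
    using that
  proof (induction S rule: finite_induct)
    case empty
    then show ?case by (simp add: zero)
  next
    case (insert s S)
    have "C (\<lambda>i. H s * (fps_nth (F i) (n + d - s) * fps_nth (G i) m)
        + (\<Sum>s\<in>S. H s * (fps_nth (F i) (n + d - s) * fps_nth (G i) m)))"
      by (rule add, rule scale, rule base, rule insert.IH)
    then show ?case using insert by simp
  qed
  from this[of "{..n + d}"] show ?thesis
    by (simp add: H[OF rel] sum_distrib_right mult.assoc)
qed

lemma coeff_class_quotient2:
  fixes F F' G G' :: "int \<Rightarrow> complex fps"
  assumes "C (\<lambda>_. 0)" "\<And>u v. C u \<Longrightarrow> C v \<Longrightarrow> C (\<lambda>i. u i + v i)"
    "\<And>c u. C u \<Longrightarrow> C (\<lambda>i. c * u i)"
    and base: "\<And>n m. C (\<lambda>i. fps_nth (F i) n * fps_nth (G i) m)"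
    and "\<And>i. F' i * D = F i * E" "D \<noteq> 0" "\<And>i. G' i * D' = G i * E'" "D' \<noteq> 0"
  shows "C (\<lambda>i. fps_nth (F' i) n * fps_nth (G' i) m)"
proof -
  have 1: "C (\<lambda>i. fps_nth (F' i) n * fps_nth (G i) m)" for n m
    by (rule coeff_class_quotient[of C F G F' D E]) (fact assms)+
  have 2: "C (\<lambda>i. fps_nth (G i) n * fps_nth (F' i) m)" for n m
    by (subst mult.commute) (rule 1)
  have "C (\<lambda>i. fps_nth (G' i) m * fps_nth (F' i) n)"
    by (rule coeff_class_quotient[of C G F' G' D' E']) (fact assms 2)+
  then show ?thesis by (subst mult.commute)
qed

text \<open>When N <= N' the denominator is the product over the skipped indices. Its constant term
  is a product of numbers \<open>- a s\<close> and can be 0, hence the multiplicative form with a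
  merely nonzero D.\<close>

lemma zero_pole_change_base:
  obtains D E where "D \<noteq> 0" "\<And>i. N \<le> i \<Longrightarrow> N' \<le> i \<Longrightarrow> zero_pole a b N' i * D = zero_pole a b N i * E"
proof (cases "N \<le> N'")
  case True
  show ?thesis
  proof (rule that[of "zero_pole a b N N'" 1])
    fix i assume "N \<le> i" "N' \<le> i"
    then show "zero_pole a b N' i * zero_pole a b N N' = zero_pole a b N i * 1"
      using zero_pole_split[of N N' i a b] True by (simp add: mult.commute)
  qed (rule zero_pole_neq_0)
next
  case False
  show ?thesis
  proof (rule that[of 1 "zero_pole a b N' N"])
    fix i assume "N \<le> i" "N' \<le> i"
    then show "zero_pole a b N' i * 1 = zero_pole a b N i * zero_pole a b N' N"
      using zero_pole_split[of N' N i a b] False by (simp add: mult.commute)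
  qed simp
qed

text \<open>The modes collected into series over all Laurent indices, the form in which
  \<open>coeff_class_quotient2\<close> consumes them.\<close>

definition row_fps where
  "row_fps a b h N i = (if N < i then fps_const (h i) * (fps_X * zero_pole a b N (i - 1) * pole_fps (b i)) else 0)"

lemma row_mode_fps: "row_mode a b h N n i = fps_nth (row_fps a b h N i) n"
  unfolding row_mode_def row_fps_def by (cases "N < i") (simp_all only: if_True if_False fps_mult_left_const_nth fps_zero_nth)

lemma row_fps_change_base:
  obtains D E where "D \<noteq> 0" "\<And>i. N < i \<Longrightarrow> N' < i \<Longrightarrow> row_fps a b h N' i * D = row_fps a b h N i * E"
proof -
  obtain D E where DE: "D \<noteq> 0" "\<And>i. N \<le> i \<Longrightarrow> N' \<le> i \<Longrightarrow> zero_pole a b N' i * D = zero_pole a b N i * E"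
    by (rule zero_pole_change_base[where N = N and N' = N' and a = a and b = b]) (rule that)
  show ?thesis
  proof (rule that[OF DE(1)])
    fix i assume i: "N < i" "N' < i"
    have "row_fps a b h N' i * D = fps_const (h i) * fps_X * pole_fps (b i) * (zero_pole a b N' (i - 1) * D)"
      using i by (simp add: row_fps_def mult_ac)
    also have "\<dots> = row_fps a b h N i * E"
      using i DE(2)[of "i - 1"] by (simp add: row_fps_def mult_ac)
    finally show "row_fps a b h N' i * D = row_fps a b h N i * E" .
  qed
qed

lemma summable_on_cofinite_shift:
  fixes f :: "int \<Rightarrow> complex"
  assumes "f summable_on {K<..}" "\<And>i. i \<le> L \<Longrightarrow> f i = 0"
  shows "f summable_on UNIV"
proof -
  have "f summable_on {L..K} \<union> {K<..}"
    by (rule summable_on_Un_disjoint) (use assms in auto)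
  then show ?thesis
  proof (rule iffD1[OF summable_on_cong_neutral, rotated -1])
    fix i assume "i \<in> UNIV - ({L..K} \<union> {K<..})"
    then show "f i = 0" using assms(2)[of i] by auto
  qed auto
qed

lemma tendsto_int_at_top_iff:
  fixes f :: "int \<Rightarrow> complex"
  shows "(f \<longlongrightarrow> l) at_top \<longleftrightarrow> (\<lambda>k. f (N + int k)) \<longlonglongrightarrow> l"
proof
  assume "(f \<longlongrightarrow> l) at_top"
  moreover have "filterlim (\<lambda>k. N + int k) at_top sequentially"
    unfolding filterlim_at_top eventually_at_top_linorder
  proof
    fix Z :: int
    show "\<exists>M. \<forall>k\<ge>M. Z \<le> N + int k"
      by (rule exI[of _ "nat (Z - N)"]) auto
  qed
  ultimately show "(\<lambda>k. f (N + int k)) \<longlonglongrightarrow> l"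
    by (rule filterlim_compose)
next
  assume *: "(\<lambda>k. f (N + int k)) \<longlonglongrightarrow> l"
  have "filterlim (\<lambda>i. nat (i - N)) sequentially (at_top :: int filter)"
    unfolding filterlim_at_top eventually_at_top_linorder
  proof
    fix Z :: nat
    show "\<exists>M. \<forall>i\<ge>M. Z \<le> nat (i - N)"
      by (rule exI[of _ "int Z + N"]) auto
  qed
  from filterlim_compose[OF * this] have "((\<lambda>i. f (N + int (nat (i - N)))) \<longlongrightarrow> l) at_top" .
  moreover have "eventually (\<lambda>i. f (N + int (nat (i - N))) = f i) at_top"
    unfolding eventually_at_top_linorder by (rule exI[of _ N]) auto
  ultimately show "(f \<longlongrightarrow> l) at_top"
    by (rule Lim_transform_eventually)
qed

lemma has_sum_greaterThan_sums:
  fixes f :: "int \<Rightarrow> complex"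
  assumes "(f has_sum S) {N<..}"
  shows "(\<lambda>k. f (N + 1 + int k)) sums S"
proof -
  have "bij_betw (\<lambda>k. N + 1 + int k) UNIV {N<..}"
    by (rule bij_betwI[of _ _ _ "\<lambda>i. nat (i - N - 1)"]) auto
  from has_sum_reindex_bij_betw[OF this, of f S] assms show ?thesis
    by (intro has_sum_imp_sums) simp
qed

section \<open>Telescoping and biorthogonality at every base point\<close>

context weights
begin

text \<open>An identity of Christoffel-Darboux type. With x, y the modes and p, q the coefficients
  of the products up to i - 1, the recursions combine into (bx + hp)(ay + gq) + (gx - ap)(hy - bq) =
  (ab + gh)(xy + pq), and ab + gh = 1. Summed over i, the products of \<open>zero_pole\<close>
  coefficients telescope.\<close>

lemma row_mode_product_step:
  assumes "N < i"
  shows "row_mode a b h N (Suc n) i * row_mode b a g N (Suc m) i = row_mode a b h N n i * row_mode b a g N m i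
    + fps_nth (zero_pole a b N (i - 1)) n * fps_nth (zero_pole b a N (i - 1)) m
    - fps_nth (zero_pole a b N i) n * fps_nth (zero_pole b a N i) m"
proof -
  have w: "h i * g i = 1 - b i * a i" using weights by (simp add: mult.commute)
  define x y p q where "x = row_mode a b h N n i" and "y = row_mode b a g N m i"
    and "p = fps_nth (zero_pole a b N (i - 1)) n" and "q = fps_nth (zero_pole b a N (i - 1)) m"
  have "(b i * x + h i * p) * (a i * y + g i * q) + (g i * x - a i * p) * (h i * y - b i * q)
      = (a i * b i + g i * h i) * (x * y + p * q)"
    by (simp add: algebra_simps)
  then show ?thesis
    unfolding row_mode_rec[OF assms] zero_pole_rec[of N i g h a b, OF assms weights] zero_pole_rec[of N i h g b a, OF assms w]
    by (simp add: weights algebra_simps flip: x_def y_def p_def q_def)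
qed

lemma row_mode_product_partial_sum:
  "(\<Sum>k<K. row_mode a b h N (Suc n) (N + 1 + int k) * row_mode b a g N (Suc m) (N + 1 + int k))
   = (\<Sum>k<K. row_mode a b h N n (N + 1 + int k) * row_mode b a g N m (N + 1 + int k))
     + (if n = 0 \<and> m = 0 then 1 else 0)
     - fps_nth (zero_pole a b N (N + int K)) n * fps_nth (zero_pole b a N (N + int K)) m"
  by (induction K) (auto simp: row_mode_product_step algebra_simps)

end

text \<open>For the original data the assumption is the diagonal form of the expectation of psi_star
  psi, over the positive modes. For the data reflected by s -> 1 - s it is that of psi
  psi_star.\<close>

locale row_side = weights +
  assumes vacuum: "n \<ge> 1 \<Longrightarrow> m \<ge> 1 \<Longrightarrow>
    ((\<lambda>i. row_mode a b h 0 n i * row_mode b a g 0 m i) has_sum (if n = m then 1 else 0)) {0<..}"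
begin

text \<open>At base 0 this product is the remainder between two convergent partial sums, and the
  delta terms of their limits cancel. Base N follows by change of base, after replacing the series
  by 0 below K so that the proportionality holds for all i.\<close>

lemma zero_pole_product_tendsto_0:
  "((\<lambda>i. fps_nth (zero_pole a b N i) n * fps_nth (zero_pole b a N i) m) \<longlongrightarrow> 0) at_top"
proof -
  have S: "(\<lambda>K. \<Sum>k<K. row_mode a b h 0 n (1 + int k) * row_mode b a g 0 m (1 + int k))
      \<longlonglongrightarrow> (if n = m \<and> n \<ge> 1 then 1 else 0)" for n m
  proof (cases "n \<ge> 1 \<and> m \<ge> 1")
    case True
    then show ?thesis using has_sum_greaterThan_sums[OF vacuum[of n m]] by (auto simp: sums_def)
  next
    case False
    then have "row_mode a b h 0 n i * row_mode b a g 0 m i = 0" for i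
      by (cases "n = 0") (auto simp: not_le)
    then show ?thesis using False by (simp only: sum.neutral_const) auto
  qed
  have lim0: "((\<lambda>i. fps_nth (zero_pole a b 0 i) n * fps_nth (zero_pole b a 0 i) m) \<longlongrightarrow> 0) at_top" for n m
  proof -
    have "(\<lambda>K. (\<Sum>k<K. row_mode a b h 0 n (1 + int k) * row_mode b a g 0 m (1 + int k))
        + (if n = 0 \<and> m = 0 then 1 else 0)
        - (\<Sum>k<K. row_mode a b h 0 (Suc n) (1 + int k) * row_mode b a g 0 (Suc m) (1 + int k)))
       \<longlonglongrightarrow> (if n = m \<and> n \<ge> 1 then 1 else 0) + (if n = 0 \<and> m = 0 then 1 else 0)
          - (if Suc n = Suc m \<and> Suc n \<ge> 1 then 1 else 0)"
      by (intro tendsto_intros S)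
    moreover have "(if n = m \<and> n \<ge> 1 then 1 else 0) + (if n = 0 \<and> m = 0 then 1 else 0)
          - (if Suc n = Suc m \<and> Suc n \<ge> 1 then 1 else 0) = (0::complex)"
      by auto
    ultimately have "(\<lambda>K. fps_nth (zero_pole a b 0 (0 + int K)) n * fps_nth (zero_pole b a 0 (0 + int K)) m) \<longlonglongrightarrow> 0"
      using row_mode_product_partial_sum[of 0] by simp
    then show ?thesis using tendsto_int_at_top_iff[of _ 0 0] by simp
  qed
  define K where "K = max 0 N"
  define cut where "cut P i = (if K \<le> i then P i else (0 :: complex fps))" for P i
  obtain D E where DE: "D \<noteq> 0" "\<And>i. 0 \<le> i \<Longrightarrow> N \<le> i \<Longrightarrow> zero_pole a b N i * D = zero_pole a b 0 i * E"
    by (rule zero_pole_change_base[where N = 0 and N' = N and a = a and b = b]) (rule that)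
  obtain D' E' where DE': "D' \<noteq> 0" "\<And>i. 0 \<le> i \<Longrightarrow> N \<le> i \<Longrightarrow> zero_pole b a N i * D' = zero_pole b a 0 i * E'"
    by (rule zero_pole_change_base[where N = 0 and N' = N and a = b and b = a]) (rule that)
  have rel: "cut (zero_pole a b N) i * D = cut (zero_pole a b 0) i * E" for i
    using DE(2)[of i] by (simp add: cut_def K_def)
  have rel': "cut (zero_pole b a N) i * D' = cut (zero_pole b a 0) i * E'" for i
    using DE'(2)[of i] by (simp add: cut_def K_def)
  have cut: "eventually (\<lambda>i. fps_nth (P i) n * fps_nth (Q i) m = fps_nth (cut P i) n * fps_nth (cut Q i) m) at_top"
    for P Q n m
    unfolding cut_def eventually_at_top_linorder by (intro exI[of _ K]) simp
  have base: "((\<lambda>i. fps_nth (cut (zero_pole a b 0) i) n * fps_nth (cut (zero_pole b a 0) i) m) \<longlongrightarrow> 0) at_top" for n m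
    by (rule Lim_transform_eventually[OF lim0 cut])
  have "((\<lambda>i. fps_nth (cut (zero_pole a b N) i) n * fps_nth (cut (zero_pole b a N) i) m) \<longlongrightarrow> 0) at_top"
  proof (rule coeff_class_quotient2[of "\<lambda>u. (u \<longlongrightarrow> 0) at_top", OF _ _ _ _ rel DE(1) rel' DE'(1)])
    fix u v :: "int \<Rightarrow> complex" and c :: complex
    assume u: "(u \<longlongrightarrow> 0) at_top"
    then show "((\<lambda>i. c * u i) \<longlongrightarrow> 0) at_top" by (rule tendsto_mult_right_zero)
    assume "(v \<longlongrightarrow> 0) at_top"
    with u show "((\<lambda>i. u i + v i) \<longlongrightarrow> 0) at_top" by (rule tendsto_add_zero)
  qed (simp, rule base)
  moreover have "eventually (\<lambda>i. fps_nth (cut P i) n * fps_nth (cut Q i) m = fps_nth (P i) n * fps_nth (Q i) m) at_top" for P Q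
    unfolding cut_def eventually_at_top_linorder by (intro exI[of _ K]) simp
  ultimately show ?thesis
    by (rule Lim_transform_eventually)
qed

text \<open>The two bases are independent because the row and column factors of an array carry
  unrelated base points. Only finitely many indices lie between the start of the support and the
  range where the change of base applies.\<close>

lemma row_mode_product_summable:
  "(\<lambda>i. row_mode a b h N n i * row_mode b a g N' m i) summable_on UNIV"
proof -
  define K where "K = max 0 (max N N')"
  obtain D E where DE: "D \<noteq> 0" "\<And>i. 0 < i \<Longrightarrow> N < i \<Longrightarrow> row_fps a b h N i * D = row_fps a b h 0 i * E"
    by (rule row_fps_change_base[where N = 0 and N' = N and a = a and b = b and h = h]) (rule that)
  obtain D' E' where DE': "D' \<noteq> 0" "\<And>i. 0 < i \<Longrightarrow> N' < i \<Longrightarrow> row_fps b a g N' i * D' = row_fps b a g 0 i * E'"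
    by (rule row_fps_change_base[where N = 0 and N' = N' and a = b and b = a and h = g]) (rule that)
  define cut where "cut P i = (if K < i then P i else (0 :: complex fps))" for P i
  have rel: "cut (row_fps a b h N) i * D = cut (row_fps a b h 0) i * E" for i
    using DE(2)[of i] by (simp add: cut_def K_def)
  have rel': "cut (row_fps b a g N') i * D' = cut (row_fps b a g 0) i * E'" for i
    using DE'(2)[of i] by (simp add: cut_def K_def)
  have cut: "(\<lambda>i. fps_nth (cut P i) n * fps_nth (cut Q i) m) summable_on {K<..}
     \<longleftrightarrow> (\<lambda>i. fps_nth (P i) n * fps_nth (Q i) m) summable_on {K<..}" for P Q n m
    by (rule summable_on_cong) (simp add: cut_def)
  have 0: "(\<lambda>i. row_mode a b h 0 n i * row_mode b a g 0 m i) summable_on {K<..}" for n m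
  proof (cases "n \<ge> 1 \<and> m \<ge> 1")
    case True
    then have "(\<lambda>i. row_mode a b h 0 n i * row_mode b a g 0 m i) summable_on {0<..}"
      using vacuum[of n m] by (blast intro: has_sum_imp_summable)
    then show ?thesis by (rule summable_on_subset_banach) (auto simp: K_def)
  next
    case False
    then have "row_mode a b h 0 n i * row_mode b a g 0 m i = 0" for i
      by (cases "n = 0") (auto simp: not_le)
    then show ?thesis by (simp only: summable_on_0_simp)
  qed
  have base: "(\<lambda>i. fps_nth (cut (row_fps a b h 0) i) n * fps_nth (cut (row_fps b a g 0) i) m) summable_on {K<..}" for n m
    unfolding cut using 0 by (simp add: row_mode_fps)
  have "(\<lambda>i. fps_nth (cut (row_fps a b h N) i) n * fps_nth (cut (row_fps b a g N') i) m) summable_on {K<..}"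
  proof (rule coeff_class_quotient2[of "\<lambda>u. u summable_on {K<..}", OF _ _ _ _ rel DE(1) rel' DE'(1)])
    fix u v :: "int \<Rightarrow> complex" and c :: complex
    assume u: "u summable_on {K<..}"
    then show "(\<lambda>i. c * u i) summable_on {K<..}" by (rule summable_on_cmult_right)
    assume "v summable_on {K<..}"
    with u show "(\<lambda>i. u i + v i) summable_on {K<..}" by (rule summable_on_add)
  qed (simp, rule base)
  then have "(\<lambda>i. row_mode a b h N n i * row_mode b a g N' m i) summable_on {K<..}"
    unfolding cut by (simp add: row_mode_fps)
  then show ?thesis
    by (rule summable_on_cofinite_shift[where L = N]) (simp add: row_mode_def)
qed

text \<open>With the remainder tending to 0, the telescoping identity says that the sum at (n + 1, m
  + 1) is the sum at (n, m) plus 1 if n = m = 0. Since the sum vanishes when n = 0 or m = 0, all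
  values follow without evaluating the change of base.\<close>

lemma row_mode_orthogonal:
  "((\<lambda>i. row_mode a b h N n i * row_mode b a g N m i) has_sum (if n = m \<and> n \<ge> 1 then 1 else 0)) UNIV"
proof -
  define S where "S n m = infsum (\<lambda>i. row_mode a b h N n i * row_mode b a g N m i) UNIV" for n m
  have S: "((\<lambda>i. row_mode a b h N n i * row_mode b a g N m i) has_sum S n m) UNIV" for n m
    unfolding S_def using row_mode_product_summable by (rule has_sum_infsum)
  have lim: "(\<lambda>K. \<Sum>k<K. row_mode a b h N n (N + 1 + int k) * row_mode b a g N m (N + 1 + int k)) \<longlonglongrightarrow> S n m" for n m
  proof -
    have "((\<lambda>i. row_mode a b h N n i * row_mode b a g N m i) has_sum S n m) {N<..}"
      by (rule iffD1[OF has_sum_cong_neutral S]) (auto simp: row_mode_def)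
    from has_sum_greaterThan_sums[OF this] show ?thesis by (simp add: sums_def)
  qed
  have step: "S (Suc n) (Suc m) = S n m + (if n = 0 \<and> m = 0 then 1 else 0)" for n m
  proof -
    have "(\<lambda>K. (\<Sum>k<K. row_mode a b h N n (N + 1 + int k) * row_mode b a g N m (N + 1 + int k))
     + (if n = 0 \<and> m = 0 then 1 else 0)
     - fps_nth (zero_pole a b N (N + int K)) n * fps_nth (zero_pole b a N (N + int K)) m)
      \<longlonglongrightarrow> S n m + (if n = 0 \<and> m = 0 then 1 else 0) - 0"
      using iffD1[OF tendsto_int_at_top_iff[of _ 0 N], OF zero_pole_product_tendsto_0[of N n m]]
      by (intro tendsto_intros lim)
    moreover note lim[of "Suc n" "Suc m"]
    ultimately show ?thesis
      unfolding row_mode_product_partial_sum by (auto dest: LIMSEQ_unique)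
  qed
  have "S n m = (if n = m \<and> n \<ge> 1 then 1 else 0)"
  proof (induction n arbitrary: m)
    case 0
    then show ?case by (simp add: S_def)
  next
    case (Suc n)
    then show ?case by (cases m) (auto simp: step, simp add: S_def)
  qed
  with S[of n m] show ?thesis by simp
qed

end

section \<open>The action on row vectors\<close>

lemma has_sum_sum:
  fixes f :: "'i \<Rightarrow> 'x \<Rightarrow> complex"
  assumes "finite S" "\<And>s. s \<in> S \<Longrightarrow> (f s has_sum c s) X"
  shows "((\<lambda>x. \<Sum>s\<in>S. f s x) has_sum (\<Sum>s\<in>S. c s)) X"
  using assms by (induction S rule: finite_induct) (auto intro!: has_sum_add)

lemma has_sum_single:
  fixes c :: complex
  shows "((\<lambda>i. if i = p then c else 0) has_sum c) UNIV"
  by (rule has_sum_finite_neutralI[of "{p}"]) auto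

text \<open>The skipped factors form a fixed series F, and multiplying by F is a finite convolution.
  The term s = n is missing because the mode at Laurent index 0 is zero.\<close>

lemma row_mode_change_base:
  assumes "N \<le> j" "j < i"
  shows "row_mode a b h N n i = (\<Sum>s<n. fps_nth (zero_pole a b N j) s * row_mode a b h j (n - s) i)"
proof -
  define F G where "F = zero_pole a b N j" and "G = fps_X * zero_pole a b j (i - 1) * pole_fps (b i)"
  have "fps_X * zero_pole a b N (i - 1) * pole_fps (b i) = F * G"
    using zero_pole_split[of N j "i - 1" a b] assms unfolding F_def G_def by (simp add: mult_ac)
  then have "row_mode a b h N n i = h i * fps_nth (F * G) n"
    using assms by (simp add: row_mode_def)
  also have "\<dots> = (\<Sum>s\<le>n. fps_nth F s * (h i * fps_nth G (n - s)))"
    by (simp add: fps_mult_nth atMost_atLeast0 sum_distrib_left mult_ac)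
  also have "\<dots> = (\<Sum>s\<le>n. fps_nth F s * row_mode a b h j (n - s) i)"
    using assms by (simp only: row_mode_def G_def if_True)
  also have "\<dots> = (\<Sum>s<n. fps_nth F s * row_mode a b h j (n - s) i)"
    by (rule sum.mono_neutral_right) auto
  finally show ?thesis by (simp only: F_def)
qed

text \<open>The linear span of the unit vectors and of the modes at all base points: large enough to
  be stable under right multiplication by the A^l, small enough that products with A^(-k)
  converge.\<close>

inductive_set rowspace :: "(int \<Rightarrow> complex) \<Rightarrow> (int \<Rightarrow> complex) \<Rightarrow> (int \<Rightarrow> complex) \<Rightarrow> (int \<Rightarrow> complex) set"
  for a b h where
  zero: "(\<lambda>_. 0) \<in> rowspace a b h"
| unit: "(\<lambda>i. if i = p then 1 else 0) \<in> rowspace a b h"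
| mode: "n \<ge> 1 \<Longrightarrow> row_mode a b h N n \<in> rowspace a b h"
| add: "u \<in> rowspace a b h \<Longrightarrow> v \<in> rowspace a b h \<Longrightarrow> (\<lambda>i. u i + v i) \<in> rowspace a b h"
| scale: "u \<in> rowspace a b h \<Longrightarrow> (\<lambda>i. c * u i) \<in> rowspace a b h"

definition vanishes_below :: "int \<Rightarrow> (int \<Rightarrow> complex) \<Rightarrow> bool" where
  "vanishes_below L u \<longleftrightarrow> (\<forall>i<L. u i = 0)"

lemma vanishes_below_mono: "vanishes_below L u \<Longrightarrow> L' \<le> L \<Longrightarrow> vanishes_below L' u"
  by (simp add: vanishes_below_def)

lemma rowspace_vanishes_below: "u \<in> rowspace a b h \<Longrightarrow> \<exists>L. vanishes_below L u"
proof (induction rule: rowspace.induct)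
  case (unit p)
  show ?case by (rule exI[of _ p]) (simp add: vanishes_below_def)
next
  case (mode n N)
  show ?case by (rule exI[of _ N]) (simp add: vanishes_below_def row_mode_def)
next
  case (add u v)
  then obtain L L' where "vanishes_below L u" "vanishes_below L' v" by blast
  then have "vanishes_below (min L L') (\<lambda>i. u i + v i)" by (simp add: vanishes_below_def)
  then show ?case by blast
qed (auto simp: vanishes_below_def)

text \<open>The product of the row vector u with the matrix T. It is applied to vectors vanishing
  below some index and to upper triangular T, where the sum is finite and the default value of
  \<open>Sum_any\<close> is not met.\<close>

definition row_act :: "(int \<Rightarrow> int \<Rightarrow> complex) \<Rightarrow> (int \<Rightarrow> complex) \<Rightarrow> int \<Rightarrow> complex" where
  "row_act T u i = Sum_any (\<lambda>s. u s * T s i)"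

lemma row_act_eq:
  assumes "vanishes_below L u" "\<And>s i. i < s \<Longrightarrow> T s i = 0"
  shows "row_act T u i = (\<Sum>s\<in>{L..i}. u s * T s i)"
  unfolding row_act_def
proof (rule Sum_any.expand_superset)
  show "{s. u s * T s i \<noteq> 0} \<subseteq> {L..i}"
    using assms by (auto simp: vanishes_below_def not_less[symmetric])
qed simp

context weights
begin

abbreviation "up \<equiv> tri a b g h"

lemma row_act_up:
  assumes "vanishes_below L u"
  shows "row_act (up l) u i = (\<Sum>s\<in>{L..i}. u s * up l s i)"
  by (rule row_act_eq[OF assms]) simp

lemma row_act_vanishes_below: "vanishes_below L u \<Longrightarrow> vanishes_below L (row_act (up l) u)"
  by (subst vanishes_below_def) (simp add: row_act_up)

lemma row_act_add:
  assumes "vanishes_below L u" "vanishes_below L' v"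
  shows "row_act (up l) (\<lambda>i. u i + v i) = (\<lambda>i. row_act (up l) u i + row_act (up l) v i)"
proof
  fix i
  have 1: "vanishes_below (min L L') u" "vanishes_below (min L L') v"
    using assms by (auto intro: vanishes_below_mono)
  then have "vanishes_below (min L L') (\<lambda>i. u i + v i)"
    by (simp add: vanishes_below_def)
  with 1 show "row_act (up l) (\<lambda>i. u i + v i) i = row_act (up l) u i + row_act (up l) v i"
    by (simp add: row_act_up algebra_simps sum.distrib)
qed

lemma row_act_scale:
  assumes "vanishes_below L u"
  shows "row_act (up l) (\<lambda>i. c * u i) = (\<lambda>i. c * row_act (up l) u i)"
proof
  fix i
  have "vanishes_below L (\<lambda>i. c * u i)"
    using assms by (simp add: vanishes_below_def)
  with assms show "row_act (up l) (\<lambda>i. c * u i) i = c * row_act (up l) u i"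
    by (simp add: row_act_up sum_distrib_left mult_ac)
qed

lemma row_act_0: "row_act (up 0) u = u"
  by (simp add: row_act_def tri_0 fun_eq_iff if_distrib[of "\<lambda>x. _ * x"] cong: if_cong)

lemma row_act_unit: "row_act (up l) (\<lambda>i. if i = p then 1 else 0) = up l p"
  by (simp add: row_act_def fun_eq_iff if_distrib[of "\<lambda>x. x * _"] cong: if_cong)

lemma row_act_mode:
  assumes "n \<ge> 1"
  shows "row_act (up 1) (row_mode a b h N n) = row_mode a b h N (Suc n)"
proof
  fix i
  have "vanishes_below (N + 1) (row_mode a b h N n)"
    by (simp add: vanishes_below_def row_mode_def)
  then show "row_act (up 1) (row_mode a b h N n) i = row_mode a b h N (Suc n) i"
    using row_mode_tri[OF assms, of "N + 1" N i] row_act_up[of "N + 1" _ 1 i] by simp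
qed

text \<open>Associativity is safe here: triangularity and the lower bound of u confine both
  summation indices to the interval from L to i.\<close>

lemma row_act_Suc:
  assumes "vanishes_below L u"
  shows "row_act (up (Suc l)) u = row_act (up 1) (row_act (up l) u)"
proof
  fix i
  have "row_act (up 1) (row_act (up l) u) i = (\<Sum>s\<in>{L..i}. \<Sum>r\<in>{L..s}. u r * up l r s * up 1 s i)"
    using row_act_vanishes_below[OF assms, of l]
    by (simp add: row_act_up[OF assms] row_act_up[of L "row_act (up l) u"] sum_distrib_right)
  also have "\<dots> = (\<Sum>s\<in>{L..i}. \<Sum>r\<in>{L..i}. u r * up l r s * up 1 s i)"
    by (intro sum.cong refl sum.mono_neutral_left) auto
  also have "\<dots> = (\<Sum>r\<in>{L..i}. u r * (\<Sum>s\<in>{L..i}. up l r s * up 1 s i))"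
    by (subst sum.swap) (simp add: sum_distrib_left mult.assoc)
  also have "\<dots> = (\<Sum>r\<in>{L..i}. u r * (\<Sum>s\<in>{r..i}. up l r s * up 1 s i))"
  proof (rule sum.cong)
    fix r assume "r \<in> {L..i}"
    then have "(\<Sum>s\<in>{L..i}. up l r s * up 1 s i) = (\<Sum>s\<in>{r..i}. up l r s * up 1 s i)"
      by (intro sum.mono_neutral_right) auto
    then show "u r * (\<Sum>s\<in>{L..i}. up l r s * up 1 s i) = u r * (\<Sum>s\<in>{r..i}. up l r s * up 1 s i)"
      by simp
  qed simp
  also have "\<dots> = row_act (up (Suc l)) u i"
    by (simp only: row_act_up[OF assms] tri_Suc_right[of l])
  finally show "row_act (up (Suc l)) u i = row_act (up 1) (row_act (up l) u) i" by (rule sym)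
qed

lemma up_1_row: "up 1 p = (\<lambda>i. b p * (if i = p then 1 else 0) + g p * row_mode a b h p 1 i)"
proof
  fix i show "up 1 p i = b p * (if i = p then 1 else 0) + g p * row_mode a b h p 1 i"
    using tri_row[of p i a b g h 1]
    by (cases "p < i"; cases "i = p") (auto simp: tri_def row_mode_def)
qed

lemma row_act_1_rowspace: "u \<in> rowspace a b h \<Longrightarrow> row_act (up 1) u \<in> rowspace a b h"
proof (induction rule: rowspace.induct)
  case zero
  show ?case by (simp add: row_act_def rowspace.zero)
next
  case (unit p)
  have "up 1 p \<in> rowspace a b h" unfolding up_1_row by (intro rowspace.intros) simp
  then show ?case by (simp only: row_act_unit)
next
  case (mode n N)
  then show ?case using row_act_mode rowspace.mode[of "Suc n"] by simp
next
  case (add u v)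
  then show ?case
    using rowspace_vanishes_below[OF add.hyps(1)] rowspace_vanishes_below[OF add.hyps(2)]
    by (auto simp: row_act_add intro: rowspace.add)
next
  case (scale u c)
  then show ?case
    using rowspace_vanishes_below[OF scale.hyps] by (auto simp: row_act_scale intro: rowspace.scale)
qed

lemma row_act_rowspace:
  assumes "u \<in> rowspace a b h"
  shows "row_act (up l) u \<in> rowspace a b h"
proof (induction l)
  case 0
  then show ?case using assms by (simp add: row_act_0)
next
  case (Suc l)
  then show ?case using rowspace_vanishes_below[OF assms] row_act_1_rowspace
    by (metis row_act_Suc)
qed

end

section \<open>Multiplication by the lower triangular matrices\<close>

context row_side
begin

abbreviation "low k i j \<equiv> tri b a h g k j i"

text \<open>The row vector \<open>row_mode N n\<close> multiplied by the lower triangular matrix.\<close>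

definition mode_low :: "int \<Rightarrow> nat \<Rightarrow> nat \<Rightarrow> int \<Rightarrow> complex" where
  "mode_low N n k j =
     (if j \<le> N then (if 1 \<le> n \<and> n \<le> k then col_mode b a h N (k - n) j else 0)
      else row_mode a b h N n j * a j ^ k
        + h j * (\<Sum>s<n. if n \<le> k + s then fps_nth (zero_pole a b N j) s * a j ^ (k + s - n) else 0))"

text \<open>For a column j <= N the matrix entries split at N and biorthogonality selects the one
  term m = k - n. For j > N the diagonal entry is separated and the base of the mode is raised to j,
  which reduces the rest to the first case with base j.\<close>

lemma has_sum_mode_low: "((\<lambda>i. row_mode a b h N n i * low k i j) has_sum mode_low N n k j) UNIV"
proof -
  have le: "((\<lambda>i. row_mode a b h N n i * low k i j) has_sum
     (if 1 \<le> n \<and> n \<le> k then col_mode b a h N (k - n) j else 0)) UNIV" if "j \<le> N" for N n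
  proof -
    have "row_mode a b h N n i * low k i j
       = (\<Sum>m\<le>k. col_mode b a h N m j * (row_mode a b h N n i * row_mode b a g N (k - m) i))" for i
    proof (cases "N < i")
      case True
      then show ?thesis using tri_split[of j N i b a h g k] that
        by (simp add: sum_distrib_left mult_ac)
    next
      case False
      then show ?thesis by (simp add: row_mode_def)
    qed
    moreover have "((\<lambda>i. \<Sum>m\<le>k. col_mode b a h N m j * (row_mode a b h N n i * row_mode b a g N (k - m) i))
      has_sum (\<Sum>m\<le>k. col_mode b a h N m j * (if n = k - m \<and> n \<ge> 1 then 1 else 0))) UNIV"
      by (intro has_sum_sum has_sum_cmult_right row_mode_orthogonal) simp
    moreover have "(\<Sum>m\<le>k. col_mode b a h N m j * (if n = k - m \<and> n \<ge> 1 then 1 else 0))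
      = (if 1 \<le> n \<and> n \<le> k then col_mode b a h N (k - n) j else 0)"
    proof -
      have "(\<Sum>m\<le>k. col_mode b a h N m j * (if n = k - m \<and> n \<ge> 1 then 1 else 0))
        = (\<Sum>m\<le>k. if m = k - n then (if 1 \<le> n \<and> n \<le> k then col_mode b a h N (k - n) j else 0) else 0)"
        by (rule sum.cong) auto
      then show ?thesis by simp
    qed
    ultimately show ?thesis by simp
  qed
  show ?thesis
  proof (cases "j \<le> N")
    case True
    then show ?thesis using le[OF True] by (simp add: mode_low_def)
  next
    case False
    have "row_mode a b h N n i * low k i j
      = (if i = j then row_mode a b h N n j * a j ^ k else 0)
        + (\<Sum>s<n. fps_nth (zero_pole a b N j) s * (row_mode a b h j (n - s) i * low k i j))" for i
    proof -
      consider "i < j" | "i = j" | "j < i" by linarith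
      then show ?thesis
      proof cases
        case 3
        then show ?thesis using row_mode_change_base[of N j i a b h n] False
          by (simp add: sum_distrib_left mult_ac)
      qed (simp_all add: row_mode_def tri_def)
    qed
    moreover have "((\<lambda>i. (if i = j then row_mode a b h N n j * a j ^ k else 0)
        + (\<Sum>s<n. fps_nth (zero_pole a b N j) s * (row_mode a b h j (n - s) i * low k i j)))
      has_sum (row_mode a b h N n j * a j ^ k
        + (\<Sum>s<n. fps_nth (zero_pole a b N j) s *
            (if 1 \<le> n - s \<and> n - s \<le> k then col_mode b a h j (k - (n - s)) j else 0)))) UNIV"
      by (intro has_sum_add has_sum_single has_sum_sum has_sum_cmult_right le) auto
    moreover have "(\<Sum>s<n. fps_nth (zero_pole a b N j) s *
            (if 1 \<le> n - s \<and> n - s \<le> k then col_mode b a h j (k - (n - s)) j else 0))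
        = h j * (\<Sum>s<n. if n \<le> k + s then fps_nth (zero_pole a b N j) s * a j ^ (k + s - n) else 0)"
      unfolding sum_distrib_left
    proof (rule sum.cong)
      fix s assume "s \<in> {..<n}"
      then show "fps_nth (zero_pole a b N j) s *
            (if 1 \<le> n - s \<and> n - s \<le> k then col_mode b a h j (k - (n - s)) j else 0)
          = h j * (if n \<le> k + s then fps_nth (zero_pole a b N j) s * a j ^ (k + s - n) else 0)"
        by (auto simp: col_mode_def pole_fps_nth)
    qed simp
    ultimately show ?thesis using False by (simp add: mode_low_def)
  qed
qed

text \<open>This is u A^1 A^(-k-1) = u A^(-k) for a mode u, as A^1 raises n by one. For j > N the
  new summand s = n compensates the change of the diagonal contribution, by
  \<open>row_mode_zero_pole\<close>.\<close>

lemma mode_low_Suc: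
  assumes "n \<ge> 1"
  shows "mode_low N (Suc n) (Suc k) j = mode_low N n k j"
proof (cases "j \<le> N")
  case True
  then show ?thesis using assms by (simp add: mode_low_def)
next
  case False
  have "a j ^ k * (a j * row_mode a b h N (Suc n) j - row_mode a b h N n j)
      = - (a j ^ k * (h j * fps_nth (zero_pole a b N j) n))"
    using row_mode_zero_pole[of N j a b h n] False by simp
  moreover define S where "S = (\<Sum>s<n. if n \<le> k + s then fps_nth (zero_pole a b N j) s * a j ^ (k + s - n) else 0)"
  moreover have "mode_low N (Suc n) (Suc k) j
      = row_mode a b h N (Suc n) j * a j ^ Suc k + h j * (S + fps_nth (zero_pole a b N j) n * a j ^ k)"
    using False by (simp add: mode_low_def S_def cong: if_cong)
  moreover have "mode_low N n k j = row_mode a b h N n j * a j ^ k + h j * S"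
    using False by (simp add: mode_low_def S_def)
  ultimately show ?thesis
    by (simp add: algebra_simps)
qed

text \<open>The same cancellation for the unit vector at p: by \<open>up_1_row\<close>, row p of
  \<open>up 1\<close> is \<open>b p\<close> times that vector plus \<open>g p\<close> times a mode
  based at p.\<close>

lemma unit_low:
  "b p * low (Suc k) p j + g p * mode_low p 1 (Suc k) j = low k p j"
proof -
  consider "j < p" | "j = p" | "p < j" by linarith
  then show ?thesis
  proof cases
    case 1
    define F where "F = zero_pole b a j (p - 1) * (pole_fps (a j) * pole_fps (a p))"
    have "zero_pole b a j p * pole_fps (a j) = fps_X * F - fps_const (b p) * F"
      unfolding zero_pole_step[OF 1] F_def by (simp add: algebra_simps)
    then have c: "col_mode b a h p k j = h j * (fps_nth (fps_X * F) k - b p * fps_nth F k)"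
      using 1 by (simp add: col_mode_def)
    have l: "low k p j = h j * g p * fps_nth (fps_X * F) k" for k
      using 1 by (simp only: tri_def F_def mult.assoc) simp
    define x y where "x = fps_nth (fps_X * F) k" and "y = fps_nth F k"
    have l1: "low (Suc k) p j = h j * g p * y"
      using l[of "Suc k"] by (simp add: y_def)
    have l0: "low k p j = h j * g p * x"
      unfolding x_def by (rule l)
    have m: "mode_low p 1 (Suc k) j = h j * (x - b p * y)"
      using 1 c by (simp add: mode_low_def x_def y_def)
    show ?thesis
      by (simp only: l0 l1 m) (simp add: algebra_simps)
  next
    case 2
    have "g p * (h p * a p ^ k) = a p ^ k - b p * (a p * a p ^ k)"
      by (simp only: mult.assoc[symmetric] weights) (simp add: algebra_simps)
    then show ?thesis using 2
      by (simp add: mode_low_def tri_def col_mode_def pole_fps_nth)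
  next
    case 3
    have "a j ^ k * (a j * row_mode a b h p 1 j) = - (a j ^ k * (h j * fps_nth (zero_pole a b p j) 0))"
      using row_mode_zero_pole[of p j a b h 0] 3 by simp
    then have "row_mode a b h p 1 j * a j ^ Suc k + h j * (fps_nth (zero_pole a b p j) 0 * a j ^ k) = 0"
      by (simp add: algebra_simps)
    then show ?thesis using 3
      by (simp add: mode_low_def)
  qed
qed

text \<open>\<open>unit_low\<close> and \<open>mode_low_Suc\<close> settle the generators. Naming
  one common sum S lets convergence of both families and equality of their sums pass through the
  linear steps together.\<close>

lemma row_act_low:
  "u \<in> rowspace a b h \<Longrightarrow> \<exists>S. ((\<lambda>i. u i * low k i j) has_sum S) UNIV
     \<and> ((\<lambda>i. row_act (up 1) u i * low (Suc k) i j) has_sum S) UNIV"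
proof (induction rule: rowspace.induct)
  case zero
  show ?case by (rule exI[of _ 0]) (simp add: row_act_def)
next
  case (unit p)
  have "((\<lambda>i. (if i = p then 1 else 0) * low k i j) has_sum low k p j) UNIV"
    by (rule has_sum_finite_neutralI[of "{p}"]) auto
  moreover have "((\<lambda>i. b p * ((if i = p then 1 else 0) * low (Suc k) i j)
      + g p * (row_mode a b h p 1 i * low (Suc k) i j))
      has_sum (b p * low (Suc k) p j + g p * mode_low p 1 (Suc k) j)) UNIV"
    by (intro has_sum_add has_sum_cmult_right has_sum_mode_low)
       (rule has_sum_finite_neutralI[of "{p}"], auto)
  moreover have "row_act (up 1) (\<lambda>i. if i = p then 1 else 0) i * low (Suc k) i j
      = b p * ((if i = p then 1 else 0) * low (Suc k) i j) + g p * (row_mode a b h p 1 i * low (Suc k) i j)" for i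
    unfolding row_act_unit by (subst up_1_row) (simp only: distrib_right mult.assoc)
  ultimately show ?case unfolding unit_low by (intro exI conjI) simp_all
next
  case (mode n N)
  show ?case unfolding row_act_mode[OF mode]
    using has_sum_mode_low[of N n k j] has_sum_mode_low[of N "Suc n" "Suc k" j]
    unfolding mode_low_Suc[OF mode] by blast
next
  case (add u v)
  then obtain S S' where S: "((\<lambda>i. u i * low k i j) has_sum S) UNIV"
      "((\<lambda>i. row_act (up 1) u i * low (Suc k) i j) has_sum S) UNIV"
      "((\<lambda>i. v i * low k i j) has_sum S') UNIV"
      "((\<lambda>i. row_act (up 1) v i * low (Suc k) i j) has_sum S') UNIV" by blast
  obtain L L' where "vanishes_below L u" "vanishes_below L' v"
    using rowspace_vanishes_below add.hyps by blast
  then have *: "row_act (up 1) (\<lambda>i. u i + v i) = (\<lambda>i. row_act (up 1) u i + row_act (up 1) v i)"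
    by (rule row_act_add)
  show ?case unfolding * distrib_right
    using has_sum_add[OF S(1,3)] has_sum_add[OF S(2,4)] by blast
next
  case (scale u c)
  then obtain S where S: "((\<lambda>i. u i * low k i j) has_sum S) UNIV"
      "((\<lambda>i. row_act (up 1) u i * low (Suc k) i j) has_sum S) UNIV" by blast
  obtain L where "vanishes_below L u"
    using rowspace_vanishes_below scale.hyps by blast
  then have *: "row_act (up 1) (\<lambda>i. c * u i) = (\<lambda>i. c * row_act (up 1) u i)"
    by (rule row_act_scale)
  show ?case unfolding * mult.assoc
    using has_sum_cmult_right[OF S(1), of c] has_sum_cmult_right[OF S(2), of c] by blast
qed

lemma rowspace_low_summable: "u \<in> rowspace a b h \<Longrightarrow> (\<lambda>i. u i * low k i j) summable_on UNIV"
  using row_act_low[of u k j] by (blast intro: has_sum_imp_summable)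

lemma row_act_low_infsum:
  "u \<in> rowspace a b h \<Longrightarrow> infsum (\<lambda>i. row_act (up 1) u i * low (Suc k) i j) UNIV = infsum (\<lambda>i. u i * low k i j) UNIV"
  using row_act_low[of u k j] by (metis infsumI)

end

section \<open>The pairing and its trace\<close>

lemma infsum_flip:
  fixes f :: "int \<Rightarrow> complex"
  shows "infsum (\<lambda>i. f (1 - i)) UNIV = infsum f UNIV"
    and "(\<lambda>i. f (1 - i)) summable_on UNIV \<longleftrightarrow> f summable_on UNIV"
    and "((\<lambda>i. f (1 - i)) has_sum S) UNIV \<longleftrightarrow> (f has_sum S) UNIV"
proof -
  have "bij_betw (\<lambda>i::int. 1 - i) UNIV UNIV"
    by (rule bij_betwI[of _ _ _ "\<lambda>i. 1 - i"]) auto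
  from infsum_reindex_bij_betw[OF this, of f] summable_on_reindex_bij_betw[OF this, of f]
    has_sum_reindex_bij_betw[OF this, of f S]
  show "infsum (\<lambda>i. f (1 - i)) UNIV = infsum f UNIV"
    "(\<lambda>i. f (1 - i)) summable_on UNIV \<longleftrightarrow> f summable_on UNIV"
    "((\<lambda>i. f (1 - i)) has_sum S) UNIV \<longleftrightarrow> (f has_sum S) UNIV"
    by simp_all
qed

text \<open>Summability of complex families is absolute, so the norms can be summed first over one
  index and then over the other.\<close>

lemma summable_on_product:
  fixes f :: "'a \<Rightarrow> complex" and g :: "'b \<Rightarrow> complex"
  assumes "f summable_on S" "g summable_on T"
  shows "(\<lambda>(x, y). f x * g y) summable_on S \<times> T"
proof -
  have a: "(\<lambda>x. norm (f x)) summable_on S" "(\<lambda>y. norm (g y)) summable_on T"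
    using assms by (simp_all flip: summable_on_iff_abs_summable_on_complex)
  have "(\<lambda>p. norm (case p of (x, y) \<Rightarrow> f x * g y)) summable_on S \<times> T"
    unfolding abs_summable_on_Sigma_iff
  proof (intro conjI ballI)
    have "(\<lambda>x. norm (norm (f x)) * norm (infsum (\<lambda>y. norm (g y)) T)) summable_on S"
      using summable_on_cmult_left[OF a(1)] by simp
    then show "(\<lambda>x. norm (infsum (\<lambda>y. norm (case (x, y) of (x, y) \<Rightarrow> f x * g y)) T)) summable_on S"
      by (simp add: norm_mult infsum_cmult_right' abs_mult)
  qed (use a in \<open>simp add: norm_mult summable_on_cmult_right\<close>)
  then show ?thesis by (rule abs_summable_summable)
qed

lemma Sum_any_flip: "Sum_any (\<lambda>s::int. f (1 - s)) = Sum_any (f :: int \<Rightarrow> complex)"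
proof (rule Sum_any.reindex_cong)
  show "bij (\<lambda>s::int. 1 - s)"
    by (rule bij_betwI[of _ _ _ "\<lambda>i. 1 - i"]) auto
qed auto

section \<open>Column vectors by reflection, and the pairing\<close>

definition col_act :: "(int \<Rightarrow> int \<Rightarrow> complex) \<Rightarrow> (int \<Rightarrow> complex) \<Rightarrow> int \<Rightarrow> complex" where
  "col_act T w j = Sum_any (\<lambda>s. w s * T j s)"

text \<open>Defined by reflecting \<open>rowspace\<close>, with g in the place of h, so that the
  statements on rows transfer without a second proof.\<close>

definition colspace :: "(int \<Rightarrow> complex) \<Rightarrow> (int \<Rightarrow> complex) \<Rightarrow> (int \<Rightarrow> complex) \<Rightarrow> (int \<Rightarrow> complex) set" where
  "colspace a b g = {w. flip w \<in> rowspace (flip a) (flip b) (flip g)}"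

lemma flip_in_colspace: "u \<in> rowspace (flip a) (flip b) (flip g) \<Longrightarrow> flip u \<in> colspace a b g"
  by (simp add: colspace_def)

lemma colspace_cases:
  assumes "w \<in> colspace a b g"
  obtains u where "w = flip u" "u \<in> rowspace (flip a) (flip b) (flip g)"
  using assms by (intro that[of "flip w"]) (auto simp: colspace_def)

lemma col_mode_in_colspace: "col_mode a b g N m \<in> colspace a b g"
  using flip_in_colspace[OF rowspace.mode[of "Suc m" "flip a" "flip b" "flip g" "- N"]]
  by (simp add: col_mode_flip[symmetric])

lemma unit_in_colspace: "(\<lambda>i. if i = p then 1 else 0) \<in> colspace a b g"
proof -
  have "(\<lambda>i. if 1 - i = p then 1 else 0) = (\<lambda>i. if i = 1 - p then 1 else (0 :: complex))" by auto
  then show ?thesis by (simp add: colspace_def rowspace.unit)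
qed

lemma colspace_vanishes_above: "w \<in> colspace a b g \<Longrightarrow> \<exists>L. \<forall>j>L. w j = 0"
proof -
  assume "w \<in> colspace a b g"
  then obtain L where L: "vanishes_below L (flip w)"
    unfolding colspace_def using rowspace_vanishes_below by blast
  have "w j = 0" if "j > 1 - L" for j
    using L[unfolded vanishes_below_def, rule_format, of "1 - j"] that by simp
  then show ?thesis by blast
qed

text \<open>The weights trade places in the reflected copy, which therefore carries the vacuum
  hypothesis for the nonpositive modes.\<close>

locale two_sided = row_side + flp: row_side "flip a" "flip b" "flip h" "flip g"
begin

lemma low_flip: "flp.low k i j = low k (1 - j) (1 - i)"
  by (rule tri_flip)

lemma up_flip: "flp.up k i j = up k (1 - j) (1 - i)"
  by (rule tri_flip)

lemma col_act_flip: "col_act (up l) (flip u) = flip (row_act (flp.up l) u)"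
proof
  fix j
  have "col_act (up l) (flip u) j = Sum_any (\<lambda>s. u (1 - s) * up l j s)"
    by (simp add: col_act_def)
  also have "\<dots> = Sum_any (\<lambda>s. u s * up l j (1 - s))"
    using Sum_any_flip[of "\<lambda>s. u s * up l j (1 - s)"] by simp
  also have "\<dots> = flip (row_act (flp.up l) u) j"
    by (simp add: row_act_def up_flip)
  finally show "col_act (up l) (flip u) j = flip (row_act (flp.up l) u) j" .
qed

lemma col_act_colspace: "w \<in> colspace a b g \<Longrightarrow> col_act (up l) w \<in> colspace a b g"
  by (erule colspace_cases) (simp add: col_act_flip flip_in_colspace flp.row_act_rowspace)

lemma col_act_0: "col_act (up 0) w = w"
  using col_act_flip[of 0 "flip w"] by (simp add: flp.row_act_0)

text \<open>The second form is associativity, as for rows. The first follows by induction because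
  the factors are powers of one matrix; \<open>pairing_shift\<close> needs it to peel off factors
  one at a time.\<close>

lemma col_act_Suc:
  assumes "w \<in> colspace a b g"
  shows "col_act (up (Suc l)) w = col_act (up l) (col_act (up 1) w)"
    and "col_act (up (Suc l)) w = col_act (up 1) (col_act (up l) w)"
proof -
  have 2: "col_act (up (Suc l)) w = col_act (up 1) (col_act (up l) w)" if w: "w \<in> colspace a b g" for w l
  proof -
    obtain u where u: "w = flip u" "u \<in> rowspace (flip a) (flip b) (flip g)"
      using w by (rule colspace_cases)
    obtain L where "vanishes_below L u" using rowspace_vanishes_below[OF u(2)] by blast
    then show ?thesis
      unfolding u(1) col_act_flip by (subst flp.row_act_Suc) simp_all
  qed
  then show "col_act (up (Suc l)) w = col_act (up 1) (col_act (up l) w)" using assms .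
  show "col_act (up (Suc l)) w = col_act (up l) (col_act (up 1) w)"
  proof (induction l)
    case 0
    then show ?case by (simp add: col_act_0)
  next
    case (Suc l)
    then show ?case using 2[OF assms, of "Suc l"] 2[of "col_act (up 1) w" l] col_act_colspace[OF assms, of 1]
      by metis
  qed
qed

lemma colspace_low_summable:
  assumes "w \<in> colspace a b g"
  shows "(\<lambda>j. w j * low k i j) summable_on UNIV"
proof -
  obtain u where u: "w = flip u" "u \<in> rowspace (flip a) (flip b) (flip g)"
    using assms by (rule colspace_cases)
  show ?thesis
    using flp.rowspace_low_summable[OF u(2), of k "1 - i"] infsum_flip(2)[of "\<lambda>j. w j * low k i j"]
    by (simp add: low_flip u(1))
qed

lemma col_act_low_infsum:
  assumes "w \<in> colspace a b g"
  shows "infsum (\<lambda>j. col_act (up 1) w j * low (Suc k) i j) UNIV = infsum (\<lambda>j. w j * low k i j) UNIV"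
proof -
  obtain u where u: "w = flip u" "u \<in> rowspace (flip a) (flip b) (flip g)"
    using assms by (rule colspace_cases)
  show ?thesis
    using flp.row_act_low_infsum[OF u(2), of k "1 - i"] infsum_flip(1)[of "\<lambda>j. w j * low k i j"]
      infsum_flip(1)[of "\<lambda>j. col_act (up 1) w j * low (Suc k) i j"]
    unfolding low_flip u(1) col_act_flip by simp
qed

lemma col_mode_orthogonal:
  "((\<lambda>j. col_mode b a h N n j * col_mode a b g N m j) has_sum (if n = m then 1 else 0)) UNIV"
  using flp.row_mode_orthogonal[of "- N" "Suc m" "Suc n"]
    infsum_flip(3)[of "\<lambda>j. col_mode b a h N n j * col_mode a b g N m j"]
  by (simp add: col_mode_flip mult.commute eq_commute)

text \<open>On the columns j <= N the splitting at N yields finitely many products of a family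
  summable in i and one summable in j. The column mode vanishes beyond N', so only finitely many
  columns remain, each summable in i.\<close>

lemma mode_mode_summable:
  "(\<lambda>(i, j). row_mode a b h N n i * low k i j * col_mode a b g N' m j) summable_on UNIV"
proof -
  have w: "col_mode a b g N' m \<in> colspace a b g" by (rule col_mode_in_colspace)
  have u: "(\<lambda>i. row_mode a b h N n i * low k i j) summable_on UNIV" for j
    by (rule has_sum_imp_summable[OF has_sum_mode_low])
  have left: "(\<lambda>(i, j). row_mode a b h N n i * low k i j * col_mode a b g N' m j) summable_on UNIV \<times> {..N}"
  proof -
    have "(\<lambda>j. col_mode b a h N s j * col_mode a b g N' m j) summable_on UNIV" for s
      using flp.row_mode_product_summable[of "- N'" "Suc m" "- N" "Suc s"]
        infsum_flip(2)[of "\<lambda>j. col_mode b a h N s j * col_mode a b g N' m j"]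
      by (simp add: col_mode_flip mult.commute)
    then have 1: "(\<lambda>(i, j). (row_mode a b h N n i * row_mode b a g N (k - s) i) *
        (col_mode b a h N s j * col_mode a b g N' m j)) summable_on UNIV \<times> {..N}" for s
      by (intro summable_on_product row_mode_product_summable) (rule summable_on_subset_banach, auto)
    have "(\<lambda>p. \<Sum>s\<le>k. case p of (i, j) \<Rightarrow> (row_mode a b h N n i * row_mode b a g N (k - s) i) *
        (col_mode b a h N s j * col_mode a b g N' m j)) summable_on UNIV \<times> {..N}"
      by (rule has_sum_imp_summable, rule has_sum_sum, simp, rule has_sum_infsum, rule 1)
    moreover have "row_mode a b h N n i * low k i j * col_mode a b g N' m j
      = (\<Sum>s\<le>k. (row_mode a b h N n i * row_mode b a g N (k - s) i) *
        (col_mode b a h N s j * col_mode a b g N' m j))" if "j \<le> N" for i j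
    proof (cases "N < i")
      case True
      then show ?thesis using tri_split[of j N i b a h g k] that
        by (simp add: sum_distrib_left sum_distrib_right mult_ac)
    qed (simp add: row_mode_def)
    ultimately show ?thesis
      by (subst summable_on_cong) (auto intro!: sum.cong)
  qed
  have right: "(\<lambda>(i, j). row_mode a b h N n i * low k i j * col_mode a b g N' m j) summable_on UNIV \<times> {j}" for j
  proof -
    have "(\<lambda>(i, j'). (row_mode a b h N n i * low k i j) * col_mode a b g N' m j') summable_on UNIV \<times> {j}"
      by (intro summable_on_product u) simp
    then show ?thesis
      by (rule iffD1[OF summable_on_cong, rotated]) auto
  qed
  have "(\<lambda>(i, j). row_mode a b h N n i * low k i j * col_mode a b g N' m j) summable_on UNIV \<times> X" if "finite X" for X
    using that
  proof (induction X rule: finite_induct)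
    case (insert j X)
    have "UNIV \<times> insert j X = (UNIV :: int set) \<times> {j} \<union> UNIV \<times> X" by auto
    then show ?case using summable_on_Un_disjoint[OF right insert.IH, of j] insert.hyps
      by (auto simp: disjoint_iff)
  qed simp
  from summable_on_Un_disjoint[OF left this[of "{N<..N'}"]]
  have "(\<lambda>(i, j). row_mode a b h N n i * low k i j * col_mode a b g N' m j) summable_on
      UNIV \<times> {..N} \<union> UNIV \<times> {N<..N'}"
    by (auto simp: disjoint_iff)
  then show ?thesis
    by (rule iffD1[OF summable_on_cong_neutral, rotated -1]) (auto simp: col_mode_def split: if_splits)
qed

lemma pairing_summable:
  assumes "u \<in> rowspace a b h" "w \<in> colspace a b g"
  shows "(\<lambda>(i, j). u i * low k i j * w j) summable_on UNIV"
  using assms(1)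
proof (induction rule: rowspace.induct)
  case zero
  then show ?case by simp
next
  case (unit p)
  have "(\<lambda>(i, j). 1 * (w j * low k p j)) summable_on {p} \<times> UNIV"
    using colspace_low_summable[OF assms(2), of k p] by (intro summable_on_product) simp_all
  then show ?case
    by (rule iffD1[OF summable_on_cong_neutral, rotated -1]) (auto split: if_splits)
next
  case (mode n N)
  obtain v where v: "w = flip v" "v \<in> rowspace (flip a) (flip b) (flip g)"
    using assms(2) by (rule colspace_cases)
  have u: "(\<lambda>i. row_mode a b h N n i * low k i j) summable_on UNIV" for j
    by (rule has_sum_imp_summable[OF has_sum_mode_low])
  show ?case unfolding v(1) using v(2)
  proof (induction rule: rowspace.induct)
    case zero
    then show ?case by simp
  next
    case (unit p)
    have "(\<lambda>(i, j). (row_mode a b h N n i * low k i (1 - p)) * 1) summable_on UNIV \<times> {1 - p}"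
      by (intro summable_on_product u) simp
    then show ?case
      by (rule iffD1[OF summable_on_cong_neutral, rotated -1]) (auto split: if_splits)
  next
    case (mode n' N')
    then have "flip (row_mode (flip a) (flip b) (flip g) N' n') = col_mode a b g (- N') (n' - 1)"
      by (auto simp: col_mode_flip)
    then show ?case using mode_mode_summable[of N n k "- N'" "n' - 1"]
      by (simp add: fun_eq_iff)
  next
    case (add v v')
    from summable_on_add[OF add.IH] show ?case
      by (rule iffD1[OF summable_on_cong, rotated]) (auto simp: algebra_simps)
  next
    case (scale v c)
    from summable_on_cmult_right[OF scale.IH, of c] show ?case
      by (rule iffD1[OF summable_on_cong, rotated]) (auto simp: algebra_simps)
  qed
next
  case (add v v')
  from summable_on_add[OF add.IH] show ?case
    by (rule iffD1[OF summable_on_cong, rotated]) (auto simp: algebra_simps)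
next
  case (scale v c)
  from summable_on_cmult_right[OF scale.IH, of c] show ?case
    by (rule iffD1[OF summable_on_cong, rotated]) (auto simp: algebra_simps)
qed

text \<open>The number u A^(-k) w, as an unconditional double sum so that either index may be summed
  first.\<close>

definition pairing :: "nat \<Rightarrow> (int \<Rightarrow> complex) \<Rightarrow> (int \<Rightarrow> complex) \<Rightarrow> complex" where
  "pairing k u w = infsum (\<lambda>(i, j). u i * low k i j * w j) UNIV"

lemma pairing_iterated:
  assumes "u \<in> rowspace a b h" "w \<in> colspace a b g"
  shows "pairing k u w = infsum (\<lambda>i. u i * infsum (\<lambda>j. w j * low k i j) UNIV) UNIV"
    and "pairing k u w = infsum (\<lambda>j. w j * infsum (\<lambda>i. u i * low k i j) UNIV) UNIV"
proof -
  have s: "(\<lambda>(i, j). u i * low k i j * w j) summable_on UNIV \<times> UNIV"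
    using pairing_summable[OF assms] by simp
  have "pairing k u w = infsum (\<lambda>i. infsum (\<lambda>j. u i * low k i j * w j) UNIV) UNIV"
    unfolding pairing_def using infsum_Sigma'_banach[OF s] by simp
  then show "pairing k u w = infsum (\<lambda>i. u i * infsum (\<lambda>j. w j * low k i j) UNIV) UNIV"
    by (simp add: infsum_cmult_right'[symmetric] mult_ac)
  have "pairing k u w = infsum (\<lambda>i. infsum (\<lambda>j. u i * low k i j * w j) UNIV) UNIV"
    unfolding pairing_def using infsum_Sigma'_banach[OF s] by simp
  also have "\<dots> = infsum (\<lambda>j. infsum (\<lambda>i. u i * low k i j * w j) UNIV) UNIV"
    by (rule infsum_swap_banach[OF s])
  finally show "pairing k u w = infsum (\<lambda>j. w j * infsum (\<lambda>i. u i * low k i j) UNIV) UNIV"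
    by (simp add: infsum_cmult_right'[symmetric] mult_ac)
qed

text \<open>Both sides equal \<open>pairing k u w\<close>: A^1 cancels one factor of A^(-k-1) from
  the left if i is summed first, and from the right if j is summed first. The successor is essential
  to the argument, as there must be a factor to cancel.\<close>

lemma pairing_shift_1:
  assumes "u \<in> rowspace a b h" "w \<in> colspace a b g"
  shows "pairing (Suc k) (row_act (up 1) u) w = pairing (Suc k) u (col_act (up 1) w)"
proof -
  have "pairing (Suc k) (row_act (up 1) u) w = pairing k u w"
    using pairing_iterated(2)[OF row_act_1_rowspace[OF assms(1)] assms(2), of "Suc k"]
      pairing_iterated(2)[OF assms, of k] row_act_low_infsum[OF assms(1)] by simp
  also have "\<dots> = pairing (Suc k) u (col_act (up 1) w)"
    using pairing_iterated(1)[OF assms(1) col_act_colspace[OF assms(2)], of "Suc k" 1]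
      pairing_iterated(1)[OF assms, of k] col_act_low_infsum[OF assms(2)] by simp
  finally show ?thesis .
qed

lemma pairing_shift:
  assumes "u \<in> rowspace a b h" "w \<in> colspace a b g"
  shows "pairing (Suc k) (row_act (up l) u) w = pairing (Suc k) u (col_act (up l) w)"
  using assms(2)
proof (induction l arbitrary: w)
  case 0
  then show ?case by (simp add: row_act_0 col_act_0)
next
  case (Suc l)
  obtain L where "vanishes_below L u" using rowspace_vanishes_below[OF assms(1)] by blast
  then have "pairing (Suc k) (row_act (up (Suc l)) u) w
      = pairing (Suc k) (row_act (up 1) (row_act (up l) u)) w"
    by (simp only: row_act_Suc)
  also have "\<dots> = pairing (Suc k) (row_act (up l) u) (col_act (up 1) w)"
    by (rule pairing_shift_1) (use assms Suc.prems row_act_rowspace in auto)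
  also have "\<dots> = pairing (Suc k) u (col_act (up l) (col_act (up 1) w))"
    by (rule Suc.IH) (rule col_act_colspace[OF Suc.prems])
  also have "\<dots> = pairing (Suc k) u (col_act (up (Suc l)) w)"
    by (simp only: col_act_Suc(1)[OF Suc.prems])
  finally show ?case .
qed

text \<open>The column mode based at 0 lives on j <= 0, where \<open>mode_low\<close> is itself a
  column mode of Laurent index k - n; biorthogonality of column modes then compares k - n with
  m.\<close>

lemma pairing_modes:
  assumes "n \<ge> 1"
  shows "pairing k (row_mode a b h 0 n) (col_mode a b g 0 m) = (if n + m = k then 1 else 0)"
proof -
  have "infsum (\<lambda>i. row_mode a b h 0 n i * low k i j) UNIV = mode_low 0 n k j" for j
    using has_sum_mode_low by (rule infsumI)
  then have "pairing k (row_mode a b h 0 n) (col_mode a b g 0 m)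
      = infsum (\<lambda>j. col_mode a b g 0 m j * mode_low 0 n k j) UNIV"
    using pairing_iterated(2)[OF rowspace.mode[OF assms] col_mode_in_colspace, of k 0 0 m] by simp
  also have "\<dots> = infsum (\<lambda>j. if n \<le> k then col_mode b a h 0 (k - n) j * col_mode a b g 0 m j else 0) UNIV"
    by (rule infsum_cong) (use assms in \<open>auto simp: mode_low_def col_mode_def\<close>)
  also have "\<dots> = (if n + m = k then 1 else 0)"
  proof (cases "n \<le> k")
    case True
    then have "k - n = m \<longleftrightarrow> n + m = k" by auto
    with True show ?thesis
      using infsumI[OF col_mode_orthogonal[of 0 "k - n" m]] by simp
  qed auto
  finally show ?thesis .
qed

end

section \<open>Arrays of finite rank and traces of commutators\<close>

inductive_set arrays ::
    "(int \<Rightarrow> complex) set \<Rightarrow> (int \<Rightarrow> complex) set \<Rightarrow> (int \<Rightarrow> int \<Rightarrow> complex) set" for U V where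
  zero: "(\<lambda>_ _. 0) \<in> arrays U V"
| add: "x \<in> arrays U V \<Longrightarrow> u \<in> U \<Longrightarrow> w \<in> V \<Longrightarrow> (\<lambda>i j. x i j + u i * w j) \<in> arrays U V"

lemma arrays_add: "y \<in> arrays U V \<Longrightarrow> x \<in> arrays U V \<Longrightarrow> (\<lambda>i j. x i j + y i j) \<in> arrays U V"
proof (induction rule: arrays.induct)
  case (add y u w)
  then show ?case using arrays.add[of "\<lambda>i j. x i j + y i j"] by (simp add: add.assoc)
qed simp

lemma arrays_product: "u \<in> U \<Longrightarrow> w \<in> V \<Longrightarrow> (\<lambda>i j. u i * w j) \<in> arrays U V"
  using arrays.add[OF arrays.zero] by simp

lemma arrays_sum:
  assumes "finite S" "\<And>s. s \<in> S \<Longrightarrow> x s \<in> arrays U V"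
  shows "(\<lambda>i j. \<Sum>s\<in>S. x s i j) \<in> arrays U V"
  using assms
proof (induction S rule: finite_induct)
  case (insert s S)
  then have "(\<lambda>i j. x s i j + (\<Sum>s\<in>S. x s i j)) \<in> arrays U V"
    by (intro arrays_add) auto
  with insert.hyps show ?case by simp
qed (simp add: arrays.zero)

lemma col_act_eq:
  assumes "\<forall>j>L. w j = 0" "\<And>j s. s < j \<Longrightarrow> T j s = 0"
  shows "col_act T w j = (\<Sum>s\<in>{j..L}. w s * T j s)"
  unfolding col_act_def
proof (rule Sum_any.expand_superset)
  show "{s. w s * T j s \<noteq> 0} \<subseteq> {j..L}"
    using assms by (auto simp: not_less[symmetric])
qed simp

text \<open>If x i j is a functional evaluated at the bilinear psi_i psi_star_j, this is the
  noncentral part of its value at the commutator of the current of T with that bilinear.\<close>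

definition commutator :: "(int \<Rightarrow> int \<Rightarrow> complex) \<Rightarrow> (int \<Rightarrow> int \<Rightarrow> complex) \<Rightarrow> int \<Rightarrow> int \<Rightarrow> complex" where
  "commutator T x i j = row_act T (\<lambda>s. x s j) i - col_act T (x i) j"

context two_sided
begin

abbreviation "arrs \<equiv> arrays (rowspace a b h) (colspace a b g)"

lemma arrays_bounded: "x \<in> arrs \<Longrightarrow> \<exists>L L'. (\<forall>i j. i < L \<longrightarrow> x i j = 0) \<and> (\<forall>i j. j > L' \<longrightarrow> x i j = 0)"
proof (induction rule: arrays.induct)
  case (add x u w)
  then obtain L L' where L: "\<forall>i j. i < L \<longrightarrow> x i j = 0" "\<forall>i j. j > L' \<longrightarrow> x i j = 0" by blast
  obtain K K' where K: "vanishes_below K u" "\<forall>j>K'. w j = 0"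
    using rowspace_vanishes_below[OF add.hyps(2)] colspace_vanishes_above[OF add.hyps(3)] by blast
  show ?case
    by (rule exI[of _ "min L K"], rule exI[of _ "max L' K'"])
       (use L K in \<open>auto simp: vanishes_below_def\<close>)
qed auto

text \<open>Pairs A^(-k) with an array entry by entry. Applied to \<open>mode_array\<close> it
  stands for the expectation with J_(-k) inserted, although J_(-k) applied to a basis vector may be
  an infinite sum.\<close>

definition trace :: "nat \<Rightarrow> (int \<Rightarrow> int \<Rightarrow> complex) \<Rightarrow> complex" where
  "trace k x = infsum (\<lambda>(i, j). low k i j * x i j) UNIV"

lemma trace_summable: "x \<in> arrs \<Longrightarrow> (\<lambda>(i, j). low k i j * x i j) summable_on UNIV"
proof (induction rule: arrays.induct)
  case (add x u w)
  from summable_on_add[OF add.IH pairing_summable[OF add.hyps(2,3), of k]] show ?case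
    by (rule iffD1[OF summable_on_cong, rotated]) (auto simp: algebra_simps)
qed simp

lemma trace_zero: "trace k (\<lambda>_ _. 0) = 0"
  by (simp add: trace_def case_prod_unfold)

lemma trace_add:
  assumes "x \<in> arrs" "y \<in> arrs"
  shows "trace k (\<lambda>i j. x i j + y i j) = trace k x + trace k y"
  using infsum_add[OF trace_summable[OF assms(1)] trace_summable[OF assms(2)], of k k]
  unfolding trace_def by (simp add: case_prod_unfold distrib_left)

lemma trace_scale: "trace k (\<lambda>i j. c * x i j) = c * trace k x"
  unfolding trace_def by (subst infsum_cmult_right'[symmetric]) (simp add: case_prod_unfold mult_ac)

lemma trace_sum:
  assumes "finite S" "\<And>s. s \<in> S \<Longrightarrow> x s \<in> arrs"
  shows "trace k (\<lambda>i j. \<Sum>s\<in>S. x s i j) = (\<Sum>s\<in>S. trace k (x s))"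
  using assms
proof (induction S rule: finite_induct)
  case empty
  then show ?case by (simp add: trace_zero)
next
  case (insert s S)
  then have "trace k (\<lambda>i j. x s i j + (\<Sum>s\<in>S. x s i j)) = trace k (x s) + trace k (\<lambda>i j. \<Sum>s\<in>S. x s i j)"
    by (intro trace_add arrays_sum) auto
  with insert show ?case by simp
qed

lemma trace_product: "trace k (\<lambda>i j. u i * w j) = pairing k u w"
  unfolding trace_def pairing_def by (rule infsum_cong) (auto simp: mult_ac)

lemma arrays_scale: "x \<in> arrs \<Longrightarrow> (\<lambda>i j. c * x i j) \<in> arrs"
proof (induction rule: arrays.induct)
  case (add x u w)
  then show ?case using arrays.add[OF add.IH rowspace.scale[OF add.hyps(2), of c] add.hyps(3)]
    by (simp add: algebra_simps)
qed (simp add: arrays.zero)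

lemma commutator_add_product:
  assumes "x \<in> arrs" "u \<in> rowspace a b h" "w \<in> colspace a b g"
  shows "commutator (up l) (\<lambda>i j. x i j + u i * w j) i j
     = commutator (up l) x i j + (row_act (up l) u i * w j + - u i * col_act (up l) w j)"
proof -
  obtain L L' where L: "\<forall>i j. i < L \<longrightarrow> x i j = 0" "\<forall>i j. j > L' \<longrightarrow> x i j = 0"
    using arrays_bounded[OF assms(1)] by blast
  obtain K K' where K: "vanishes_below K u" "\<forall>j>K'. w j = 0"
    using rowspace_vanishes_below[OF assms(2)] colspace_vanishes_above[OF assms(3)] by blast
  define M M' where "M = min L K" and "M' = max L' K'"
  have v: "vanishes_below M u" "vanishes_below M (\<lambda>s. x s j)" "vanishes_below M (\<lambda>s. x s j + u s * w j)"
    and v': "\<forall>j>M'. w j = 0" "\<forall>j>M'. x i j = 0" "\<forall>j>M'. x i j + u i * w j = 0"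
    using L K by (auto simp: vanishes_below_def M_def M'_def)
  have "col_act (up l) w j = (\<Sum>s\<in>{j..M'}. w s * up l j s)"
    "col_act (up l) (x i) j = (\<Sum>s\<in>{j..M'}. x i s * up l j s)"
    "col_act (up l) (\<lambda>s. x i s + u i * w s) j = (\<Sum>s\<in>{j..M'}. (x i s + u i * w s) * up l j s)"
    by (rule col_act_eq; use v' in simp)+
  then show ?thesis
    unfolding commutator_def row_act_up[OF v(1)] row_act_up[OF v(2)] row_act_up[OF v(3)]
    by (simp add: algebra_simps sum.distrib sum_distrib_left sum_negf)
qed

text \<open>On a product u w the two halves of the commutator have traces
  \<open>pairing (Suc k)\<close> of (u A^l, w) and of (u, A^l w), equal by
  \<open>pairing_shift\<close>.\<close>

lemma commutator_arrays:
  "x \<in> arrs \<Longrightarrow> commutator (up l) x \<in> arrs \<and> trace (Suc k) (commutator (up l) x) = 0"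
proof (induction rule: arrays.induct)
  case zero
  have "commutator (up l) (\<lambda>_ _. 0) = (\<lambda>_ _. 0)"
    by (simp add: commutator_def row_act_def col_act_def fun_eq_iff)
  then show ?case by (simp add: arrays.zero trace_zero)
next
  case (add x u w)
  have e: "commutator (up l) (\<lambda>i j. x i j + u i * w j)
     = (\<lambda>i j. commutator (up l) x i j + (row_act (up l) u i * w j + - u i * col_act (up l) w j))"
    using commutator_add_product[OF add.hyps] by (simp add: fun_eq_iff)
  have m: "(\<lambda>i. - u i) \<in> rowspace a b h"
    using rowspace.scale[OF add.hyps(2), of "- 1"] by simp
  have 1: "(\<lambda>i j. row_act (up l) u i * w j) \<in> arrs"
    using add.hyps by (intro arrays_product row_act_rowspace)
  have 2: "(\<lambda>i j. - u i * col_act (up l) w j) \<in> arrs"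
    using add.hyps m by (intro arrays_product col_act_colspace)
  have "trace (Suc k) (\<lambda>i j. - u i * col_act (up l) w j) = - pairing (Suc k) u (col_act (up l) w)"
    using trace_scale[of "Suc k" "- 1" "\<lambda>i j. u i * col_act (up l) w j"] by (simp add: trace_product)
  then have "trace (Suc k) (\<lambda>i j. row_act (up l) u i * w j + - u i * col_act (up l) w j) = 0"
    using pairing_shift[OF add.hyps(2,3)] by (subst trace_add[OF 1 2]) (simp add: trace_product)
  then show ?case
    unfolding e using trace_add[OF conjunct1[OF add.IH] arrays_add[OF 2 1]] arrays_add[OF 1]
      arrays_add[OF arrays_add[OF 2 1] conjunct1[OF add.IH]] add.IH by simp
qed

lemma single_array: "(\<lambda>i j. if i = p \<and> j = q then c else 0) \<in> arrs"
proof -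
  have "(\<lambda>i. c * (if i = p then 1 else 0)) \<in> rowspace a b h"
    by (intro rowspace.scale rowspace.unit)
  from arrays_product[OF this unit_in_colspace[of q]] show ?thesis
    by (rule back_subst[of "\<lambda>x. x \<in> arrs"]) (auto simp: fun_eq_iff)
qed

lemma finite_support_array:
  assumes "finite P" "\<And>i j. (i, j) \<notin> P \<Longrightarrow> x i j = 0"
  shows "x \<in> arrs"
proof -
  have "(\<lambda>i j. \<Sum>(p, q)\<in>P. if i = p \<and> j = q then x p q else 0) \<in> arrs"
    using arrays_sum[OF assms(1), of "\<lambda>(p, q) i j. if i = p \<and> j = q then x p q else 0"] single_array
    by (simp add: case_prod_unfold)
  moreover have "(\<Sum>(p, q)\<in>P. if i = p \<and> j = q then x p q else 0) = x i j" for i j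
  proof -
    have "(\<Sum>(p, q)\<in>P. if i = p \<and> j = q then x p q else 0) = (\<Sum>s\<in>P. if s = (i, j) then x i j else 0)"
      by (rule sum.cong) (auto split: if_splits)
    then show ?thesis using assms by simp
  qed
  ultimately show ?thesis by simp
qed

text \<open>The central term of the commutator of \<open>J\<^sub>l\<close> with a fermion bilinear.\<close>

definition cocycle :: "nat \<Rightarrow> int \<Rightarrow> int \<Rightarrow> complex" where
  "cocycle l i j = (if j \<le> 0 \<and> 0 < i then up l j i else 0)"

text \<open>Splitting at 0 gives l products of modes with Laurent indices l - m and m. These add up
  to l, so each product pairs to 1 if k = l and to 0 otherwise. The term m = l is absent since
  \<open>row_mode\<close> vanishes at index 0.\<close>

lemma cocycle_array: "cocycle l \<in> arrs" "trace k (cocycle l) = (if k = l then of_nat l else 0)"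
proof -
  have e: "cocycle l = (\<lambda>i j. \<Sum>m<l. row_mode a b h 0 (l - m) i * col_mode a b g 0 m j)"
  proof (intro ext)
    fix i j
    show "cocycle l i j = (\<Sum>m<l. row_mode a b h 0 (l - m) i * col_mode a b g 0 m j)"
    proof (cases "j \<le> 0 \<and> 0 < i")
      case True
      then show ?thesis using tri_split[of j 0 i a b g h l]
        by (simp add: cocycle_def lessThan_Suc_atMost[symmetric] mult.commute)
    next
      case False
      then show ?thesis by (auto simp: cocycle_def row_mode_def col_mode_def)
    qed
  qed
  have p: "(\<lambda>i j. row_mode a b h 0 (l - m) i * col_mode a b g 0 m j) \<in> arrs" if "m < l" for m
    using that by (intro arrays_product rowspace.mode col_mode_in_colspace) simp
  then show "cocycle l \<in> arrs" unfolding e by (intro arrays_sum) auto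
  have "trace k (cocycle l) = (\<Sum>m<l. trace k (\<lambda>i j. row_mode a b h 0 (l - m) i * col_mode a b g 0 m j))"
    unfolding e using p by (intro trace_sum) auto
  also have "\<dots> = (\<Sum>m<l. if k = l then 1 else 0)"
    by (rule sum.cong) (auto simp: trace_product pairing_modes)
  finally show "trace k (cocycle l) = (if k = l then of_nat l else 0)" by auto
qed

end

section \<open>From symmetric functions and vacuum expectations to triangular matrices\<close>

lemma elem_sym_0: "elem_sym 0 x I = 1" if "finite I"
proof -
  have "{X. X \<subseteq> I \<and> card X = 0} = {{}}"
    using that by (auto dest: finite_subset)
  then show ?thesis by (simp add: elem_sym_def)
qed

lemma elem_sym_above: "elem_sym r x I = 0" if "finite I" "card I < r"
proof -
  have "{X. X \<subseteq> I \<and> card X = r} = {}"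
    using that by (auto dest: card_mono)
  then show ?thesis by (simp only: elem_sym_def sum.empty)
qed

lemma inj_on_insert_avoiding: "p \<notin> I \<Longrightarrow> inj_on (insert p) (Pow I)"
  by (rule inj_onI) (metis PowD insert_ident subsetD)

lemma elem_sym_insert:
  assumes "finite I" "p \<notin> I"
  shows "elem_sym (Suc r) x (insert p I) = elem_sym (Suc r) x I + x p * elem_sym r x I"
proof -
  let ?S = "\<lambda>r. {X. X \<subseteq> I \<and> card X = r}"
  have fin: "finite (?S r)" for r
    by (rule finite_subset[of _ "Pow I"]) (use assms in auto)
  have "{X. X \<subseteq> insert p I \<and> card X = Suc r} = ?S (Suc r) \<union> insert p ` ?S r"
  proof (intro equalityI subsetI)
    fix X assume X: "X \<in> {X. X \<subseteq> insert p I \<and> card X = Suc r}"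
    show "X \<in> ?S (Suc r) \<union> insert p ` ?S r"
    proof (cases "p \<in> X")
      case True
      then have "X = insert p (X - {p})" "X - {p} \<in> ?S r"
        using X assms by (auto simp: card_Diff_singleton)
      then show ?thesis by blast
    qed (use X in auto)
  next
    fix X assume "X \<in> ?S (Suc r) \<union> insert p ` ?S r"
    then show "X \<in> {X. X \<subseteq> insert p I \<and> card X = Suc r}"
      using assms by (auto simp: card_insert_if finite_subset)
  qed
  moreover have "?S (Suc r) \<inter> insert p ` ?S r = {}"
    using assms by auto
  moreover have "inj_on (insert p) (?S r)"
    by (rule inj_on_subset[OF inj_on_insert_avoiding[OF assms(2)]]) auto
  moreover have "(\<Prod>s\<in>insert p X. x s) = x p * (\<Prod>s\<in>X. x s)" if "X \<in> ?S r" for X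
    using that assms by (subst prod.insert) (auto dest: finite_subset)
  ultimately show ?thesis
    unfolding elem_sym_def using fin
    by (simp add: sum.union_disjoint sum.reindex sum_distrib_left)
qed

text \<open>The factors are X - x rather than 1 - xX, so the elementary polynomials are read off
  from the top coefficient downwards.\<close>

lemma fps_prod_linear_nth:
  fixes x :: "int \<Rightarrow> complex"
  assumes "finite I"
  shows "fps_nth (\<Prod>s\<in>I. fps_X - fps_const (x s)) n
     = (if n \<le> card I then elem_sym (card I - n) (\<lambda>s. - x s) I else 0)"
  using assms
proof (induction I arbitrary: n rule: finite_induct)
  case empty
  then show ?case by (simp add: elem_sym_0)
next
  case (insert p I)
  let ?P = "\<Prod>s\<in>I. fps_X - fps_const (x s)"
  have "fps_nth (\<Prod>s\<in>insert p I. fps_X - fps_const (x s)) n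
     = (if n = 0 then 0 else fps_nth ?P (n - 1)) - x p * fps_nth ?P n"
    using insert.hyps by (simp add: left_diff_distrib)
  also have "\<dots> = (if n \<le> card (insert p I) then elem_sym (card (insert p I) - n) (\<lambda>s. - x s) (insert p I) else 0)"
  proof (cases n)
    case 0
    then show ?thesis
      using insert.hyps by (simp add: insert.IH elem_sym_insert elem_sym_above)
  next
    case (Suc m)
    consider "m > card I" | "m = card I" | "m < card I" by linarith
    then show ?thesis
    proof cases
      case 3
      then have "card I - m = Suc (card I - Suc m)" by simp
      with 3 show ?thesis using insert.hyps Suc
        by (simp add: insert.IH elem_sym_insert)
    qed (use insert.hyps Suc in \<open>simp_all add: insert.IH elem_sym_0\<close>)
  qed
  finally show ?case .
qed

abbreviation msets :: "int set \<Rightarrow> nat \<Rightarrow> int multiset set" where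
  "msets I n \<equiv> {M. set_mset M \<subseteq> I \<and> size M = n}"

lemma finite_msets: "finite I \<Longrightarrow> finite (msets I n)"
proof (induction n)
  case 0
  have "msets I 0 = {{#}}" by auto
  then show ?case by simp
next
  case (Suc n)
  have "msets I (Suc n) \<subseteq> (\<lambda>(p, M). add_mset p M) ` (I \<times> msets I n)"
  proof
    fix M assume M: "M \<in> msets I (Suc n)"
    then obtain p N where "M = add_mset p N" by (metis (mono_tags) mem_Collect_eq size_eq_Suc_imp_eq_union)
    with M show "M \<in> (\<lambda>(p, M). add_mset p M) ` (I \<times> msets I n)" by auto
  qed
  then show ?case using Suc by (auto intro: finite_subset)
qed

lemma comp_sym_0: "comp_sym 0 x I = 1"
proof -
  have "msets I 0 = {{#}}" by auto
  then show ?thesis by (simp add: comp_sym_def)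
qed

lemma comp_sym_insert:
  assumes "finite I" "p \<notin> I"
  shows "comp_sym (Suc n) x (insert p I) = comp_sym (Suc n) x I + x p * comp_sym n x (insert p I)"
proof -
  have "msets (insert p I) (Suc n) = msets I (Suc n) \<union> add_mset p ` msets (insert p I) n"
  proof (intro equalityI subsetI)
    fix M assume M: "M \<in> msets (insert p I) (Suc n)"
    show "M \<in> msets I (Suc n) \<union> add_mset p ` msets (insert p I) n"
    proof (cases "p \<in># M")
      case True
      then obtain N where "M = add_mset p N" by (metis insert_DiffM)
      with M show ?thesis by auto
    qed (use M in auto)
  next
    fix M assume "M \<in> msets I (Suc n) \<union> add_mset p ` msets (insert p I) n"
    then show "M \<in> msets (insert p I) (Suc n)" by auto
  qed
  moreover have "msets I (Suc n) \<inter> add_mset p ` msets (insert p I) n = {}"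
    using assms by auto
  moreover have "inj_on (add_mset p) (msets (insert p I) n)"
    by (simp add: inj_on_def)
  ultimately show ?thesis
    unfolding comp_sym_def using assms finite_msets
    by (simp add: sum.union_disjoint sum.reindex sum_distrib_left)
qed

text \<open>Multiplying by 1 - xX for the new variable gives the coefficients the recursion of
  \<open>comp_sym_insert\<close>: a multiset either avoids p or loses one copy of it.\<close>

lemma fps_prod_pole_nth:
  assumes "finite I"
  shows "fps_nth (\<Prod>s\<in>I. pole_fps (x s)) n = comp_sym n x I"
  using assms
proof (induction I arbitrary: n rule: finite_induct)
  case empty
  show ?case
  proof (cases n)
    case (Suc m)
    have "msets {} (Suc m) = {}" by auto
    then show ?thesis using Suc by (simp only: comp_sym_def sum.empty) simp
  qed (simp add: comp_sym_0)
next
  case (insert p I)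
  define F where "F = (\<Prod>s\<in>I. pole_fps (x s))"
  define G where "G = pole_fps (x p) * F"
  have "G * (1 - fps_const (x p) * fps_X) = F"
    using pole_fps_mult[of "x p"] unfolding G_def by (metis mult.commute mult.left_commute mult_1_right)
  then have "G = F + fps_X * (fps_const (x p) * G)"
    by (simp add: algebra_simps)
  then have "fps_nth G n = fps_nth (F + fps_X * (fps_const (x p) * G)) n" for n by (rule arg_cong)
  then have rec: "fps_nth G n = fps_nth F n + (if n = 0 then 0 else x p * fps_nth G (n - 1))" for n
    by simp
  have "fps_nth G n = comp_sym n x (insert p I)"
  proof (induction n)
    case 0
    then show ?case using rec[of 0] insert.IH[of 0] by (simp add: F_def comp_sym_0)
  next
    case (Suc n)
    then show ?case using rec[of "Suc n"] insert.IH[of "Suc n"] insert.hyps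
      by (simp add: F_def comp_sym_insert)
  qed
  then show ?case using insert.hyps by (simp add: G_def F_def)
qed

lemma tri_symmetric_functions:
  assumes "i < j"
  shows "tri a b g h k i j = g i * h j *
    (\<Sum>(r, s) \<in> {(r, s). r \<le> card {i+1..j-1} \<and> int r - int s = j - i - int k}.
       elem_sym r (\<lambda>s. - a s) {i+1..j-1} * comp_sym s b {i..j})"
proof -
  let ?I = "{i+1..j-1}"
  define N where "N = card ?I"
  have N: "int N = j - i - 1" using assms by (simp add: N_def)
  have I: "{i<..j - 1} = ?I" "{i..j} = insert i (insert j ?I)" using assms by auto
  define F G where "F = (\<Prod>s\<in>?I. fps_X - fps_const (a s))" and "G = (\<Prod>s\<in>{i..j}. pole_fps (b s))"
  have "zero_pole a b i (j - 1) * (pole_fps (b i) * pole_fps (b j)) = F * G"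
    unfolding F_def G_def zero_pole_def I using assms by (simp add: prod.distrib mult_ac)
  then have e: "tri a b g h k i j = g i * h j * fps_nth (fps_X * (F * G)) k"
    using assms by (simp add: tri_def mult.assoc)
  have F: "fps_nth F n = (if n \<le> N then elem_sym (N - n) (\<lambda>s. - a s) ?I else 0)" for n
    unfolding F_def N_def by (rule fps_prod_linear_nth) simp
  have G: "fps_nth G n = comp_sym n b {i..j}" for n
    unfolding G_def by (rule fps_prod_pole_nth) simp
  have "fps_nth (fps_X * (F * G)) k
     = (\<Sum>(r, s) \<in> {(r, s). r \<le> N \<and> int r - int s = j - i - int k}. elem_sym r (\<lambda>s. - a s) ?I * comp_sym s b {i..j})"
  proof (cases k)
    case 0
    have "r \<le> N \<Longrightarrow> int r - int s = j - i - int k \<Longrightarrow> False" for r s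
      using N 0 by linarith
    then have "{(r, s). r \<le> N \<and> int r - int s = j - i - int k} = {}" by blast
    then show ?thesis using 0 by (simp only: sum.empty) simp
  next
    case (Suc m)
    have "fps_nth (fps_X * (F * G)) k = (\<Sum>n\<le>m. fps_nth F n * fps_nth G (m - n))"
      using Suc by (simp add: fps_mult_nth[of F G] atMost_atLeast0)
    also have "\<dots> = (\<Sum>n\<in>{n. n \<le> m \<and> n \<le> N}. elem_sym (N - n) (\<lambda>s. - a s) ?I * comp_sym (m - n) b {i..j})"
      by (rule sum.mono_neutral_cong_right) (auto simp: F G)
    \<comment> \<open>The substitution is r = N - n and s = m - n. With N = j - i - 1 and m = k - 1
      this gives r - s = j - i - k.\<close>
    also have "\<dots> = (\<Sum>(r, s) \<in> {(r, s). r \<le> N \<and> int r - int s = j - i - int k}. elem_sym r (\<lambda>s. - a s) ?I * comp_sym s b {i..j})"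
      by (rule sum.reindex_bij_witness[where i = "\<lambda>(r, s). N - r" and j = "\<lambda>n. (N - n, m - n)"])
         (use N Suc in auto)
    finally show ?thesis .
  qed
  then show ?thesis by (simp only: e N_def)
qed

abbreviation defect :: "(int \<Rightarrow> complex) \<Rightarrow> (int \<Rightarrow> complex) \<Rightarrow> int \<Rightarrow> complex" where
  "defect \<alpha> \<beta> \<equiv> \<lambda>i. 1 - \<alpha> i * \<beta> i"

lemma A_pos:
  assumes "k > 0"
  shows "A \<alpha> \<beta> (int k) i j = tri \<alpha> \<beta> (\<lambda>_. 1) (defect \<alpha> \<beta>) k i j"
proof -
  consider "i = j" | "j < i" | "i < j" by linarith
  then show ?thesis
  proof cases
    case 3
    then show ?thesis using assms by (simp add: A_def tri_symmetric_functions)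
  qed (use assms in \<open>simp_all add: A_def tri_def\<close>)
qed

text \<open>Exchanging r with s, \<alpha> with \<beta> and i with j turns the formula for -k into
  the one for k. The weight stays attached to the smaller index, so it moves to the other weight
  slot of \<open>tri\<close>.\<close>

lemma A_neg:
  assumes "k > 0"
  shows "A \<alpha> \<beta> (- int k) i j = tri \<beta> \<alpha> (defect \<alpha> \<beta>) (\<lambda>_. 1) k j i"
proof -
  consider "i = j" | "i < j" | "j < i" by linarith
  then show ?thesis
  proof cases
    case 3
    have "(\<Sum>(r, s) \<in> {(r, s). s \<le> card {j+1..i-1} \<and> int r - int s = j - i + int k}.
             comp_sym r \<alpha> {j..i} * elem_sym s (\<lambda>s. - \<beta> s) {j+1..i-1})
      = (\<Sum>(r, s) \<in> {(r, s). r \<le> card {j+1..i-1} \<and> int r - int s = i - j - int k}.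
             elem_sym r (\<lambda>s. - \<beta> s) {j+1..i-1} * comp_sym s \<alpha> {j..i})"
      by (rule sum.reindex_bij_witness[where i = prod.swap and j = prod.swap]) (auto simp: mult.commute)
    then show ?thesis using 3 assms by (simp add: A_def tri_symmetric_functions)
  qed (use assms in \<open>simp_all add: A_def tri_def\<close>)
qed

section \<open>Laurent expansions of the fermion modes at 0 and at infinity\<close>

lemma fls_inverse_pole: "inverse (1 - fls_X * fls_const b) = fps_to_fls (pole_fps b)"
proof -
  have "fps_to_fls ((1 - fps_X * fps_const b) * pole_fps b) = 1"
    using pole_fps_mult[of b] by (simp only: mult.commute fps_one_to_fls)
  then have "(1 - fls_X * fls_const b) * fps_to_fls (pole_fps b) = 1"
    by (simp only: fls_times_fps_to_fls fps_to_fls_minus fps_one_to_fls fps_X_to_fls fps_const_to_fls)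
  then show ?thesis by (rule inverse_unique)
qed

lemma fls_X_X_inv: "fls_X * fls_X_inv = (1 :: complex fls)" "fls_X_inv * fls_X = (1 :: complex fls)"
  using right_inverse[of "fls_X :: complex fls"] left_inverse[of "fls_X :: complex fls"]
  by (simp_all add: fls_inverse_X)

lemma fls_inverse_pole_inf: "inverse (fls_X_inv - fls_const b) = fls_X * fps_to_fls (pole_fps b)"
proof -
  have "fls_X_inv - fls_const b = fls_X_inv * (1 - fls_X * fls_const b)"
    by (simp add: right_diff_distrib fls_X_X_inv flip: mult.assoc)
  then show ?thesis by (simp add: fls_inverse_pole fls_inverse_X_inv)
qed

lemma fls_zero_inf: fixes a :: complex shows "1 - fls_X_inv * fls_const a = fls_X_inv * (fls_X - fls_const a)"
  by (simp only: right_diff_distrib fls_X_X_inv)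

lemma fps_to_fls_prod: "fps_to_fls (prod f S) = (\<Prod>s\<in>S. fps_to_fls (f s))"
  for f :: "'b \<Rightarrow> 'a::comm_ring_1 fps"
  by (induction S rule: infinite_finite_induct) (simp_all add: fls_times_fps_to_fls)

lemma fps_to_fls_zero_pole:
  "fps_to_fls (zero_pole a b m n) = (\<Prod>s\<in>{m<..n}. (fls_X - fls_const (a s)) * fps_to_fls (pole_fps (b s)))"
  by (simp add: zero_pole_def fps_to_fls_prod fls_times_fps_to_fls)

lemma defect_fls: fixes z :: complex shows "1 - fls_const z = fls_const (1 - z)"
  by (simp add: fls_minus_const flip: fls_const_1)

lemmas prod_inverse = prod_inversef[unfolded o_def]

lemma semi_pow_nonpos: "k \<le> 0 \<Longrightarrow> semi_pow z a k = inverse (\<Prod>i\<in>{k<..0}. 1 - z * a i)"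
  unfolding prod_inverse[symmetric] by (auto simp: semi_pow_def intro!: prod.cong)

lemma bar_pow_nonpos: "k \<le> 0 \<Longrightarrow> bar_pow z b k = inverse (\<Prod>i\<in>{k<..0}. z - b i)"
  unfolding prod_inverse[symmetric] by (auto simp: bar_pow_def intro!: prod.cong)

lemma semi_pow_nonneg: "0 \<le> k \<Longrightarrow> semi_pow z a k = (\<Prod>i\<in>{0<..k}. 1 - z * a i)"
  by (auto simp: semi_pow_def intro!: prod.cong)

lemma bar_pow_nonneg: "0 \<le> k \<Longrightarrow> bar_pow z b k = (\<Prod>i\<in>{0<..k}. z - b i)"
  by (auto simp: bar_pow_def intro!: prod.cong)

text \<open>With z = 1/X every numerator 1 - za contributes a factor 1/X and every pole 1/(z - b) a
  factor X; paired over the same index set these cancel.\<close>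

lemma prod_fls_pair:
  fixes f g :: "int \<Rightarrow> complex fls"
  shows "(\<Prod>s\<in>S. fls_X_inv * f s) * (\<Prod>s\<in>S. fls_X * g s) = (\<Prod>s\<in>S. f s * g s)"
proof -
  have "fls_X_inv * f s * (fls_X * g s) = (fls_X_inv * fls_X) * (f s * g s)" for s
    by (simp only: mult_ac)
  then show ?thesis by (simp only: prod.distrib[symmetric] fls_X_X_inv mult_1_left)
qed

text \<open>The exponents i - 1 and i leave one unpaired pole, at \<beta> i; its factor X cancels
  the prefactor z.\<close>

lemma psi_at_inf_nonpos:
  assumes "i \<le> 0"
  shows "fls_nth (psi_at_inf \<alpha> \<beta> i) (int m) = col_mode \<alpha> \<beta> (\<lambda>_. 1) 0 m i"
proof -
  have I: "{i - 1<..0} = insert i {i<..0}" using assms by auto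
  have "psi_at_inf \<alpha> \<beta> i = fls_X_inv * ((\<Prod>s\<in>{i - 1<..0}. inverse (fls_X_inv - fls_const (\<beta> s)))
      * (\<Prod>s\<in>{i<..0}. 1 - fls_X_inv * fls_const (\<alpha> s)))"
    unfolding psi_at_inf_def psi_coeff_def divide_inverse semi_pow_nonpos[OF assms] prod_inverse
    using assms by (subst bar_pow_nonpos) (auto simp: mult.assoc)
  also have "\<dots> = (fls_X_inv * fls_X) * (fps_to_fls (pole_fps (\<beta> i)) *
      ((\<Prod>s\<in>{i<..0}. fls_X_inv * (fls_X - fls_const (\<alpha> s))) * (\<Prod>s\<in>{i<..0}. fls_X * fps_to_fls (pole_fps (\<beta> s)))))"
    unfolding I fls_zero_inf fls_inverse_pole_inf by (simp add: mult_ac)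
  also have "\<dots> = fps_to_fls (zero_pole \<alpha> \<beta> i 0 * pole_fps (\<beta> i))"
    unfolding prod_fls_pair fls_X_X_inv fls_times_fps_to_fls fps_to_fls_zero_pole by (simp add: mult.commute)
  finally show ?thesis using assms by (simp add: col_mode_def)
qed

lemma psi_star_at_0_nonpos:
  assumes "i \<le> 0"
  shows "fls_nth (psi_star_at_0 \<alpha> \<beta> i) (int m) = col_mode \<beta> \<alpha> (defect \<alpha> \<beta>) 0 m i"
proof -
  have I: "{i - 1<..0} = insert i {i<..0}" using assms by auto
  have "psi_star_at_0 \<alpha> \<beta> i = (1 - fls_const (\<alpha> i) * fls_const (\<beta> i)) * ((\<Prod>s\<in>{i - 1<..0}. inverse (1 - fls_X * fls_const (\<alpha> s)))
      * (\<Prod>s\<in>{i<..0}. fls_X - fls_const (\<beta> s)))"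
    unfolding psi_star_at_0_def psi_star_coeff_def divide_inverse bar_pow_nonpos[OF assms] prod_inverse
    using assms by (subst semi_pow_nonpos) (auto simp: mult.assoc)
  also have "\<dots> = fps_to_fls (fps_const (1 - \<alpha> i * \<beta> i) * (zero_pole \<beta> \<alpha> i 0 * pole_fps (\<alpha> i)))"
    unfolding I fls_inverse_pole fls_times_fps_to_fls fps_to_fls_zero_pole
    by (simp add: defect_fls prod.distrib mult_ac)
  finally show ?thesis using assms by (simp add: col_mode_def)
qed

text \<open>Again one pole is unpaired, but there is no prefactor z: the surviving X is the factor
  \<open>fps_X\<close> in \<open>row_mode\<close>.\<close>

lemma psi_star_at_inf_pos:
  assumes "i > 0"
  shows "fls_nth (psi_star_at_inf \<alpha> \<beta> i) (int m) = row_mode \<alpha> \<beta> (defect \<alpha> \<beta>) 0 m i"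
proof -
  have I: "{0<..i} = insert i {0<..i - 1}" using assms by auto
  have "psi_star_at_inf \<alpha> \<beta> i = (1 - fls_const (\<alpha> i) * fls_const (\<beta> i)) * ((\<Prod>s\<in>{0<..i}. inverse (fls_X_inv - fls_const (\<beta> s)))
      * (\<Prod>s\<in>{0<..i - 1}. 1 - fls_X_inv * fls_const (\<alpha> s)))"
    unfolding psi_star_at_inf_def psi_star_coeff_def divide_inverse prod_inverse
    using assms by (subst semi_pow_nonneg, simp, subst bar_pow_nonneg) (auto simp: mult_ac)
  also have "\<dots> = (1 - fls_const (\<alpha> i) * fls_const (\<beta> i)) * (fls_X * fps_to_fls (pole_fps (\<beta> i)) *
      ((\<Prod>s\<in>{0<..i - 1}. fls_X_inv * (fls_X - fls_const (\<alpha> s))) * (\<Prod>s\<in>{0<..i - 1}. fls_X * fps_to_fls (pole_fps (\<beta> s)))))"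
    unfolding I fls_zero_inf fls_inverse_pole_inf by (simp add: mult_ac)
  also have "\<dots> = fps_to_fls (fps_const (1 - \<alpha> i * \<beta> i) * (fps_X * zero_pole \<alpha> \<beta> 0 (i - 1) * pole_fps (\<beta> i)))"
    unfolding prod_fls_pair fls_times_fps_to_fls fps_to_fls_zero_pole
    by (simp add: defect_fls mult_ac)
  finally have "fls_nth (psi_star_at_inf \<alpha> \<beta> i) (int m)
      = fps_nth (fps_const (1 - \<alpha> i * \<beta> i) * (fps_X * zero_pole \<alpha> \<beta> 0 (i - 1) * pole_fps (\<beta> i))) m"
    by (simp only: fps_to_fls_nth) simp
  then show ?thesis using assms
    by (simp only: row_mode_def fps_mult_left_const_nth if_True)
qed

lemma psi_at_0_pos:
  assumes "i > 0"
  shows "fls_nth (psi_at_0 \<alpha> \<beta> i) (int m) = row_mode \<beta> \<alpha> (\<lambda>_. 1) 0 m i"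
proof -
  have I: "{0<..i} = insert i {0<..i - 1}" using assms by auto
  have "psi_at_0 \<alpha> \<beta> i = fls_X * ((\<Prod>s\<in>{0<..i - 1}. fls_X - fls_const (\<beta> s))
      * (\<Prod>s\<in>{0<..i}. inverse (1 - fls_X * fls_const (\<alpha> s))))"
    unfolding psi_at_0_def psi_coeff_def divide_inverse prod_inverse
    using assms by (subst semi_pow_nonneg, simp, subst bar_pow_nonneg) (auto simp: mult_ac)
  also have "\<dots> = fps_to_fls (fps_X * zero_pole \<beta> \<alpha> 0 (i - 1) * pole_fps (\<alpha> i))"
    unfolding I fls_inverse_pole fls_times_fps_to_fls fps_to_fls_zero_pole
    by (simp add: prod.distrib mult_ac)
  finally have "fls_nth (psi_at_0 \<alpha> \<beta> i) (int m)
      = fps_nth (fps_X * zero_pole \<beta> \<alpha> 0 (i - 1) * pole_fps (\<alpha> i)) m"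
    by (simp only: fps_to_fls_nth) simp
  then show ?thesis using assms
    by (simp only: row_mode_def if_True mult_1_left)
qed

section \<open>The expectation formulas as biorthogonality relations\<close>

lemma maya_empty: "maya empty_partition = {..0}"
proof -
  have "s \<in> range (\<lambda>i. - int i)" if "s \<le> 0" for s
    using that by (intro image_eqI[of _ _ "nat (- s)"]) auto
  then show ?thesis by (auto simp: maya_def empty_partition_def)
qed

lemma minus_one_power_square: "(- 1) ^ n * (- 1) ^ n = (1 :: complex)"
  by (cases "even n") simp_all

lemma vacuum_psi_psi_star:
  "bra empty_partition (psi i (psi_star j (ket empty_partition))) = (if i = j \<and> i \<le> 0 then 1 else 0)"
proof -
  consider "i > 0" | "i \<le> 0" "j = i" | "i \<le> 0" "j \<noteq> i" by linarith
  then show ?thesis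
  proof cases
    case 1
    then show ?thesis by (simp add: bra_def psi_def maya_empty)
  next
    case 2
    then have "insert i ({..0} - {i}) = {..0}" "{s \<in> {..0} - {i}. i < s} = {s \<in> {..0}. i < s}"
      by auto
    then show ?thesis using 2
      by (simp add: bra_def psi_def psi_star_def ket_def maya_empty minus_one_power_square)
  next
    case 3
    then have "i \<in> {..0}" "i \<notin> insert j ({..0} - {i})" by auto
    then have "insert j ({..0} - {i}) \<noteq> {..0}" by metis
    then show ?thesis using 3 by (simp add: bra_def psi_def psi_star_def ket_def maya_empty)
  qed
qed

lemma vacuum_psi_star_psi:
  "bra empty_partition (psi_star j (psi i (ket empty_partition))) = (if i = j \<and> i > 0 then 1 else 0)"
proof -
  consider "j \<le> 0" | "j > 0" "i = j" | "j > 0" "i \<noteq> j" by linarith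
  then show ?thesis
  proof cases
    case 1
    then show ?thesis by (simp add: bra_def psi_star_def maya_empty)
  next
    case 2
    then have e: "insert j {..0} - {j} = {..0}" "{s \<in> {..0}. j < s} = {}" "{s \<in> insert j {..0}. j < s} = {}"
      by auto
    have "psi j (ket empty_partition) (insert j {..0}) = 1"
      unfolding psi_def e by (simp add: ket_def maya_empty)
    moreover have "psi_star j v {..0} = v (insert j {..0})" for v
      using 2 unfolding psi_star_def e by simp
    ultimately show ?thesis using 2 by (simp add: bra_def maya_empty)
  next
    case 3
    then have "j \<in> insert j {..0} - {i}" "j \<notin> {..0}" by auto
    then have "insert j {..0} - {i} \<noteq> {..0}" by metis
    then show ?thesis using 3 by (simp add: bra_def psi_def psi_star_def ket_def maya_empty)
  qed
qed

lemma has_sum_diagonal: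
  fixes f :: "int \<Rightarrow> int \<Rightarrow> complex"
  assumes "((\<lambda>(i, j). f i j) has_sum S) UNIV" "\<And>i j. \<not> (i = j \<and> i \<in> X) \<Longrightarrow> f i j = 0"
    and "\<And>i. i \<in> X \<Longrightarrow> f i i = g i"
  shows "(g has_sum S) X"
proof -
  have "((\<lambda>(i, j). f i j) has_sum S) ((\<lambda>i. (i, i)) ` X)"
  proof (rule iffD1[OF has_sum_cong_neutral assms(1)])
    fix p assume "p \<in> UNIV - (\<lambda>i. (i, i)) ` X"
    then have "\<not> (fst p = snd p \<and> fst p \<in> X)" by (cases p) auto
    from assms(2)[OF this] show "(case p of (i, j) \<Rightarrow> f i j) = 0" by (simp add: case_prod_unfold)
  qed auto
  moreover have "inj_on (\<lambda>i. (i, i)) X" by (rule inj_onI) simp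
  ultimately have "((\<lambda>i. f i i) has_sum S) X"
    using has_sum_reindex[of "\<lambda>i. (i, i)" X "\<lambda>(i, j). f i j" S] by (simp add: o_def)
  moreover have "((\<lambda>i. f i i) has_sum S) X \<longleftrightarrow> (g has_sum S) X"
    using assms(3) by (rule has_sum_cong)
  ultimately show ?thesis by simp
qed

text \<open>The vacuum matrix elements vanish off the diagonal and are 1 there exactly for i > 0
  (psi_star psi) or i <= 0 (psi psi_star), so each double sum collapses to one of the two
  assumptions of the locale.\<close>

lemma two_sided_vacuum:
  assumes "vev_psi_psi_star \<alpha> \<beta>" "vev_psi_star_psi \<alpha> \<beta>"
  shows "two_sided \<alpha> \<beta> (\<lambda>_. 1) (defect \<alpha> \<beta>)"
proof -
  have pos: "((\<lambda>i. row_mode \<alpha> \<beta> (defect \<alpha> \<beta>) 0 n i * row_mode \<beta> \<alpha> (\<lambda>_. 1) 0 m i)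
      has_sum (if n = m then 1 else 0)) {0<..}" if "m \<ge> 1" for n m
  proof (rule has_sum_diagonal)
    show "((\<lambda>(i, j). fls_nth (psi_star_at_inf \<alpha> \<beta> j) (int n) * fls_nth (psi_at_0 \<alpha> \<beta> i) (int m) *
            bra empty_partition (psi_star j (psi i (ket empty_partition))))
         has_sum (if n = m then 1 else 0)) UNIV"
      using assms(2)[unfolded vev_psi_star_psi_def, rule_format, of "int n" "int m"] that by simp
  qed (auto simp: vacuum_psi_star_psi psi_star_at_inf_pos psi_at_0_pos)
  have neg: "((\<lambda>i. col_mode \<alpha> \<beta> (\<lambda>_. 1) 0 n i * col_mode \<beta> \<alpha> (defect \<alpha> \<beta>) 0 m i)
      has_sum (if n = m then 1 else 0)) {..0}" for n m
  proof (rule has_sum_diagonal)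
    show "((\<lambda>(i, j). fls_nth (psi_at_inf \<alpha> \<beta> i) (int n) * fls_nth (psi_star_at_0 \<alpha> \<beta> j) (int m) *
            bra empty_partition (psi i (psi_star j (ket empty_partition))))
         has_sum (if n = m then 1 else 0)) UNIV"
      using assms(1)[unfolded vev_psi_psi_star_def, rule_format, of "int n" "int m"] by simp
  qed (auto simp: vacuum_psi_psi_star psi_at_inf_nonpos psi_star_at_0_nonpos)
  have bij: "bij_betw (\<lambda>i::int. 1 - i) {0<..} {..0}"
    by (rule bij_betwI[of _ _ _ "\<lambda>i. 1 - i"]) auto
  show ?thesis
  proof (intro two_sided.intro row_side.intro)
    show "row_side_axioms \<alpha> \<beta> (\<lambda>_. 1) (defect \<alpha> \<beta>)"
      by (rule row_side_axioms.intro) (rule pos)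
    show "row_side_axioms (flip \<alpha>) (flip \<beta>) (flip (defect \<alpha> \<beta>)) (flip (\<lambda>_. 1))"
    proof
      fix n m :: nat assume "n \<ge> 1" "m \<ge> 1"
      then obtain n' m' where nm: "n = Suc n'" "m = Suc m'" by (metis Suc_le_D One_nat_def)
      have "((\<lambda>i. col_mode \<alpha> \<beta> (\<lambda>_. 1) 0 n' (1 - i) * col_mode \<beta> \<alpha> (defect \<alpha> \<beta>) 0 m' (1 - i))
          has_sum (if n = m then 1 else 0)) {0<..}"
        using has_sum_reindex_bij_betw[OF bij, of "\<lambda>i. col_mode \<alpha> \<beta> (\<lambda>_. 1) 0 n' i * col_mode \<beta> \<alpha> (defect \<alpha> \<beta>) 0 m' i"]
          neg[of n' m'] by (simp add: nm)
      then show "((\<lambda>i. row_mode (flip \<alpha>) (flip \<beta>) (flip (\<lambda>_. 1)) 0 n i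
          * row_mode (flip \<beta>) (flip \<alpha>) (flip (defect \<alpha> \<beta>)) 0 m i) has_sum (if n = m then 1 else 0)) {0<..}"
        by (simp add: col_mode_flip nm)
    qed
  qed (auto intro!: weights.intro)
qed

section \<open>Currents on Fock space\<close>

text \<open>The type \<open>fock\<close> also allows sets with infinitely many elements above a
  point, where \<open>card\<close> returns 0 and the signs of \<open>psi\<close> and
  \<open>psi_star\<close> lose their meaning.\<close>

definition bounded_above :: "int set \<Rightarrow> bool" where
  "bounded_above S \<longleftrightarrow> (\<forall>j. finite {s \<in> S. j < s})"

definition wedge_sign :: "int \<Rightarrow> int set \<Rightarrow> complex" where
  "wedge_sign j S = (- 1) ^ card {s \<in> S. j < s}"

lemma bounded_above_insert [simp]: "bounded_above (insert i S) \<longleftrightarrow> bounded_above S"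
proof -
  have "{s \<in> insert i S. j < s} = (if j < i then insert i {s \<in> S. j < s} else {s \<in> S. j < s})" for j
    by auto
  then show ?thesis by (simp add: bounded_above_def)
qed

lemma bounded_above_remove [simp]: "bounded_above (S - {i}) \<longleftrightarrow> bounded_above S"
  using bounded_above_insert[of i "S - {i}"] by (cases "i \<in> S") (simp_all add: insert_absorb)

lemma wedge_sign_insert:
  assumes "bounded_above S" "i \<notin> S"
  shows "wedge_sign j (insert i S) = (if j < i then - 1 else 1) * wedge_sign j S"
proof -
  have "{s \<in> insert i S. j < s} = (if j < i then insert i {s \<in> S. j < s} else {s \<in> S. j < s})"
    by auto
  then show ?thesis using assms by (simp add: wedge_sign_def bounded_above_def)
qed

lemma wedge_sign_remove:
  assumes "bounded_above S" "i \<in> S"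
  shows "wedge_sign j (S - {i}) = (if j < i then - 1 else 1) * wedge_sign j S"
  using wedge_sign_insert[of "S - {i}" i j] assms by (simp add: insert_absorb)

lemma wedge_sign_square [simp]: "wedge_sign j S * (wedge_sign j S * x) = x"
  by (simp add: wedge_sign_def mult.assoc[symmetric] minus_one_power_square)

lemma wedge_sign_square' [simp]: "wedge_sign j S * wedge_sign j S = 1"
  using wedge_sign_square[of j S 1] by simp

lemma psi_wedge: "psi j v S = (if j \<in> S then wedge_sign j S * v (S - {j}) else 0)"
  by (simp add: psi_def wedge_sign_def)

lemma psi_star_wedge: "psi_star j v S = (if j \<notin> S then wedge_sign j S * v (insert j S) else 0)"
  by (simp add: psi_star_def wedge_sign_def)

text \<open>On vectors vanishing at the ill-behaved sets the Clifford relations hold.\<close>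

definition fock_bounded :: "fock \<Rightarrow> bool" where
  "fock_bounded v \<longleftrightarrow> (\<forall>S. \<not> bounded_above S \<longrightarrow> v S = 0)"

lemma fock_bounded_psi: "fock_bounded v \<Longrightarrow> fock_bounded (psi i v)"
  by (simp add: fock_bounded_def psi_wedge)

lemma fock_bounded_psi_star: "fock_bounded v \<Longrightarrow> fock_bounded (psi_star i v)"
  by (simp add: fock_bounded_def psi_star_wedge)

lemma psi_psi_star_anticommute:
  assumes "fock_bounded v"
  shows "psi i (psi_star j v) S = (if i = j then v S else 0) - psi_star j (psi i v) S"
proof (cases "bounded_above S")
  case False
  then show ?thesis using assms by (simp add: psi_wedge psi_star_wedge fock_bounded_def)
next
  case True
  show ?thesis
  proof (cases "i = j")
    case True
    then show ?thesis using \<open>bounded_above S\<close>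
      by (simp add: psi_wedge psi_star_wedge wedge_sign_insert wedge_sign_remove insert_absorb)
  next
    case False
    then have "insert j (S - {i}) = insert j S - {i}" by auto
    then show ?thesis using \<open>bounded_above S\<close> False
      by (auto simp: psi_wedge psi_star_wedge wedge_sign_insert wedge_sign_remove)
  qed
qed

lemma psi_anticommute:
  assumes "fock_bounded v"
  shows "psi i (psi j v) S = - psi j (psi i v) S"
proof (cases "bounded_above S")
  case False
  then show ?thesis using assms by (simp add: psi_wedge fock_bounded_def)
next
  case True
  have "S - {i} - {j} = S - {j} - {i}" by auto
  then show ?thesis using True
    by (cases i j rule: linorder_cases) (auto simp: psi_wedge wedge_sign_remove)
qed

lemma psi_star_anticommute:
  assumes "fock_bounded v"
  shows "psi_star i (psi_star j v) S = - psi_star j (psi_star i v) S"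
proof (cases "bounded_above S")
  case False
  then show ?thesis using assms by (simp add: psi_star_wedge fock_bounded_def)
next
  case True
  have "insert i (insert j S) = insert j (insert i S)" by auto
  then show ?thesis using True
    by (cases i j rule: linorder_cases) (auto simp: psi_star_wedge wedge_sign_insert)
qed

lemma psi_sum: "psi i (\<lambda>S. \<Sum>x\<in>X. c x * u x S) S = (\<Sum>x\<in>X. c x * psi i (u x) S)"
  by (simp add: psi_wedge sum_distrib_left mult_ac)

lemma psi_star_sum: "psi_star i (\<lambda>S. \<Sum>x\<in>X. c x * u x S) S = (\<Sum>x\<in>X. c x * psi_star i (u x) S)"
  by (simp add: psi_star_wedge sum_distrib_left mult_ac)

lemma psi_diff: "psi i (\<lambda>S. u S - v S) S = psi i u S - psi i v S"
  by (simp add: psi_wedge algebra_simps)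

lemma psi_uminus: "psi i (\<lambda>S. - u S) S = - psi i u S"
  by (simp add: psi_wedge)

lemma psi_if: "psi i (\<lambda>S. if P then u S else 0) S = (if P then psi i u S else 0)"
  by (simp add: psi_wedge)

definition bilinear :: "int \<Rightarrow> int \<Rightarrow> fock \<Rightarrow> fock" where
  "bilinear i j v = psi i (psi_star j v)"

text \<open>Moving psi_i psi_star_j to the left takes four anticommutations; the two that exchange a
  psi with a psi_star leave the delta terms. No constant appears until normal ordering is
  restored.\<close>

lemma bilinear_commute:
  assumes v: "fock_bounded v"
  shows "bilinear a b (bilinear i j v) S = bilinear i j (bilinear a b v) S
    + (if b = i then bilinear a j v S else 0) - (if a = j then bilinear i b v S else 0)"
proof -
  note fb = fock_bounded_psi fock_bounded_psi_star
  have "psi_star b (psi i w) = (\<lambda>S. (if b = i then w S else 0) - psi i (psi_star b w) S)"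
    if "fock_bounded w" for w b i
    using psi_psi_star_anticommute[OF that, of i b] by (auto simp: fun_eq_iff)
  note ac = this
  have "bilinear a b (bilinear i j v) S = (if b = i then bilinear a j v S else 0) - psi a (psi i (psi_star b (psi_star j v))) S"
    unfolding bilinear_def by (subst ac) (simp_all add: fb v psi_diff psi_if)
  also have "psi a (psi i (psi_star b (psi_star j v))) S = - psi i (psi a (psi_star b (psi_star j v))) S"
    by (rule psi_anticommute) (simp add: fb v)
  also have "psi_star b (psi_star j v) = (\<lambda>S. - psi_star j (psi_star b v) S)"
    by (rule ext, rule psi_star_anticommute) (rule v)
  also have "psi a (\<lambda>S. - psi_star j (psi_star b v) S) = (\<lambda>S. - psi a (psi_star j (psi_star b v)) S)"
    by (simp add: psi_uminus fun_eq_iff)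
  also have "psi i (\<lambda>S. - psi a (psi_star j (psi_star b v)) S) S = - psi i (psi a (psi_star j (psi_star b v))) S"
    by (rule psi_uminus)
  also have "psi a (psi_star j (psi_star b v)) = (\<lambda>S. (if a = j then psi_star b v S else 0) - psi_star j (psi a (psi_star b v)) S)"
    by (rule ext, rule psi_psi_star_anticommute) (simp add: fb v)
  also have "psi i (\<lambda>S. (if a = j then psi_star b v S else 0) - psi_star j (psi a (psi_star b v)) S) S
    = (if a = j then bilinear i b v S else 0) - bilinear i j (bilinear a b v) S"
    by (simp add: psi_diff psi_if bilinear_def)
  finally show ?thesis by simp
qed

lemma normal_ordered_bilinear:
  assumes "fock_bounded v"
  shows "normal_ordered i j v S = bilinear i j v S - (if i = j \<and> i \<le> 0 then v S else 0)"
  using psi_psi_star_anticommute[OF assms, of i j S] by (auto simp: normal_ordered_def bilinear_def)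

lemma normal_ordered_sum:
  "normal_ordered i j (\<lambda>S. \<Sum>x\<in>X. c x * u x S) S = (\<Sum>x\<in>X. c x * normal_ordered i j (u x) S)"
proof -
  have "psi_star j (\<lambda>S. \<Sum>x\<in>X. c x * u x S) = (\<lambda>S. \<Sum>x\<in>X. c x * psi_star j (u x) S)"
    "psi i (\<lambda>S. \<Sum>x\<in>X. c x * u x S) = (\<lambda>S. \<Sum>x\<in>X. c x * psi i (u x) S)"
    by (auto simp: psi_sum psi_star_sum fun_eq_iff)
  then show ?thesis by (simp add: normal_ordered_def psi_sum psi_star_sum sum_negf)
qed

lemma fock_bounded_normal_ordered: "fock_bounded v \<Longrightarrow> fock_bounded (normal_ordered i j v)"
  using fock_bounded_psi[OF fock_bounded_psi_star, of v i j]
    fock_bounded_psi_star[OF fock_bounded_psi, of v j i]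
  by (auto simp: normal_ordered_def fock_bounded_def)

text \<open>Normal ordering subtracts the constant [i = j <= 0]. Rewriting the two bilinears
  produced by the commutator in normal order adds such constants back, and their difference is the
  central term.\<close>

lemma normal_ordered_commute:
  assumes v: "fock_bounded v"
  shows "normal_ordered a b (normal_ordered i j v) S = normal_ordered i j (normal_ordered a b v) S
    + (if b = i then normal_ordered a j v S + (if a = j \<and> j \<le> 0 then v S else 0) else 0)
    - (if a = j then normal_ordered i b v S + (if i = b \<and> i \<le> 0 then v S else 0) else 0)"
proof -
  have sub: "bilinear i j (\<lambda>S. u S - (if P then w S else 0)) S = bilinear i j u S - (if P then bilinear i j w S else 0)"
    for i j u w P S
    by (simp add: bilinear_def psi_wedge psi_star_wedge algebra_simps)
  have n: "normal_ordered i j v = (\<lambda>S. bilinear i j v S - (if i = j \<and> i \<le> 0 then v S else 0))" for i j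
    using normal_ordered_bilinear[OF v] by (simp add: fun_eq_iff)
  have nn: "normal_ordered a b (normal_ordered i j v) S
      = bilinear a b (bilinear i j v) S - (if i = j \<and> i \<le> 0 then bilinear a b v S else 0)
        - (if a = b \<and> a \<le> 0 then normal_ordered i j v S else 0)" for a b i j
    unfolding normal_ordered_bilinear[OF fock_bounded_normal_ordered[OF v]]
    by (subst n) (simp add: sub)
  show ?thesis
    unfolding nn bilinear_commute[OF v, of a b i j] normal_ordered_bilinear[OF v] by auto
qed

lemma normal_ordered_offdiag:
  assumes "i \<noteq> j" "fock_bounded v"
  shows "normal_ordered i j v S =
    (if i \<in> S \<and> j \<notin> S then wedge_sign i S * wedge_sign j (S - {i}) * v (insert j (S - {i})) else 0)"
  using assms by (auto simp: normal_ordered_bilinear bilinear_def psi_wedge psi_star_wedge)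

lemma normal_ordered_diag:
  assumes "fock_bounded v"
  shows "normal_ordered i i v S = (if 0 < i then (if i \<in> S then v S else 0) else (if i \<in> S then 0 else - v S))"
proof (cases "bounded_above S \<and> i \<in> S")
  case True
  then show ?thesis using assms
    by (simp add: normal_ordered_bilinear bilinear_def psi_wedge psi_star_wedge wedge_sign_remove insert_absorb)
next
  case False
  then show ?thesis using assms
    by (auto simp: normal_ordered_bilinear bilinear_def psi_wedge psi_star_wedge fock_bounded_def insert_absorb)
qed

section \<open>Boxes, and currents of upper triangular matrices\<close>

definition box :: "int \<Rightarrow> int set set" where
  "box L = {S. (\<forall>s. s < - L \<longrightarrow> s \<in> S) \<and> (\<forall>s\<in>S. s \<le> L)}"

text \<open>The support consists of sets agreeing with the vacuum outside the interval from -L to L.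
  Upper triangular currents preserve this condition, which makes all their index sums
  finite.\<close>

definition in_box :: "int \<Rightarrow> fock \<Rightarrow> bool" where
  "in_box L v \<longleftrightarrow> L \<ge> 0 \<and> (\<forall>S. S \<notin> box L \<longrightarrow> v S = 0)"

lemma in_box_mono:
  assumes "in_box L v" "L \<le> L'"
  shows "in_box L' v"
proof -
  have "S \<in> box L'" if "S \<in> box L" for S
    using that assms(2) by (force simp: box_def)
  with assms show ?thesis by (auto simp: in_box_def)
qed

lemma in_box_bounded: "in_box L v \<Longrightarrow> fock_bounded v"
proof -
  assume v: "in_box L v"
  have "bounded_above S" if "S \<in> box L" for S
  proof -
    have "{s \<in> S. j < s} \<subseteq> {j<..L}" for j using that by (auto simp: box_def)
    then show ?thesis unfolding bounded_above_def by (meson finite_greaterThanAtMost_int finite_subset)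
  qed
  with v show ?thesis by (auto simp: in_box_def fock_bounded_def)
qed

lemma in_box_sum: "L \<ge> 0 \<Longrightarrow> (\<And>x. x \<in> X \<Longrightarrow> in_box L (u x)) \<Longrightarrow> in_box L (\<lambda>S. \<Sum>x\<in>X. c x * u x S)"
  by (simp add: in_box_def)

text \<open>Off the diagonal, psi_i would fill a place i < -L already occupied, or psi_star_j would
  remove a bead at j > L; on the diagonal it is the normal ordering that gives 0. Together with i <=
  j these one-sided bounds confine both indices to the box.\<close>

lemma normal_ordered_outside_box:
  assumes v: "in_box L v" and "i < - L \<or> j > L"
  shows "normal_ordered i j v = (\<lambda>_. 0)"
proof
  fix S
  have L: "L \<ge> 0" using v by (simp add: in_box_def)
  show "normal_ordered i j v S = 0"
  proof (cases "i = j")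
    case True
    have "i \<in> S \<longleftrightarrow> i \<le> 0" if S: "S \<in> box L"
    proof (cases "i < - L")
      case True
      then show ?thesis using S L by (simp add: box_def)
    next
      case False
      then have "i > L" using assms(2) \<open>i = j\<close> by simp
      then show ?thesis using S L by (force simp: box_def)
    qed
    then show ?thesis using v in_box_bounded[OF v] True
      by (cases "S \<in> box L") (auto simp: normal_ordered_diag in_box_def)
  next
    case False
    have "insert j (S - {i}) \<notin> box L"
    proof
      assume S: "insert j (S - {i}) \<in> box L"
      show False
      proof (cases "i < - L")
        case True
        then have "i \<in> insert j (S - {i})" using S unfolding box_def by blast
        then show False using False by simp
      next
        case False
        then have "j > L" using assms(2) by simp
        moreover have "j \<le> L" using S unfolding box_def by blast
        ultimately show False by simp
      qed
    qed
    then show ?thesis using v in_box_bounded[OF v] False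
      by (simp add: normal_ordered_offdiag in_box_def)
  qed
qed

lemma in_box_normal_ordered:
  assumes v: "in_box L v" and ij: "i \<in> {- L..L}" "j \<in> {- L..L}"
  shows "in_box L (normal_ordered i j v)"
proof -
  have L: "L \<ge> 0" using v by (simp add: in_box_def)
  have "normal_ordered i j v S = 0" if S: "S \<notin> box L" for S
  proof (cases "i = j")
    case True
    then show ?thesis using v in_box_bounded[OF v] S by (simp add: normal_ordered_diag in_box_def)
  next
    case False
    have "insert j (S - {i}) \<notin> box L" if "i \<in> S" "j \<notin> S"
    proof
      assume *: "insert j (S - {i}) \<in> box L"
      have "s \<in> S" if "s < - L" for s
      proof -
        have "s \<in> insert j (S - {i})" using * that unfolding box_def by blast
        moreover have "s \<noteq> j" using that ij by simp
        ultimately show ?thesis by simp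
      qed
      moreover have "s \<le> L" if "s \<in> S" for s
      proof (cases "s = i")
        case False
        then have "s \<in> insert j (S - {i})" using that by simp
        then show ?thesis using * unfolding box_def by blast
      qed (use ij in simp)
      ultimately show False using S unfolding box_def by blast
    qed
    then show ?thesis using v in_box_bounded[OF v] False
      by (auto simp: normal_ordered_offdiag in_box_def)
  qed
  with L show ?thesis by (simp add: in_box_def)
qed

definition current :: "(int \<Rightarrow> int \<Rightarrow> complex) \<Rightarrow> fock \<Rightarrow> fock" where
  "current T v = (\<lambda>S. Sum_any (\<lambda>(i, j). T i j * normal_ordered i j v S))"

definition upper :: "(int \<Rightarrow> int \<Rightarrow> complex) \<Rightarrow> bool" where
  "upper T \<longleftrightarrow> (\<forall>i j. j < i \<longrightarrow> T i j = 0)"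

lemma upper_outside: "upper T \<Longrightarrow> T i j \<noteq> 0 \<Longrightarrow> i \<le> j"
  unfolding upper_def by (metis not_less)

lemma current_box:
  assumes "upper T" "in_box L v"
  shows "current T v S = (\<Sum>(i, j)\<in>{- L..L} \<times> {- L..L}. T i j * normal_ordered i j v S)"
  unfolding current_def
proof (rule Sum_any.expand_superset)
  show "{p. (case p of (i, j) \<Rightarrow> T i j * normal_ordered i j v S) \<noteq> 0} \<subseteq> {- L..L} \<times> {- L..L}"
  proof clarify
    fix i j assume *: "T i j * normal_ordered i j v S \<noteq> 0"
    then have "i \<le> j" using upper_outside[OF assms(1)] by auto
    moreover have "- L \<le> i" "j \<le> L"
      using * normal_ordered_outside_box[OF assms(2), of i j] by (auto simp: not_less[symmetric])
    ultimately show "i \<in> {- L..L} \<and> j \<in> {- L..L}" by auto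
  qed
qed simp

lemma normal_ordered_zero: "normal_ordered i j (\<lambda>_. 0) = (\<lambda>_. 0)"
  by (auto simp: normal_ordered_def psi_def psi_star_def fun_eq_iff)

lemma current_zero: "current T (\<lambda>_. 0) = (\<lambda>_. 0)"
  by (simp add: current_def normal_ordered_zero case_prod_unfold)

lemma in_box_current:
  assumes "upper T" "in_box L v"
  shows "in_box L (current T v)"
proof -
  have "current T v = (\<lambda>S. \<Sum>p\<in>{- L..L} \<times> {- L..L}. T (fst p) (snd p) * normal_ordered (fst p) (snd p) v S)"
    using current_box[OF assms] by (simp add: fun_eq_iff case_prod_unfold)
  moreover have "in_box L \<dots>"
    using assms(2) by (intro in_box_sum in_box_normal_ordered) (auto simp: in_box_def)
  ultimately show ?thesis by simp
qed

lemma current_sum: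
  assumes T: "upper T" and "L \<ge> 0" and u: "\<And>x. x \<in> X \<Longrightarrow> in_box L (u x)"
  shows "current T (\<lambda>S. \<Sum>x\<in>X. c x * u x S) S = (\<Sum>x\<in>X. c x * current T (u x) S)"
proof -
  let ?B = "{- L..L} \<times> {- L..L}"
  have "current T (\<lambda>S. \<Sum>x\<in>X. c x * u x S) S
      = (\<Sum>(i, j)\<in>?B. \<Sum>x\<in>X. c x * (T i j * normal_ordered i j (u x) S))"
    using assms by (subst current_box[OF T in_box_sum])
      (auto simp: normal_ordered_sum sum_distrib_left mult_ac intro!: sum.cong)
  also have "\<dots> = (\<Sum>x\<in>X. c x * (\<Sum>(i, j)\<in>?B. T i j * normal_ordered i j (u x) S))"
    by (simp add: case_prod_unfold sum_distrib_left sum.swap[of _ X])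
  also have "\<dots> = (\<Sum>x\<in>X. c x * current T (u x) S)"
    by (rule sum.cong) (simp_all add: current_box[OF T u])
  finally show ?thesis .
qed

lemma current_scale:
  assumes "upper T" "in_box L u"
  shows "current T (\<lambda>S. c * u S) S = c * current T u S"
  using current_sum[of T L "{()}" "\<lambda>_. u" "\<lambda>_. c"] assms by (simp add: in_box_def)

text \<open>The two constants of \<open>normal_ordered_commute\<close> contribute
  \<open>T j i\<close> once under j <= 0 and once, with a minus sign, under i <= 0. As
  \<open>T j i\<close> forces j <= i, they differ exactly when j <= 0 < i.\<close>

lemma current_normal_ordered:
  assumes T: "upper T" and v: "in_box L v" and ij: "i \<in> {- L..L}" "j \<in> {- L..L}"
  shows "current T (normal_ordered i j v) S = normal_ordered i j (current T v) S
    + (\<Sum>s\<in>{- L..L}. T s i * normal_ordered s j v S) - (\<Sum>s\<in>{- L..L}. T j s * normal_ordered i s v S)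
    + (if j \<le> 0 \<and> 0 < i then T j i else 0) * v S"
proof -
  let ?I = "{- L..L}"
  note b = in_box_bounded[OF v]
  have "current T (normal_ordered i j v) S = (\<Sum>(p, q)\<in>?I \<times> ?I. T p q * normal_ordered p q (normal_ordered i j v) S)"
    by (rule current_box[OF T in_box_normal_ordered[OF v ij]])
  also have "\<dots> = (\<Sum>p\<in>?I. \<Sum>q\<in>?I. T p q * normal_ordered i j (normal_ordered p q v) S
      + (if q = i then T p i * normal_ordered p j v S + (if p = j then (if j \<le> 0 then T j i * v S else 0) else 0) else 0)
      - (if p = j then T j q * normal_ordered i q v S + (if q = i then (if i \<le> 0 then T j i * v S else 0) else 0) else 0))"
    unfolding sum.cartesian_product
    by (rule sum.cong) (auto simp: normal_ordered_commute[OF b, of _ _ i j] algebra_simps)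
  also have "\<dots> = (\<Sum>p\<in>?I. \<Sum>q\<in>?I. T p q * normal_ordered i j (normal_ordered p q v) S)
      + ((\<Sum>p\<in>?I. T p i * normal_ordered p j v S) + (if j \<le> 0 then T j i * v S else 0))
      - ((\<Sum>q\<in>?I. T j q * normal_ordered i q v S) + (if i \<le> 0 then T j i * v S else 0))"
  proof -
    have "(\<Sum>p\<in>?I. \<Sum>q\<in>?I. if q = i then f p else 0) = (\<Sum>p\<in>?I. f p)" for f :: "int \<Rightarrow> complex"
      using ij by simp
    moreover have "(\<Sum>p\<in>?I. \<Sum>q\<in>?I. if p = j then f q else 0) = (\<Sum>q\<in>?I. f q)" for f :: "int \<Rightarrow> complex"
      by (subst sum.swap) (use ij in simp)
    ultimately show ?thesis
      using ij by (simp add: sum.distrib sum_subtractf)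
  qed
  also have "(\<Sum>p\<in>?I. \<Sum>q\<in>?I. T p q * normal_ordered i j (normal_ordered p q v) S) = normal_ordered i j (current T v) S"
  proof -
    have "current T v = (\<lambda>S. \<Sum>p\<in>?I \<times> ?I. T (fst p) (snd p) * normal_ordered (fst p) (snd p) v S)"
      using current_box[OF T v] by (simp add: fun_eq_iff case_prod_unfold)
    then show ?thesis
      by (simp add: normal_ordered_sum sum.cartesian_product case_prod_unfold)
  qed
  finally have "current T (normal_ordered i j v) S = normal_ordered i j (current T v) S
    + (\<Sum>s\<in>?I. T s i * normal_ordered s j v S) - (\<Sum>s\<in>?I. T j s * normal_ordered i s v S)
    + ((if j \<le> 0 then T j i * v S else 0) - (if i \<le> 0 then T j i * v S else 0))"
    by simp
  moreover have "(if j \<le> 0 then T j i * v S else 0) - (if i \<le> 0 then T j i * v S else 0)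
      = (if j \<le> 0 \<and> 0 < i then T j i else 0) * v S"
    using T by (cases "T j i = 0") (auto dest: upper_outside)
  ultimately show ?thesis by simp
qed

text \<open>The commutator is the current of TT' - T'T plus a central term. The latter multiplies
  \<open>T' i j\<close>, which needs i <= j, by an entry present only for j <= 0 < i, so it is
  0.\<close>

lemma current_commute:
  assumes T: "upper T" and T': "upper T'" and v: "in_box L v"
    and TT': "\<And>i j. (\<Sum>m\<in>{i..j}. T i m * T' m j) = (\<Sum>m\<in>{i..j}. T' i m * T m j)"
  shows "current T (current T' v) = current T' (current T v)"
proof
  fix S
  let ?I = "{- L..L}"
  let ?N = "\<lambda>i j. normal_ordered i j v S"
  have prod: "(\<Sum>m\<in>?I. X i m * Y m j) = (\<Sum>m\<in>{i..j}. X i m * Y m j)"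
    if "upper X" "upper Y" "i \<in> ?I" "j \<in> ?I" for X Y i j
  proof (rule sum.mono_neutral_right)
    show "\<forall>m\<in>?I - {i..j}. X i m * Y m j = 0"
    proof
      fix m assume "m \<in> ?I - {i..j}"
      then have "m < i \<or> j < m" by auto
      then show "X i m * Y m j = 0" using that(1,2) by (auto simp: upper_def)
    qed
  qed (use that in auto)
  have "current T' v = (\<lambda>S. \<Sum>p\<in>?I \<times> ?I. T' (fst p) (snd p) * normal_ordered (fst p) (snd p) v S)"
    using current_box[OF T' v] by (simp add: fun_eq_iff case_prod_unfold)
  then have "current T (current T' v) S = (\<Sum>p\<in>?I \<times> ?I. T' (fst p) (snd p) * current T (normal_ordered (fst p) (snd p) v) S)"
    using in_box_normal_ordered[OF v] v
    by (simp only:) (rule current_sum[OF T, of L], auto simp: in_box_def)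
  also have "\<dots> = (\<Sum>i\<in>?I. \<Sum>j\<in>?I. T' i j * current T (normal_ordered i j v) S)"
    by (simp add: sum.cartesian_product case_prod_unfold)
  also have "\<dots> = (\<Sum>i\<in>?I. \<Sum>j\<in>?I. T' i j * normal_ordered i j (current T v) S
      + T' i j * (\<Sum>s\<in>?I. T s i * ?N s j) - T' i j * (\<Sum>s\<in>?I. T j s * ?N i s))"
  proof (intro sum.cong refl)
    fix i j assume "i \<in> ?I" "j \<in> ?I"
    note c = current_normal_ordered[OF T v this, of S]
    have z: "T' i j * ((if j \<le> 0 \<and> 0 < i then T j i else 0) * v S) = 0"
      using upper_outside[OF T', of i j] by auto
    show "T' i j * current T (normal_ordered i j v) S = T' i j * normal_ordered i j (current T v) S
      + T' i j * (\<Sum>s\<in>?I. T s i * ?N s j) - T' i j * (\<Sum>s\<in>?I. T j s * ?N i s)"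
      unfolding c distrib_left right_diff_distrib z by simp
  qed
  also have "\<dots> = (\<Sum>i\<in>?I. \<Sum>j\<in>?I. T' i j * normal_ordered i j (current T v) S)
      + (\<Sum>i\<in>?I. \<Sum>j\<in>?I. \<Sum>s\<in>?I. T s i * T' i j * ?N s j)
      - (\<Sum>i\<in>?I. \<Sum>j\<in>?I. \<Sum>s\<in>?I. T' i j * T j s * ?N i s)"
    by (simp add: sum.distrib sum_subtractf sum_distrib_left mult.assoc mult.left_commute[of "T' _ _" "T _ _"])
  also have "(\<Sum>i\<in>?I. \<Sum>j\<in>?I. \<Sum>s\<in>?I. T s i * T' i j * ?N s j)
      = (\<Sum>s\<in>?I. \<Sum>j\<in>?I. (\<Sum>i\<in>?I. T s i * T' i j) * ?N s j)"
  proof -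
    have swap: "(\<Sum>i\<in>?I. \<Sum>j\<in>?I. \<Sum>s\<in>?I. f i j s) = (\<Sum>s\<in>?I. \<Sum>j\<in>?I. \<Sum>i\<in>?I. f i j s)"
      for f :: "int \<Rightarrow> int \<Rightarrow> int \<Rightarrow> complex"
    proof -
      have "(\<Sum>i\<in>?I. \<Sum>j\<in>?I. \<Sum>s\<in>?I. f i j s) = (\<Sum>i\<in>?I. \<Sum>s\<in>?I. \<Sum>j\<in>?I. f i j s)"
        by (rule sum.cong[OF refl]) (rule sum.swap)
      also have "\<dots> = (\<Sum>s\<in>?I. \<Sum>i\<in>?I. \<Sum>j\<in>?I. f i j s)"
        by (rule sum.swap)
      also have "\<dots> = (\<Sum>s\<in>?I. \<Sum>j\<in>?I. \<Sum>i\<in>?I. f i j s)"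
        by (rule sum.cong[OF refl]) (rule sum.swap)
      finally show ?thesis .
    qed
    show ?thesis by (subst swap) (simp only: sum_distrib_right)
  qed
  also have "\<dots> = (\<Sum>s\<in>?I. \<Sum>j\<in>?I. (\<Sum>i\<in>?I. T' s i * T i j) * ?N s j)"
    by (intro sum.cong refl) (simp add: prod[OF T T'] prod[OF T' T] TT')
  also have "\<dots> = (\<Sum>i\<in>?I. \<Sum>j\<in>?I. \<Sum>s\<in>?I. T' i j * T j s * ?N i s)"
  proof (rule sum.cong[OF refl])
    fix s
    have "(\<Sum>j\<in>?I. (\<Sum>i\<in>?I. T' s i * T i j) * ?N s j) = (\<Sum>j\<in>?I. \<Sum>i\<in>?I. T' s i * T i j * ?N s j)"
      by (simp only: sum_distrib_right)
    also have "\<dots> = (\<Sum>i\<in>?I. \<Sum>j\<in>?I. T' s i * T i j * ?N s j)"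
      by (rule sum.swap)
    finally show "(\<Sum>j\<in>?I. (\<Sum>i\<in>?I. T' s i * T i j) * ?N s j) = (\<Sum>i\<in>?I. \<Sum>j\<in>?I. T' s i * T i j * ?N s j)" .
  qed
  also have "(\<Sum>i\<in>?I. \<Sum>j\<in>?I. T' i j * normal_ordered i j (current T v) S) = current T' (current T v) S"
    using current_box[OF T' in_box_current[OF T v], of S] by (simp add: sum.cartesian_product)
  finally show "current T (current T' v) S = current T' (current T v) S" by simp
qed

lemma in_box_const: "in_box L v \<Longrightarrow> in_box L (const_series v M)"
  by (simp add: const_series_def in_box_def)

lemma upper_tri: "upper (tri a b g h l)"
  by (simp add: upper_def)

lemma J_current: "k > 0 \<Longrightarrow> J \<alpha> \<beta> (int k) = current (tri \<alpha> \<beta> (\<lambda>_. 1) (defect \<alpha> \<beta>) k)"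
  by (simp add: J_def current_def A_pos fun_eq_iff)

text \<open>Both sides equal \<open>up (k + l)\<close>, the corresponding power of a single
  matrix.\<close>

lemma (in weights) up_commute: "(\<Sum>m\<in>{i..j}. up k i m * up l m j) = (\<Sum>m\<in>{i..j}. up l i m * up k m j)"
proof -
  have *: "(\<Sum>m\<in>{i..j}. up k i m * up l m j) = up (k + l) i j" for k l i j
  proof -
    have "row_act (up l) (up k i) = up (k + l) i" for l
    proof (induction l)
      case (Suc l)
      have v: "vanishes_below i (up k i)" by (simp add: vanishes_below_def)
      have v': "vanishes_below i (\<lambda>s. if s = i then 1 else 0)" by (simp add: vanishes_below_def)
      show ?case
        using row_act_Suc[OF v, of l] Suc row_act_Suc[OF v', of "k + l"] unfolding row_act_unit by simp
    qed (simp add: row_act_0)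
    moreover have "row_act (up l) (up k i) j = (\<Sum>m\<in>{i..j}. up k i m * up l m j)"
      by (rule row_act_up) (simp add: vanishes_below_def)
    ultimately show ?thesis by simp
  qed
  show ?thesis unfolding * by (simp only: add.commute)
qed

abbreviation Jk :: "(int \<Rightarrow> complex) \<Rightarrow> (int \<Rightarrow> complex) \<Rightarrow> nat \<Rightarrow> fock \<Rightarrow> fock" where
  "Jk \<alpha> \<beta> k \<equiv> current (tri \<alpha> \<beta> (\<lambda>_. 1) (defect \<alpha> \<beta>) k)"

lemma Jk_commute:
  assumes "in_box L v"
  shows "Jk \<alpha> \<beta> k (Jk \<alpha> \<beta> l v) = Jk \<alpha> \<beta> l (Jk \<alpha> \<beta> k v)"
proof -
  interpret weights \<alpha> \<beta> "\<lambda>_. 1" "defect \<alpha> \<beta>" by unfold_locales simp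
  show ?thesis by (rule current_commute[OF upper_tri upper_tri assms]) (rule up_commute)
qed

section \<open>Powers of \<open>H_plus\<close> and coefficients of the exponential\<close>

definition H_power :: "(int \<Rightarrow> complex) \<Rightarrow> (int \<Rightarrow> complex) \<Rightarrow> nat \<Rightarrow> nat multiset \<Rightarrow> fock \<Rightarrow> fock" where
  "H_power \<alpha> \<beta> n M v = (H_plus \<alpha> \<beta> ^^ n) (const_series v) M"

definition pos_parts :: "nat multiset \<Rightarrow> nat set" where
  "pos_parts M = {k. k \<in># M \<and> k \<ge> 1}"

lemma finite_pos_parts [simp]: "finite (pos_parts M)"
  by (rule finite_subset[of _ "set_mset M"]) (auto simp: pos_parts_def)

lemma H_power_0: "H_power \<alpha> \<beta> 0 M v = const_series v M"
  by (simp add: H_power_def)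

lemma H_power_Suc:
  "H_power \<alpha> \<beta> (Suc n) M v = (\<lambda>S. \<Sum>k\<in>pos_parts M. inverse (of_nat k) * Jk \<alpha> \<beta> k (H_power \<alpha> \<beta> n (M - {#k#}) v) S)"
proof
  fix S
  have "H_power \<alpha> \<beta> (Suc n) M v S
      = (\<Sum>k\<in>pos_parts M. J \<alpha> \<beta> (int k) (H_power \<alpha> \<beta> n (M - {#k#}) v) S / of_nat k)"
    by (simp add: H_power_def H_plus_def pos_parts_def)
  also have "\<dots> = (\<Sum>k\<in>pos_parts M. inverse (of_nat k) * Jk \<alpha> \<beta> k (H_power \<alpha> \<beta> n (M - {#k#}) v) S)"
    by (rule sum.cong) (auto simp: J_current pos_parts_def divide_inverse)
  finally show "H_power \<alpha> \<beta> (Suc n) M v S = (\<Sum>k\<in>pos_parts M. inverse (of_nat k) * Jk \<alpha> \<beta> k (H_power \<alpha> \<beta> n (M - {#k#}) v) S)" .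
qed

lemma in_box_H_power: "in_box L v \<Longrightarrow> in_box L (H_power \<alpha> \<beta> n M v)"
proof (induction n arbitrary: M)
  case 0
  then show ?case by (simp add: H_power_0 in_box_const)
next
  case (Suc n)
  then show ?case unfolding H_power_Suc
    by (intro in_box_sum in_box_current upper_tri) (auto simp: in_box_def)
qed

lemma H_power_degree: "n \<noteq> size M \<or> 0 \<in># M \<Longrightarrow> H_power \<alpha> \<beta> n M v = (\<lambda>_. 0)"
proof (induction n arbitrary: M)
  case 0
  then have "M \<noteq> {#}" by auto
  then show ?case by (simp add: H_power_0 const_series_def)
next
  case (Suc n)
  have "H_power \<alpha> \<beta> n (M - {#k#}) v = (\<lambda>_. 0)" if "k \<in> pos_parts M" for k
  proof (rule Suc.IH)
    have k: "k \<in># M" "k \<ge> 1" using that by (auto simp: pos_parts_def)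
    then obtain N where N: "M = add_mset k N" by (metis insert_DiffM)
    then show "n \<noteq> size (M - {#k#}) \<or> 0 \<in># M - {#k#}" using Suc.prems k by auto
  qed
  then show ?case by (simp add: H_power_Suc current_zero)
qed

lemma H_power_Jk:
  assumes v: "in_box L v"
  shows "H_power \<alpha> \<beta> n M (Jk \<alpha> \<beta> l v) = Jk \<alpha> \<beta> l (H_power \<alpha> \<beta> n M v)"
proof (induction n arbitrary: M)
  case 0
  then show ?case by (simp add: H_power_0 const_series_def current_zero)
next
  case (Suc n)
  show ?case
  proof
    fix S
    have L: "L \<ge> 0" using v by (simp add: in_box_def)
    have "Jk \<alpha> \<beta> l (H_power \<alpha> \<beta> (Suc n) M v) S
      = (\<Sum>k\<in>pos_parts M. inverse (of_nat k) * Jk \<alpha> \<beta> l (Jk \<alpha> \<beta> k (H_power \<alpha> \<beta> n (M - {#k#}) v)) S)"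
      unfolding H_power_Suc
      by (rule current_sum[OF upper_tri L]) (intro in_box_current upper_tri in_box_H_power v)
    also have "\<dots> = H_power \<alpha> \<beta> (Suc n) M (Jk \<alpha> \<beta> l v) S"
      unfolding H_power_Suc Suc.IH
      by (intro sum.cong refl) (simp only: Jk_commute[OF in_box_H_power[OF v], where k = l])
    finally show "H_power \<alpha> \<beta> (Suc n) M (Jk \<alpha> \<beta> l v) S = Jk \<alpha> \<beta> l (H_power \<alpha> \<beta> (Suc n) M v) S" by (rule sym)
  qed
qed

text \<open>The coefficient form of l d/dp_l H^(n+1) = (n+1) H^n J_l, which relies on J_l commuting
  with H. The factor \<open>Suc (count M l)\<close> is the exponent of p_l before
  differentiation.\<close>

lemma H_power_derivative:
  assumes v: "in_box L v" and l: "l \<ge> 1"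
  shows "of_nat l * of_nat (Suc (count M l)) * H_power \<alpha> \<beta> (Suc n) (add_mset l M) v S
    = of_nat (Suc n) * H_power \<alpha> \<beta> n M (Jk \<alpha> \<beta> l v) S"
proof (induction n arbitrary: M S)
  case 0
  show ?case
  proof (cases "M = {#}")
    case True
    then have "pos_parts (add_mset l M) = {l}" using l by (auto simp: pos_parts_def)
    then show ?thesis using True l by (simp add: H_power_Suc H_power_0 const_series_def)
  next
    case False
    then have "H_power \<alpha> \<beta> 0 M (Jk \<alpha> \<beta> l v) = (\<lambda>_. 0)" "H_power \<alpha> \<beta> (Suc 0) (add_mset l M) v = (\<lambda>_. 0)"
      by (intro H_power_degree; simp add: nonempty_has_size)+
    then show ?thesis by simp
  qed
next
  case (Suc n)
  define c where "c = count M l"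
  define H where "H = (\<lambda>n M v. H_power \<alpha> \<beta> n M v)"
  let ?J = "Jk \<alpha> \<beta>"
  have l0: "of_nat l \<noteq> (0 :: complex)" using l by simp
  have other: "of_nat l * of_nat (Suc c) * ?J k (H (Suc n) (add_mset l M - {#k#}) v) S
      = of_nat (Suc n) * ?J k (H n (M - {#k#}) (?J l v)) S" if k: "k \<in># M" "k \<noteq> l" for k
  proof -
    have "add_mset l M - {#k#} = add_mset l (M - {#k#})" "count (M - {#k#}) l = c"
      using k by (auto simp: c_def)
    then have IH: "H n (M - {#k#}) (?J l v) = (\<lambda>S. (of_nat l * of_nat (Suc c) / of_nat (Suc n)) * H (Suc n) (add_mset l M - {#k#}) v S)"
      using Suc.IH[of "M - {#k#}"] by (auto simp: fun_eq_iff H_def field_simps simp del: of_nat_Suc)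
    have "?J k (H n (M - {#k#}) (?J l v)) S
        = (of_nat l * of_nat (Suc c) / of_nat (Suc n)) * ?J k (H (Suc n) (add_mset l M - {#k#}) v) S"
      by (subst IH) (unfold H_def, rule current_scale[OF upper_tri in_box_H_power[OF v]])
    then show ?thesis by (simp add: field_simps del: of_nat_Suc)
  qed
  have same: "of_nat c * ?J l (H (Suc n) M v) S
    = (if l \<in># M then of_nat (Suc n) * (inverse (of_nat l) * ?J l (H n (M - {#l#}) (?J l v)) S) else 0)"
  proof (cases "l \<in># M")
    case True
    then obtain M' where M': "M = add_mset l M'" by (metis insert_DiffM)
    have IH: "H n M' (?J l v) = (\<lambda>S. (of_nat l * of_nat c / of_nat (Suc n)) * H (Suc n) M v S)"
      using Suc.IH[of M'] M' by (auto simp: fun_eq_iff H_def c_def field_simps simp del: of_nat_Suc)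
    have "?J l (H n M' (?J l v)) S = (of_nat l * of_nat c / of_nat (Suc n)) * ?J l (H (Suc n) M v) S"
      by (subst IH) (unfold H_def, rule current_scale[OF upper_tri in_box_H_power[OF v]])
    then show ?thesis using l0 M' by (simp add: field_simps del: of_nat_Suc)
  next
    case False
    then have "c = 0" by (simp add: c_def not_in_iff)
    then show ?thesis using False by simp
  qed
  define R where "R = pos_parts M - {l}"
  have R: "finite R" "l \<notin> R" "pos_parts (add_mset l M) = insert l R"
    "pos_parts M = (if l \<in># M then insert l R else R)"
    using l finite_pos_parts[of M] by (auto simp: R_def pos_parts_def)
  define f where "f k = inverse (of_nat k) * ?J k (H n (M - {#k#}) (?J l v)) S" for k
  have "of_nat l * of_nat (Suc c) * H (Suc (Suc n)) (add_mset l M) v S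
    = of_nat (Suc c) * ?J l (H (Suc n) M v) S
      + (\<Sum>k\<in>R. inverse (of_nat k) * (of_nat l * of_nat (Suc c) * ?J k (H (Suc n) (add_mset l M - {#k#}) v) S))"
    using R l0 by (simp add: H_def H_power_Suc[of _ _ "Suc n"] sum_distrib_left field_simps del: of_nat_Suc)
  also have "(\<Sum>k\<in>R. inverse (of_nat k) * (of_nat l * of_nat (Suc c) * ?J k (H (Suc n) (add_mset l M - {#k#}) v) S))
    = of_nat (Suc n) * (\<Sum>k\<in>R. f k)"
    unfolding sum_distrib_left
  proof (rule sum.cong[OF refl])
    fix k assume "k \<in> R"
    then have "k \<in># M" "k \<noteq> l" by (auto simp: R_def pos_parts_def)
    from other[OF this]
    show "inverse (of_nat k) * (of_nat l * of_nat (Suc c) * ?J k (H (Suc n) (add_mset l M - {#k#}) v) S)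
      = of_nat (Suc n) * f k"
      unfolding f_def by (simp only: mult.left_commute[of "inverse _"])
  qed
  \<comment> \<open>The factor is split as c + 1. The share c is the k = l summand of the recursion
    for H^(n+1) J_l; the share 1 is the additional J_l H^(n+1) that turns n + 1 into n + 2.\<close>
  also have "of_nat (Suc c) * ?J l (H (Suc n) M v) S
    = ?J l (H (Suc n) M v) S + (if l \<in># M then of_nat (Suc n) * f l else 0)"
    unfolding same[unfolded f_def[symmetric], symmetric] by (simp add: algebra_simps)
  also have "\<dots> + of_nat (Suc n) * (\<Sum>k\<in>R. f k)
    = ?J l (H (Suc n) M v) S + of_nat (Suc n) * (\<Sum>k\<in>pos_parts M. f k)"
    using R by (simp add: algebra_simps del: of_nat_Suc)
  also have "(\<Sum>k\<in>pos_parts M. f k) = H (Suc n) M (?J l v) S"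
    by (simp add: f_def H_def H_power_Suc)
  also have "?J l (H (Suc n) M v) S = H (Suc n) M (?J l v) S"
    unfolding H_def by (rule fun_cong[OF H_power_Jk[OF v, symmetric]])
  finally show ?case
    by (simp add: H_def c_def algebra_simps)
qed

definition coeff_functional :: "(int \<Rightarrow> complex) \<Rightarrow> (int \<Rightarrow> complex) \<Rightarrow> nat multiset \<Rightarrow> fock \<Rightarrow> complex" where
  "coeff_functional \<alpha> \<beta> M v = bra empty_partition (exp_H_plus \<alpha> \<beta> (const_series v) M)"

lemma coeff_functional_H_power:
  "coeff_functional \<alpha> \<beta> M v = H_power \<alpha> \<beta> (size M) M v {..0} / fact (size M)"
proof -
  have "Sum_any (\<lambda>n. H_power \<alpha> \<beta> n M v S / fact n) = (\<Sum>n\<in>{size M}. H_power \<alpha> \<beta> n M v S / fact n)" for S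
  proof (rule Sum_any.expand_superset)
    have "H_power \<alpha> \<beta> n M v S / fact n = 0" if "n \<noteq> size M" for n
      using H_power_degree[of n M \<alpha> \<beta> v] that by simp
    then show "{n. H_power \<alpha> \<beta> n M v S / fact n \<noteq> 0} \<subseteq> {size M}" by blast
  qed simp
  then show ?thesis
    by (simp add: coeff_functional_def bra_def maya_empty exp_H_plus_def H_power_def)
qed

lemma coeff_functional_empty: "coeff_functional \<alpha> \<beta> {#} v = v {..0}"
  by (simp add: coeff_functional_H_power H_power_0 const_series_def)

lemma coeff_functional_no_0: "0 \<in># M \<Longrightarrow> coeff_functional \<alpha> \<beta> M v = 0"
  by (simp add: coeff_functional_H_power H_power_degree)

text \<open>The factor n + 1 of \<open>H_power_derivative\<close> is absorbed by the factorials of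
  the exponential. From here on the exponential enters through this recursion: one indeterminate in
  exchange for one current.\<close>

lemma coeff_functional_add:
  assumes "in_box L v" "l \<ge> 1"
  shows "of_nat l * of_nat (Suc (count M l)) * coeff_functional \<alpha> \<beta> (add_mset l M) v
    = coeff_functional \<alpha> \<beta> M (Jk \<alpha> \<beta> l v)"
proof -
  define c where "c = (of_nat l * of_nat (Suc (count M l)) :: complex)"
  have "c * H_power \<alpha> \<beta> (Suc (size M)) (add_mset l M) v {..0}
      = of_nat (Suc (size M)) * H_power \<alpha> \<beta> (size M) M (Jk \<alpha> \<beta> l v) {..0}"
    unfolding c_def by (rule H_power_derivative[OF assms])
  then have "c * H_power \<alpha> \<beta> (Suc (size M)) (add_mset l M) v {..0} / fact (Suc (size M))
      = H_power \<alpha> \<beta> (size M) M (Jk \<alpha> \<beta> l v) {..0} / fact (size M)"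
    by (simp add: field_simps del: of_nat_Suc)
  then show ?thesis by (simp only: coeff_functional_H_power c_def[symmetric] size_add_mset times_divide_eq_right)
qed

lemma coeff_functional_sum:
  assumes "L \<ge> 0" "\<And>x. x \<in> X \<Longrightarrow> in_box L (u x)"
  shows "coeff_functional \<alpha> \<beta> M (\<lambda>S. \<Sum>x\<in>X. c x * u x S) = (\<Sum>x\<in>X. c x * coeff_functional \<alpha> \<beta> M (u x))"
  using assms(2)
proof (induction M arbitrary: u)
  case empty
  then show ?case by (simp add: coeff_functional_empty)
next
  case (add l M)
  show ?case
  proof (cases "l = 0")
    case True
    then show ?thesis by (simp add: coeff_functional_no_0)
  next
    case False
    define C where "C = (of_nat l * of_nat (Suc (count M l)) :: complex)"
    have C: "C \<noteq> 0" using False by (simp add: C_def del: of_nat_Suc)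
    have ib: "in_box L (\<lambda>S. \<Sum>x\<in>X. c x * u x S)"
      by (rule in_box_sum[OF assms(1) add.prems])
    have "Jk \<alpha> \<beta> l (\<lambda>S. \<Sum>x\<in>X. c x * u x S) = (\<lambda>S. \<Sum>x\<in>X. c x * Jk \<alpha> \<beta> l (u x) S)"
      by (rule ext) (rule current_sum[OF upper_tri assms(1) add.prems])
    then have "C * coeff_functional \<alpha> \<beta> (add_mset l M) (\<lambda>S. \<Sum>x\<in>X. c x * u x S)
       = coeff_functional \<alpha> \<beta> M (\<lambda>S. \<Sum>x\<in>X. c x * Jk \<alpha> \<beta> l (u x) S)"
      using coeff_functional_add[OF ib, where l = l and M = M and \<alpha> = \<alpha> and \<beta> = \<beta>] False by (simp add: C_def)
    also have "\<dots> = (\<Sum>x\<in>X. c x * coeff_functional \<alpha> \<beta> M (Jk \<alpha> \<beta> l (u x)))"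
      by (rule add.IH) (rule in_box_current[OF upper_tri add.prems])
    also have "\<dots> = (\<Sum>x\<in>X. c x * (C * coeff_functional \<alpha> \<beta> (add_mset l M) (u x)))"
      unfolding C_def using False by (intro sum.cong refl) (subst coeff_functional_add[OF add.prems], auto)
    also have "\<dots> = C * (\<Sum>x\<in>X. c x * coeff_functional \<alpha> \<beta> (add_mset l M) (u x))"
      by (simp add: sum_distrib_left mult_ac)
    finally show ?thesis using C by simp
  qed
qed

lemma coeff_functional_zero: "coeff_functional \<alpha> \<beta> M (\<lambda>_. 0) = 0"
  using coeff_functional_sum[of 0 "{}" "\<lambda>_ _. 0" \<alpha> \<beta> M "\<lambda>_. 0"] by simp

lemma coeff_functional_commutator:
  assumes "L \<ge> 0" "in_box L u" "in_box L v" "\<And>x. x \<in> X \<Longrightarrow> in_box L (p x)" "\<And>x. x \<in> X \<Longrightarrow> in_box L (q x)" "finite X"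
  shows "coeff_functional \<alpha> \<beta> M (\<lambda>S. u S + (\<Sum>x\<in>X. c x * p x S) - (\<Sum>x\<in>X. d x * q x S) + e * v S)
    = coeff_functional \<alpha> \<beta> M u + (\<Sum>x\<in>X. c x * coeff_functional \<alpha> \<beta> M (p x))
      - (\<Sum>x\<in>X. d x * coeff_functional \<alpha> \<beta> M (q x)) + e * coeff_functional \<alpha> \<beta> M v"
proof -
  let ?f = "coeff_functional \<alpha> \<beta> M"
  have s: "in_box L (\<lambda>S. \<Sum>x\<in>X. c x * p x S)" "in_box L (\<lambda>S. \<Sum>x\<in>X. d x * q x S)"
    using assms by (auto intro: in_box_sum)
  \<comment> \<open>Listing the four terms of the commutator turns the claim into an instance of
    linearity over a finite index set.\<close>
  define w :: "nat \<Rightarrow> fock" where "w n = [u, \<lambda>S. \<Sum>x\<in>X. c x * p x S, \<lambda>S. \<Sum>x\<in>X. d x * q x S, v] ! n" for n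
  define t :: "nat \<Rightarrow> complex" where "t n = [1, 1, - 1, e] ! n" for n
  have four: "(\<Sum>n<4. g n) = g 0 + g 1 + g 2 + g 3" for g :: "nat \<Rightarrow> complex"
    by (simp add: eval_nat_numeral)
  have "?f (\<lambda>S. \<Sum>n<4. t n * w n S) = (\<Sum>n<4. t n * ?f (w n))"
    using assms(2,3) s by (intro coeff_functional_sum[OF assms(1)]) (auto simp: w_def less_Suc_eq numeral_eq_Suc)
  then show ?thesis
    unfolding four using coeff_functional_sum[OF assms(1,4), where c = c and \<alpha> = \<alpha> and \<beta> = \<beta> and M = M]
      coeff_functional_sum[OF assms(1,5), where c = d and \<alpha> = \<alpha> and \<beta> = \<beta> and M = M]
    by (simp add: t_def w_def eval_nat_numeral)
qed

section \<open>The mode array of a vector and its trace\<close>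

definition mode_array :: "(int \<Rightarrow> complex) \<Rightarrow> (int \<Rightarrow> complex) \<Rightarrow> nat multiset \<Rightarrow> fock \<Rightarrow> int \<Rightarrow> int \<Rightarrow> complex" where
  "mode_array \<alpha> \<beta> M v i j = coeff_functional \<alpha> \<beta> M (normal_ordered i j v)"

lemma mode_array_outside: "in_box L v \<Longrightarrow> i < - L \<or> j > L \<Longrightarrow> mode_array \<alpha> \<beta> M v i j = 0"
  by (simp add: mode_array_def normal_ordered_outside_box coeff_functional_zero)

text \<open>One current J_l is moved through the bilinear, leaving J_l on v, a matrix commutator
  acting on the two indices, and the central term. The box is enlarged to K so that it contains i
  and j as well.\<close>

lemma (in two_sided) mode_array_step:
  assumes abgh: "a = \<alpha>" "b = \<beta>" "g = (\<lambda>_. 1)" "h = defect \<alpha> \<beta>" and v: "in_box L v" and l: "l \<ge> 1"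
  shows "of_nat l * of_nat (Suc (count M l)) * mode_array \<alpha> \<beta> (add_mset l M) v i j
    = mode_array \<alpha> \<beta> M (Jk \<alpha> \<beta> l v) i j + commutator (up l) (mode_array \<alpha> \<beta> M v) i j
      + cocycle l i j * coeff_functional \<alpha> \<beta> M v"
proof -
  let ?f = "coeff_functional \<alpha> \<beta>"
  define K where "K = max L (max \<bar>i\<bar> \<bar>j\<bar>)"
  let ?K = "{- K..K}"
  have vK: "in_box K v" using v by (rule in_box_mono) (simp add: K_def)
  have ij: "i \<in> ?K" "j \<in> ?K" by (auto simp: K_def)
  have up: "up l = tri \<alpha> \<beta> (\<lambda>_. 1) (defect \<alpha> \<beta>) l" by (simp add: abgh)
  have "of_nat l * of_nat (Suc (count M l)) * ?f (add_mset l M) (normal_ordered i j v)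
      = ?f M (Jk \<alpha> \<beta> l (normal_ordered i j v))"
    by (rule coeff_functional_add[OF in_box_normal_ordered[OF vK ij] l])
  also have "Jk \<alpha> \<beta> l (normal_ordered i j v) = (\<lambda>S. normal_ordered i j (Jk \<alpha> \<beta> l v) S
    + (\<Sum>s\<in>?K. up l s i * normal_ordered s j v S) - (\<Sum>s\<in>?K. up l j s * normal_ordered i s v S)
    + cocycle l i j * v S)"
    unfolding cocycle_def up by (rule ext) (rule current_normal_ordered[OF upper_tri vK ij])
  also have "?f M \<dots> = ?f M (normal_ordered i j (Jk \<alpha> \<beta> l v))
    + (\<Sum>s\<in>?K. up l s i * ?f M (normal_ordered s j v)) - (\<Sum>s\<in>?K. up l j s * ?f M (normal_ordered i s v))
    + cocycle l i j * ?f M v"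
    by (rule coeff_functional_commutator[of K])
       (use vK ij in_box_normal_ordered[OF vK] in_box_normal_ordered[OF in_box_current[OF upper_tri vK]]
         in \<open>auto simp: in_box_def\<close>)
  also have "(\<Sum>s\<in>?K. up l s i * ?f M (normal_ordered s j v)) = row_act (up l) (\<lambda>s. mode_array \<alpha> \<beta> M v s j) i"
  proof -
    have "row_act (up l) (\<lambda>s. mode_array \<alpha> \<beta> M v s j) i = (\<Sum>s\<in>{- K..i}. mode_array \<alpha> \<beta> M v s j * up l s i)"
      by (rule row_act_up) (use mode_array_outside[OF vK] in \<open>auto simp: vanishes_below_def\<close>)
    also have "\<dots> = (\<Sum>s\<in>?K. mode_array \<alpha> \<beta> M v s j * up l s i)"
      by (rule sum.mono_neutral_left) (use ij in auto)
    finally show ?thesis by (simp add: mode_array_def mult.commute)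
  qed
  also have "(\<Sum>s\<in>?K. up l j s * ?f M (normal_ordered i s v)) = col_act (up l) (mode_array \<alpha> \<beta> M v i) j"
  proof -
    have "col_act (up l) (mode_array \<alpha> \<beta> M v i) j = (\<Sum>s\<in>{j..K}. mode_array \<alpha> \<beta> M v i s * up l j s)"
      by (rule col_act_eq) (use mode_array_outside[OF vK] in auto)
    also have "\<dots> = (\<Sum>s\<in>?K. mode_array \<alpha> \<beta> M v i s * up l j s)"
      by (rule sum.mono_neutral_left) (use ij in auto)
    finally show ?thesis by (simp add: mode_array_def mult.commute)
  qed
  finally show ?thesis by (simp add: mode_array_def commutator_def)
qed

text \<open>The induction runs over all v at once, because the step involves J_l v. The commutator
  has trace 0 and the cocycle contributes l when the index is l, which reproduces [d/dp_l, p_l] = 1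
  on the side of \<open>p_mult\<close>. Membership in \<open>arrs\<close> is carried along since the
  traces need it.\<close>

theorem (in two_sided) mode_array_trace:
  assumes abgh: "a = \<alpha>" "b = \<beta>" "g = (\<lambda>_. 1)" "h = defect \<alpha> \<beta>" and "in_box L v"
  shows "mode_array \<alpha> \<beta> M v \<in> arrs \<and>
    (\<forall>k. trace (Suc k) (mode_array \<alpha> \<beta> M v) = p_mult (Suc k) (\<lambda>M. coeff_functional \<alpha> \<beta> M v) M)"
  using assms(5)
proof (induction M arbitrary: v)
  case empty
  have L: "L \<ge> 0" and b: "fock_bounded v" using empty in_box_bounded by (auto simp: in_box_def)
  have zero: "mode_array \<alpha> \<beta> {#} v i j = 0" if "\<not> (i \<le> 0 \<and> 0 < j)" for i j
    using that by (cases "i = j")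
      (auto simp: mode_array_def coeff_functional_empty normal_ordered_diag[OF b] normal_ordered_offdiag[OF _ b])
  have "mode_array \<alpha> \<beta> {#} v \<in> arrs"
  proof (rule finite_support_array)
    show "mode_array \<alpha> \<beta> {#} v i j = 0" if "(i, j) \<notin> {- L..0} \<times> {1..L}" for i j
    proof (cases "i \<le> 0 \<and> 0 < j")
      case True
      with that have "i < - L \<or> j > L" by auto
      then show ?thesis by (rule mode_array_outside[OF empty])
    qed (rule zero)
  qed simp
  moreover have "trace (Suc k) (mode_array \<alpha> \<beta> {#} v) = 0" for k
  proof -
    \<comment> \<open>For the empty monomial only entries with i <= 0 < j survive, exactly where the
      lower triangular matrix vanishes: the vacuum covector is annihilated by J_(-k).\<close>
    have "low (Suc k) i j * mode_array \<alpha> \<beta> {#} v i j = 0" for i j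
      by (cases "i \<le> 0 \<and> 0 < j") (auto simp: zero)
    then show ?thesis by (simp only: trace_def split_def infsum_0_simp)
  qed
  ultimately show ?case by (simp add: p_mult_def)
next
  case (add l M)
  let ?f = "coeff_functional \<alpha> \<beta>" and ?X = "mode_array \<alpha> \<beta>"
  show ?case
  proof (cases "l = 0")
    case True
    have z: "?f (add_mset 0 N) w = 0" for N w by (simp add: coeff_functional_no_0)
    then have "?X (add_mset l M) v = (\<lambda>_ _. 0)" using True by (simp add: mode_array_def fun_eq_iff)
    moreover have "p_mult (Suc k) (\<lambda>M. ?f M v) (add_mset l M) = 0" for k
      using True by (simp add: p_mult_def coeff_functional_no_0)
    ultimately show ?thesis by (simp add: arrays.zero trace_zero)
  next
    case False
    then have l: "l \<ge> 1" by simp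
    define C where "C = (of_nat l * of_nat (Suc (count M l)) :: complex)"
    have C: "C \<noteq> 0" using l by (simp add: C_def del: of_nat_Suc)
    let ?w = "Jk \<alpha> \<beta> l v"
    have w: "in_box L ?w" by (rule in_box_current[OF upper_tri add.prems])
    define R where "R = (\<lambda>i j. ?X M ?w i j + commutator (up l) (?X M v) i j + ?f M v * cocycle l i j)"
    have step: "C * ?X (add_mset l M) v i j = R i j" for i j
      unfolding C_def R_def mode_array_step[OF abgh add.prems l] by (simp add: mult.commute)
    have X: "?X (add_mset l M) v = (\<lambda>i j. inverse C * R i j)"
      using C by (simp add: step[symmetric] fun_eq_iff)
    note IHw = add.IH[OF w] and IHv = add.IH[OF add.prems]
    have 1: "?X M ?w \<in> arrs" using IHw by blast
    have 2: "commutator (up l) (?X M v) \<in> arrs" using IHv commutator_arrays by blast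
    have 3: "(\<lambda>i j. ?f M v * cocycle l i j) \<in> arrs" by (rule arrays_scale[OF cocycle_array(1)])
    have R: "R \<in> arrs" unfolding R_def by (rule arrays_add[OF 3 arrays_add[OF 2 1]])
    have "trace (Suc k) (?X (add_mset l M) v) = p_mult (Suc k) (\<lambda>M. ?f M v) (add_mset l M)" for k
    proof -
      have "trace (Suc k) R = p_mult (Suc k) (\<lambda>M. ?f M ?w) M + ?f M v * (if Suc k = l then of_nat l else 0)"
        unfolding R_def
        using trace_add[OF arrays_add[OF 2 1] 3, of "Suc k"] trace_add[OF 1 2, of "Suc k"] IHw
          commutator_arrays[OF conjunct1[OF IHv], of l k]
        by (simp add: trace_scale cocycle_array(2))
      also have "\<dots> = C * p_mult (Suc k) (\<lambda>M. ?f M v) (add_mset l M)"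
      \<comment> \<open>If the new indeterminate is p_k itself, C contains
        \<open>count M l + 1\<close>: the part \<open>count M l\<close> comes from J_l v at the
        monomial with one p_l removed, the remaining 1 from the central term.\<close>
      proof (cases "Suc k = l")
        case True
        show ?thesis
        proof (cases "l \<in># M")
          case lM: True
          then obtain N where N: "M = add_mset l N" by (metis insert_DiffM)
          have "?f N ?w = of_nat l * of_nat (Suc (count N l)) * ?f M v"
            unfolding N by (rule coeff_functional_add[OF add.prems l, symmetric])
          then show ?thesis using True N by (simp add: p_mult_def C_def algebra_simps)
        next
          case False
          then have "count M l = 0" by (simp add: not_in_iff)
          then show ?thesis using True False by (simp add: p_mult_def C_def)
        qed
      next
        case kl: False
        show ?thesis
        proof (cases "Suc k \<in># M")
          case True
          then obtain N where N: "M = add_mset (Suc k) N" by (metis insert_DiffM)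
          have "?f N ?w = of_nat l * of_nat (Suc (count N l)) * ?f (add_mset l N) v"
            by (rule coeff_functional_add[OF add.prems l, symmetric])
          moreover have "add_mset l (add_mset (Suc k) N) - {#Suc k#} = add_mset l N"
            using kl by simp
          ultimately show ?thesis using kl N by (simp add: p_mult_def C_def)
        next
          case False
          then show ?thesis using kl by (simp add: p_mult_def)
        qed
      qed
      finally show ?thesis unfolding X trace_scale using C by simp
    qed
    moreover have "?X (add_mset l M) v \<in> arrs" unfolding X by (rule arrays_scale[OF R])
    ultimately show ?thesis by blast
  qed
qed

section \<open>Ribbons as bead moves\<close>

text \<open>For the beads of a partition this is the row in which the diagonal of content c leaves
  the diagram, positions left of the first column counting as inside.\<close>

definition count_above :: "int set \<Rightarrow> int \<Rightarrow> nat" where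
  "count_above S c = card {s \<in> S. c < s}"

lemma count_above_step:
  assumes "bounded_above S"
  shows "count_above S (c - 1) = count_above S c + (if c \<in> S then 1 else 0)"
proof -
  have "{s \<in> S. c - 1 < s} = (if c \<in> S then insert c {s \<in> S. c < s} else {s \<in> S. c < s})"
  proof -
    have "c - 1 < s \<longleftrightarrow> s = c \<or> c < s" for s by linarith
    then show ?thesis by auto
  qed
  moreover have "finite {s \<in> S. c < s}" using assms unfolding bounded_above_def by blast
  ultimately show ?thesis unfolding count_above_def by (cases "c \<in> S") simp_all
qed

lemma count_above_antimono: "bounded_above S \<Longrightarrow> c \<le> d \<Longrightarrow> count_above S d \<le> count_above S c"
  unfolding count_above_def bounded_above_def by (rule card_mono) auto

lemma count_above_inject:
  assumes "bounded_above S" "bounded_above T" "\<And>c. count_above S c = count_above T c"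
  shows "S = T"
proof (rule set_eqI)
  fix s
  show "s \<in> S \<longleftrightarrow> s \<in> T"
    using count_above_step[OF assms(1), of s] count_above_step[OF assms(2), of s] assms(3)
    by (auto split: if_splits)
qed

text \<open>In terms of diagrams, each diagonal with content in [i, j) gains exactly one box and the
  others none.\<close>

lemma count_above_move:
  assumes "bounded_above S" "i < j" "i \<in> S" "j \<notin> S"
  shows "count_above (insert j (S - {i})) c = count_above S c + (if i \<le> c \<and> c < j then 1 else 0)"
proof -
  have fin: "finite {s \<in> S. c < s}" using assms(1) by (simp add: bounded_above_def)
  consider "c < i" | "i \<le> c" "c < j" | "j \<le> c" by linarith
  then show ?thesis
  proof cases
    case 1
    then have "{s \<in> insert j (S - {i}). c < s} = insert j ({s \<in> S. c < s} - {i})" using assms by auto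
    moreover have "card (insert j ({s \<in> S. c < s} - {i})) = Suc (card ({s \<in> S. c < s} - {i}))"
      by (rule card_insert_disjoint) (use fin assms in auto)
    moreover have "Suc (card ({s \<in> S. c < s} - {i})) = card {s \<in> S. c < s}"
      by (rule card_Suc_Diff1[OF fin]) (use assms 1 in simp)
    ultimately show ?thesis using 1 by (simp add: count_above_def)
  next
    case 2
    then have "{s \<in> insert j (S - {i}). c < s} = insert j {s \<in> S. c < s}" using assms by auto
    then show ?thesis using 2 fin assms by (simp add: count_above_def)
  next
    case 3
    then have "{s \<in> insert j (S - {i}). c < s} = {s \<in> S. c < s}" using assms by auto
    then show ?thesis using 3 by (simp add: count_above_def)
  qed
qed

lemma partition_antimono: "is_partition lam \<Longrightarrow> r \<le> s \<Longrightarrow> lam s \<le> lam r"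
  by (auto simp: is_partition_def antimono_def)

text \<open>Bead positions strictly decrease with the row, so the rows whose bead lies beyond c form
  an initial segment, whose length is the count.\<close>

lemma maya_beads:
  assumes "is_partition lam"
  shows "bounded_above (maya lam)" "r < count_above (maya lam) c \<longleftrightarrow> c < int (lam r) - int r"
proof -
  define b where "b r = int (lam r) - int r" for r
  have b: "b s < b r" if "r < s" for r s
    using partition_antimono[OF assms, of r s] that by (simp add: b_def)
  have inj: "inj b" by (rule inj_onI) (metis b less_irrefl linorder_neqE_nat)
  have E: "{s \<in> maya lam. c < s} = b ` {r. c < b r}" for c
    by (auto simp: maya_def b_def)
  have fin: "finite {r. c < b r}" for c
  proof (rule finite_subset)
    show "{r. c < b r} \<subseteq> {..nat (int (lam 0) - c)}"
    proof
      fix r assume "r \<in> {r. c < b r}"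
      then show "r \<in> {..nat (int (lam 0) - c)}"
        using partition_antimono[OF assms, of 0 r] by (simp add: b_def)
    qed
  qed simp
  show "bounded_above (maya lam)"
    unfolding bounded_above_def E using fin by blast
  have "card {s \<in> maya lam. c < s} = card {r. c < b r}"
    unfolding E using inj by (intro card_image) (rule inj_on_subset, auto)
  moreover obtain n where n: "c < b r \<longleftrightarrow> r < n" for r
  proof -
    obtain m where m: "\<not> c < b m" using ex_new_if_finite[OF infinite_UNIV_nat fin[of c]] by auto
    define n where "n = (LEAST r. \<not> c < b r)"
    have n: "\<not> c < b n" unfolding n_def using m by (rule LeastI)
    have "c < b r \<longleftrightarrow> r < n" for r
    proof
      assume "r < n"
      then show "c < b r" using not_less_Least[of r "\<lambda>r. \<not> c < b r"] by (simp add: n_def)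
    next
      assume "c < b r"
      then show "r < n" using n b[of n r] by (cases r n rule: linorder_cases) auto
    qed
    then show ?thesis by (rule that)
  qed
  moreover have "{r. c < b r} = {..<n}" using n by auto
  ultimately have "count_above (maya lam) c = n" by (simp add: count_above_def)
  then show "r < count_above (maya lam) c \<longleftrightarrow> c < int (lam r) - int r"
    using n[of r] by (simp add: b_def)
qed

lemma maya_inject:
  assumes "is_partition lam" "is_partition mu" "maya lam = maya mu"
  shows "lam = mu"
proof
  fix r
  have "c < int (lam r) - int r \<longleftrightarrow> c < int (mu r) - int r" for c
    using maya_beads(2)[OF assms(1), of r c] maya_beads(2)[OF assms(2), of r c] assms(3) by simp
  from this[of "int (lam r) - int r - 1"] this[of "int (mu r) - int r - 1"]
  show "lam r = mu r" by linarith
qed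

text \<open>Charge zero, expressed through counts far to the left. Together with boundedness above
  it characterises the bead sets of partitions, by \<open>partition_of_beads\<close>.\<close>

lemma maya_charge:
  assumes "is_partition lam"
  obtains N where "N \<ge> 0" "\<And>c. c \<le> - N \<Longrightarrow> int (count_above (maya lam) c) = - c"
proof -
  have "finite {i. lam i \<noteq> 0}" using assms by (simp add: is_partition_def)
  then obtain n where n: "\<And>r. lam r \<noteq> 0 \<Longrightarrow> r < n"
    unfolding finite_nat_set_iff_bounded by blast
  show ?thesis
  proof (rule that[of "int n"])
    fix c assume c: "c \<le> - int n"
    have "r < count_above (maya lam) c \<longleftrightarrow> r < nat (- c)" for r
      unfolding maya_beads(2)[OF assms] using n[of r] c by (cases "lam r = 0") auto
    from this[of "nat (- c)"] this[of "count_above (maya lam) c"]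
    show "int (count_above (maya lam) c) = - c" using c by simp
  qed simp
qed

lemma partition_of_beads:
  assumes S: "bounded_above S" and charge: "\<And>c. c \<le> - N \<Longrightarrow> int (count_above S c) = - c"
  obtains nu where "is_partition nu" "maya nu = S"
proof -
  \<comment> \<open>Raising c by one loses at most one bead, so the bound persists from the far
    left. It covers the positions left of the first column, where no row length is defined.\<close>
  have ge: "int (count_above S c) \<ge> - c" for c
  proof (cases "c \<le> - N")
    case True
    then show ?thesis using charge by simp
  next
    case False
    then have "- N \<le> c" by simp
    then show ?thesis
    proof (induction c rule: int_ge_induct)
      case base
      then show ?case using charge[of "- N"] by simp
    next
      case (step c)
      then show ?case using count_above_step[OF S, of "c + 1"] by (auto split: if_splits)
    qed
  qed
  have ex: "\<exists>n. count_above S (int n - int r) \<le> r" for r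
  proof -
    have "finite {s \<in> S. 0 < s}" using S by (simp add: bounded_above_def)
    then have "s \<in> S \<Longrightarrow> 0 < s \<Longrightarrow> s \<le> Max {s \<in> S. 0 < s}" for s
      by (rule Max_ge) simp
    then obtain U where U: "\<And>s. s \<in> S \<Longrightarrow> 0 < s \<Longrightarrow> s \<le> U" by blast
    define n where "n = nat (max U 0) + r"
    have "\<not> (s \<in> S \<and> int n - int r < s)" for s
      using U[of s] by (cases "0 < s") (auto simp: n_def)
    then have "{s \<in> S. int n - int r < s} = {}" by blast
    then have "count_above S (int n - int r) = 0" by (simp only: count_above_def card.empty)
    then show ?thesis by (intro exI[of _ n]) simp
  qed
  define nu where "nu r = (LEAST n. count_above S (int n - int r) \<le> r)" for r
  have nu: "r < count_above S c \<longleftrightarrow> c < int (nu r) - int r" for r c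
  proof
    assume *: "c < int (nu r) - int r"
    show "r < count_above S c"
    proof (cases "c < - int r")
      case True
      then show ?thesis using ge[of c] by linarith
    next
      case False
      define m where "m = nat (c + int r)"
      have "m < nu r" "int m - int r = c" using False * by (auto simp: m_def)
      then show ?thesis using not_less_Least[of m "\<lambda>n. count_above S (int n - int r) \<le> r"] by (simp add: nu_def)
    qed
  next
    assume *: "r < count_above S c"
    have "count_above S (int (nu r) - int r) \<le> r" unfolding nu_def using ex by (rule LeastI_ex)
    with * show "c < int (nu r) - int r" using count_above_antimono[OF S, of "int (nu r) - int r" c] by force
  qed
  have part: "is_partition nu"
    unfolding is_partition_def
  proof
    show "antimono nu"
    proof (rule decseq_SucI)
      fix r
      define c where "c = int (nu (Suc r)) - int (Suc r) - 1"
      have "Suc r < count_above S c" unfolding nu c_def by simp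
      then have "r < count_above S (c + 1)" using count_above_step[OF S, of "c + 1"] by (auto split: if_splits)
      then show "nu (Suc r) \<le> nu r" unfolding nu c_def by simp
    qed
    have "nu r = 0" if "int r \<ge> N" for r
      using charge[of "- int r"] nu[of r "- int r"] that by simp
    then have "r \<le> nat N" if "nu r \<noteq> 0" for r
      using that by (metis linear nat_le_iff)
    then have "{r. nu r \<noteq> 0} \<subseteq> {..nat N}" by auto
    then show "finite {r. nu r \<noteq> 0}" by (rule finite_subset) simp
  qed
  have "count_above (maya nu) c = count_above S c" for c
  proof -
    have "r < count_above (maya nu) c \<longleftrightarrow> r < count_above S c" for r
      unfolding maya_beads(2)[OF part] nu ..
    from this[of "count_above S c"] this[of "count_above (maya nu) c"] show ?thesis by simp
  qed
  then have "maya nu = S" by (rule count_above_inject[OF maya_beads(1)[OF part] S])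
  with part show ?thesis by (rule that)
qed

text \<open>The bead may move in either direction. Counts below both p and q are unchanged, so the
  charge stays zero; a move to the left is handled by reading \<open>count_above_move\<close>
  backwards.\<close>

lemma partition_of_move:
  assumes lam: "is_partition lam" and "p \<in> maya lam" "q \<notin> maya lam"
  obtains nu where "is_partition nu" "maya nu = insert q (maya lam - {p})"
proof -
  obtain N where N: "N \<ge> 0" "\<And>c. c \<le> - N \<Longrightarrow> int (count_above (maya lam) c) = - c"
    by (rule maya_charge[OF lam]) (rule that)
  let ?S = "insert q (maya lam - {p})"
  have b: "bounded_above ?S" using maya_beads(1)[OF lam] by simp
  have "count_above ?S c = count_above (maya lam) c" if "c < p" "c < q" for c
  proof (cases "p < q")
    case True
    then show ?thesis using count_above_move[OF maya_beads(1)[OF lam] True assms(2,3), of c] that by simp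
  next
    case False
    moreover have "p \<noteq> q" using assms(2,3) by blast
    ultimately have "q < p" by simp
    have e: "insert p (?S - {q}) = maya lam" using assms(2,3) by blast
    have "p \<notin> ?S" using \<open>p \<noteq> q\<close> by blast
    from count_above_move[OF b \<open>q < p\<close> insertI1 this, of c] show ?thesis
      unfolding e using that by simp
  qed
  then have charge: "int (count_above ?S c) = - c" if "c \<le> - (max N (max (1 - p) (1 - q)))" for c
    using N(2)[of c] that by simp
  show ?thesis
  proof (rule partition_of_beads[OF b])
    fix c assume "c \<le> - (max N (max (1 - p) (1 - q)))"
    then show "int (count_above ?S c) = - c" by (rule charge)
  next
    fix nu assume "is_partition nu" "maya nu = ?S"
    then show thesis by (rule that)
  qed
qed

lemma skew_box_iff:
  assumes "is_partition lam" "is_partition nu"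
  shows "(r, q) \<in> skew_boxes nu lam \<longleftrightarrow>
    count_above (maya lam) (int q - int r) \<le> r \<and> r < count_above (maya nu) (int q - int r)"
proof -
  have "count_above (maya lam) (int q - int r) \<le> r \<longleftrightarrow> lam r \<le> q"
    using maya_beads(2)[OF assms(1), of r "int q - int r"] by linarith
  moreover have "r < count_above (maya nu) (int q - int r) \<longleftrightarrow> q < nu r"
    using maya_beads(2)[OF assms(2), of r "int q - int r"] by linarith
  ultimately show ?thesis by (simp add: skew_boxes_def)
qed

lemma skew_box_of_content:
  assumes "is_partition lam" "is_partition nu" "count_above (maya lam) c \<le> r" "r < count_above (maya nu) c"
  obtains q where "(r, q) \<in> skew_boxes nu lam" "int q - int r = c"
proof -
  have "int (lam r) - int r \<le> c"
    using maya_beads(2)[OF assms(1), of r c] assms(3) by linarith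
  then have "int (nat (c + int r)) - int r = c" by simp
  then show ?thesis using that[of "nat (c + int r)"] assms by (simp add: skew_box_iff)
qed

lemma finite_skew_boxes:
  assumes "is_partition nu"
  shows "finite (skew_boxes nu lam)"
proof (rule finite_subset)
  show "skew_boxes nu lam \<subseteq> {r. nu r \<noteq> 0} \<times> {..<nu 0}"
  proof clarify
    fix r q assume "(r, q) \<in> skew_boxes nu lam"
    then have "q < nu r" by (simp add: skew_boxes_def)
    moreover have "nu r \<le> nu 0" by (rule partition_antimono[OF assms]) simp
    ultimately show "r \<in> {r. nu r \<noteq> 0} \<and> q \<in> {..<nu 0}" by simp
  qed
  show "finite ({r. nu r \<noteq> 0} \<times> {..<nu 0})"
    using assms by (simp add: is_partition_def)
qed

text \<open>A step across an edge changes the content by exactly one, so a path in D attains all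
  intermediate contents.\<close>

lemma content_interval:
  assumes "connected_boxes D" "x \<in> D" "y \<in> D" "content x \<le> c" "c \<le> content y"
  shows "c \<in> content ` D"
proof -
  have "(x, y) \<in> {(u, v). u \<in> D \<and> v \<in> D \<and> share_edge u v}\<^sup>*"
    using assms by (auto simp: connected_boxes_def)
  then show ?thesis using assms(4,5)
  proof (induction arbitrary: c rule: rtrancl_induct)
    case base
    then have "c = content x" by simp
    then show ?case using assms(2) by simp
  next
    case (step y z)
    have e: "content z = content y + 1 \<or> content z = content y - 1"
    proof -
      obtain r q r' q' where yz: "y = (r, q)" "z = (r', q')" by (metis surj_pair)
      have edge: "\<bar>int r - int r'\<bar> + \<bar>int q - int q'\<bar> = 1"
        using step.hyps(2) by (simp add: share_edge_def yz)
      have "content z - content y = (int r - int r') - (int q - int q')"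
        by (simp add: content_def yz)
      moreover have "x - y = 1 \<or> x - y = - 1" if "\<bar>x\<bar> + \<bar>y\<bar> = 1" for x y :: int
      proof (cases "x = 0")
        case False
        then have "\<bar>x\<bar> \<ge> 1" by simp
        with that have "y = 0" by simp
        with that show ?thesis by (simp add: abs_if split: if_splits)
      qed (use that in \<open>simp add: abs_if split: if_splits\<close>)
      ultimately show ?thesis using edge by fastforce
    qed
    show ?case
    proof (cases "c \<le> content y")
      case True
      then show ?thesis using step.IH step.prems by blast
    next
      case False
      then have "c = content z" using e step.prems by auto
      then show ?thesis using step.hyps(2) by auto
    qed
  qed
qed

text \<open>Injectivity of the content allows at most one box per diagonal, and connectedness makes
  the occupied diagonals an interval, so the counts differ by the indicator of [i, j). A bead at s
  is the drop of the count from s - 1 to s, hence only i and j change.\<close>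

lemma ribbon_imp_move:
  assumes lam: "is_partition lam" and nu: "is_partition nu" and rib: "nonempty_ribbon nu lam"
  shows "content_lo nu lam < content_hi nu lam" "content_lo nu lam \<in> maya lam" "content_hi nu lam \<notin> maya lam"
    "maya nu = insert (content_hi nu lam) (maya lam - {content_lo nu lam})"
proof -
  let ?D = "skew_boxes nu lam"
  let ?l = "count_above (maya lam)" and ?n = "count_above (maya nu)"
  define i j where "i = content_lo nu lam" and "j = content_hi nu lam"
  have le: "?l c \<le> ?n c" for c
  proof (rule ccontr)
    assume "\<not> ?l c \<le> ?n c"
    then have "c < int (lam (?n c)) - int (?n c)" "\<not> c < int (nu (?n c)) - int (?n c)"
      using maya_beads(2)[OF lam, of "?n c" c] maya_beads(2)[OF nu, of "?n c" c] by auto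
    moreover have "lam (?n c) \<le> nu (?n c)" using rib by (simp add: nonempty_ribbon_def)
    ultimately show False by simp
  qed
  have C: "content ` ?D = {c. ?l c < ?n c}"
  proof (intro equalityI subsetI)
    fix c assume "c \<in> content ` ?D"
    then obtain r q where "(r, q) \<in> ?D" "c = int q - int r" by (auto simp: content_def)
    then show "c \<in> {c. ?l c < ?n c}" by (auto simp: skew_box_iff[OF lam nu])
  next
    fix c assume "c \<in> {c. ?l c < ?n c}"
    then have "?l c < ?n c" by simp
    obtain q where q: "(?l c, q) \<in> ?D" "int q - int (?l c) = c"
      by (rule skew_box_of_content[OF lam nu order_refl \<open>?l c < ?n c\<close>])
    then have "content (?l c, q) = c" by (simp add: content_def)
    with q(1) show "c \<in> content ` ?D" by (metis image_eqI)
  qed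
  have le1: "?n c \<le> Suc (?l c)" for c
  proof (rule ccontr)
    assume "\<not> ?n c \<le> Suc (?l c)"
    then have "?l c < ?n c" "Suc (?l c) < ?n c" by simp_all
    obtain q where q: "(?l c, q) \<in> ?D" "int q - int (?l c) = c"
      by (rule skew_box_of_content[OF lam nu order_refl \<open>?l c < ?n c\<close>])
    obtain q' where q': "(Suc (?l c), q') \<in> ?D" "int q' - int (Suc (?l c)) = c"
      by (rule skew_box_of_content[OF lam nu le_SucI[OF order_refl] \<open>Suc (?l c) < ?n c\<close>])
    have "inj_on content ?D" using rib by (simp add: nonempty_ribbon_def)
    from inj_onD[OF this _ q(1) q'(1)] q(2) q'(2) show False by (simp add: content_def)
  qed
  have fin: "finite (content ` ?D)" "content ` ?D \<noteq> {}"
    using finite_skew_boxes[OF nu] rib by (auto simp: nonempty_ribbon_def)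
  have I: "content ` ?D = {i..<j}"
  proof (intro equalityI subsetI)
    fix c assume "c \<in> content ` ?D"
    then show "c \<in> {i..<j}" using fin by (auto simp: i_def j_def content_lo_def content_hi_def)
  next
    fix c assume c: "c \<in> {i..<j}"
    have "Min (content ` ?D) \<in> content ` ?D" "Max (content ` ?D) \<in> content ` ?D" using fin by simp_all
    then obtain x y where "x \<in> ?D" "content x = i" "y \<in> ?D" "content y = j - 1"
      by (auto simp: i_def j_def content_lo_def content_hi_def)
    then show "c \<in> content ` ?D"
      using content_interval[of ?D x y c] c rib by (auto simp: nonempty_ribbon_def)
  qed
  then have ij: "i < j" using fin(2) by (metis atLeastLessThan_empty_iff)
  have n: "?n c = ?l c + (if i \<le> c \<and> c < j then 1 else 0)" for c
  proof -
    have "c \<in> {i..<j} \<longleftrightarrow> ?l c < ?n c" using C I by blast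
    then show ?thesis using le[of c] le1[of c] by auto
  qed
  note steps = count_above_step[OF maya_beads(1)[OF lam]] count_above_step[OF maya_beads(1)[OF nu]]
  have mi: "i \<in> maya lam" "i \<notin> maya nu"
    using steps(1)[of i] steps(2)[of i] n[of i] n[of "i - 1"] ij by (simp_all split: if_splits)
  have mj: "j \<notin> maya lam" "j \<in> maya nu"
    using steps(1)[of j] steps(2)[of j] n[of j] n[of "j - 1"] ij by (simp_all split: if_splits)
  have ms: "s \<in> maya nu \<longleftrightarrow> s \<in> maya lam" if "s \<noteq> i" "s \<noteq> j" for s
  proof -
    have "i \<le> s \<and> s < j \<longleftrightarrow> i \<le> s - 1 \<and> s - 1 < j" using that by linarith
    then show ?thesis
      using steps(1)[of s] steps(2)[of s] n[of s] n[of "s - 1"] by (simp split: if_splits)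
  qed
  show "content_lo nu lam < content_hi nu lam" "content_lo nu lam \<in> maya lam" "content_hi nu lam \<notin> maya lam"
    using ij mi mj by (simp_all add: i_def j_def)
  show "maya nu = insert (content_hi nu lam) (maya lam - {content_lo nu lam})"
    unfolding i_def[symmetric] j_def[symmetric]
  proof (rule set_eqI)
    fix s show "s \<in> maya nu \<longleftrightarrow> s \<in> insert j (maya lam - {i})"
      using mi mj ms[of s] ij by (cases "s = i"; cases "s = j") simp_all
  qed
qed

text \<open>Passing from j - 1 to j the count takes a new value exactly when there is a bead at j.
  The values on [i, j) are the rows of the ribbon, which explains the height.\<close>

lemma card_count_above_image:
  assumes S: "bounded_above S" and "i < j"
  shows "card (count_above S ` {i..<j}) = Suc (card {s \<in> S. i < s \<and> s < j})"
proof -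
  have "i + 1 \<le> j" using assms(2) by simp
  then show ?thesis
  proof (induction j rule: int_ge_induct)
    case base
    have "{i..<i + 1} = {i}" "{s \<in> S. i < s \<and> s < i + 1} = {}" by auto
    then show ?case by simp
  next
    case (step j)
    have I: "{i..<j + 1} = insert j {i..<j}" using step by auto
    have fin: "finite {s \<in> S. i < s \<and> s < j}" by (rule finite_subset[of _ "{i<..<j}"]) auto
    show ?case
    proof (cases "j \<in> S")
      case True
      have "count_above S j < count_above S c" if "c \<in> {i..<j}" for c
        using count_above_antimono[OF S, of c "j - 1"] count_above_step[OF S, of j] that True by simp
      then have "count_above S j \<notin> count_above S ` {i..<j}" by force
      moreover have "{s \<in> S. i < s \<and> s < j + 1} = insert j {s \<in> S. i < s \<and> s < j}"
        using True step by auto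
      ultimately show ?thesis using step.IH fin by (simp add: I)
    next
      case False
      then have "count_above S j = count_above S (j - 1)" using count_above_step[OF S, of j] by simp
      then have "count_above S j \<in> count_above S ` {i..<j}" using step by (intro image_eqI[of _ _ "j - 1"]) auto
      moreover have "{s \<in> S. i < s \<and> s < j + 1} = {s \<in> S. i < s \<and> s < j}"
      proof -
        have "s < j + 1 \<longleftrightarrow> s < j" if "s \<in> S" for s
          using that False by (cases "s = j") auto
        then show ?thesis by auto
      qed
      ultimately show ?thesis using step.IH by (simp add: I insert_absorb)
    qed
  qed
qed

lemma move_imp_ribbon:
  assumes lam: "is_partition lam" and nu: "is_partition nu" and ij: "i < j" "i \<in> maya lam" "j \<notin> maya lam"
    and maya: "maya nu = insert j (maya lam - {i})"
  shows "nonempty_ribbon nu lam" "content_lo nu lam = i" "content_hi nu lam = j"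
    "height nu lam - 1 = card {s \<in> maya lam. i < s \<and> s < j}"
proof -
  let ?D = "skew_boxes nu lam"
  let ?l = "count_above (maya lam)" and ?n = "count_above (maya nu)"
  note b = maya_beads(1)[OF lam]
  have n: "?n c = ?l c + (if i \<le> c \<and> c < j then 1 else 0)" for c
    unfolding maya by (rule count_above_move[OF b ij])
  \<comment> \<open>The only box on the diagonal c: its row is the count for lam, and content c then
    fixes the column.\<close>
  define g where "g c = (?l c, nat (c + int (?l c)))" for c
  have g: "g c \<in> ?D" "content (g c) = c" if "c \<in> {i..<j}" for c
  proof -
    have "?l c < ?n c" using n[of c] that by simp
    obtain q where q: "(?l c, q) \<in> ?D" "int q - int (?l c) = c"
      by (rule skew_box_of_content[OF lam nu order_refl \<open>?l c < ?n c\<close>])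
    then have "g c = (?l c, q)" by (auto simp: g_def)
    then show "g c \<in> ?D" "content (g c) = c" using q by (simp_all add: content_def)
  qed
  have D: "?D = g ` {i..<j}"
  proof (intro equalityI subsetI)
    fix x assume x: "x \<in> ?D"
    obtain r q where rq: "x = (r, q)" by (cases x)
    define c where "c = int q - int r"
    have "?l c \<le> r" "r < ?n c" using x by (auto simp: rq c_def skew_box_iff[OF lam nu])
    then have "c \<in> {i..<j}" "r = ?l c" using n[of c] by (auto split: if_splits)
    moreover have "q = nat (c + int r)" by (simp add: c_def)
    ultimately show "x \<in> g ` {i..<j}" by (auto simp: rq g_def)
  next
    fix x assume "x \<in> g ` {i..<j}"
    then show "x \<in> ?D" using g by auto
  qed
  have C: "content ` ?D = {i..<j}" unfolding D using g(2) by (auto simp: image_iff)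
  have inj: "inj_on content ?D"
    unfolding D
  proof (rule inj_onI)
    fix x y assume x: "x \<in> g ` {i..<j}" and y: "y \<in> g ` {i..<j}" and e: "content x = content y"
    obtain c where c: "x = g c" "c \<in> {i..<j}" using x by blast
    obtain d where d: "y = g d" "d \<in> {i..<j}" using y by blast
    have "c = d" using e g(2)[OF c(2)] g(2)[OF d(2)] unfolding c(1) d(1) by simp
    then show "x = y" unfolding c(1) d(1) by simp
  qed
  let ?R = "{(u, v). u \<in> ?D \<and> v \<in> ?D \<and> share_edge u v}"
  have edge: "share_edge (g c) (g (c + 1))" if "c \<in> {i..<j}" "c + 1 \<in> {i..<j}" for c
  proof -
    have "fst (g (c + 1)) = fst (g c) \<or> Suc (fst (g (c + 1))) = fst (g c)"
      using count_above_step[OF b, of "c + 1"] by (auto simp: g_def split: if_splits)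
    moreover have "int (snd (g c)) - int (fst (g c)) = c" "int (snd (g (c + 1))) - int (fst (g (c + 1))) = c + 1"
      using g(2)[OF that(1)] g(2)[OF that(2)] by (auto simp: content_def case_prod_unfold)
    ultimately show ?thesis by (auto simp: share_edge_def case_prod_unfold)
  qed
  have sym: "sym (?R\<^sup>*)"
    by (rule sym_rtrancl) (auto simp: sym_def share_edge_def abs_minus_commute)
  have path: "(g i, g c) \<in> ?R\<^sup>*" if "c \<in> {i..<j}" for c
  proof -
    have "i \<le> c" "c < j" using that by auto
    then show ?thesis
    proof (induction c rule: int_ge_induct)
      case (step c)
      have "(g c, g (c + 1)) \<in> ?R" using step edge[of c] g(1)[of c] g(1)[of "c + 1"] by auto
      moreover have "(g i, g c) \<in> ?R\<^sup>*" using step by simp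
      ultimately show ?case by (rule rtrancl.rtrancl_into_rtrancl[rotated])
    qed simp
  qed
  have "connected_boxes ?D"
    unfolding connected_boxes_def
  proof (intro ballI)
    fix x y assume "x \<in> ?D" "y \<in> ?D"
    then obtain c d where "x = g c" "y = g d" "c \<in> {i..<j}" "d \<in> {i..<j}" unfolding D by auto
    then have "(g i, x) \<in> ?R\<^sup>*" "(g i, y) \<in> ?R\<^sup>*" using path by auto
    then show "(x, y) \<in> ?R\<^sup>*" using sym by (meson rtrancl_trans symD)
  qed
  moreover have "lam r \<le> nu r" for r
  proof (rule ccontr)
    assume "\<not> lam r \<le> nu r"
    then have "r < ?l (int (nu r) - int r)" "\<not> r < ?n (int (nu r) - int r)"
      unfolding maya_beads(2)[OF lam] maya_beads(2)[OF nu] by auto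
    then show False using n[of "int (nu r) - int r"] by simp
  qed
  moreover have "?D \<noteq> {}" unfolding D using ij by auto
  ultimately show "nonempty_ribbon nu lam" using inj by (simp add: nonempty_ribbon_def)
  show "content_lo nu lam = i"
    unfolding content_lo_def C using ij by (intro Min_eqI) auto
  have "Max {i..<j} = j - 1" using ij by (intro Max_eqI) auto
  then show "content_hi nu lam = j" unfolding content_hi_def C by simp
  have "fst ` ?D = ?l ` {i..<j}" unfolding D by (auto simp: g_def image_image)
  then show "height nu lam - 1 = card {s \<in> maya lam. i < s \<and> s < j}"
    unfolding height_def using card_count_above_image[OF b ij(1)] by simp
qed

lemma S_set_maya: "S_set lam = {s \<in> maya lam. 0 < s}"
  by (auto simp: S_set_def maya_def)

text \<open>A gap s <= 0 with n beads beyond it belongs to the column c = s - 1 + n: exactly the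
  first n rows reach past column c, so the conjugate part there is n and s = c + 1 - n.\<close>

lemma T_set_maya:
  assumes lam: "is_partition lam"
  shows "T_set lam = {s. s \<le> 0 \<and> s \<notin> maya lam}"
proof -
  have conj: "conj_part lam c = n" if "\<And>r. c < lam r \<longleftrightarrow> r < n" for c n
    using that by (simp add: conj_part_def)
  have conj_lt: "r < conj_part lam c \<longleftrightarrow> c < lam r" for r c
  proof -
    define n where "n = count_above (maya lam) (int c)"
    have fin: "finite {r. c < lam r}"
      by (rule finite_subset[of _ "{i. lam i \<noteq> 0}"]) (use lam in \<open>auto simp: is_partition_def\<close>)
    obtain m where m: "\<not> c < lam m" using ex_new_if_finite[OF infinite_UNIV_nat fin] by auto
    define k where "k = (LEAST r. \<not> c < lam r)"
    have "\<not> c < lam k" unfolding k_def using m by (rule LeastI)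
    then have "c < lam r \<longleftrightarrow> r < k" for r
      using partition_antimono[OF lam, of k r] not_less_Least[of r "\<lambda>r. \<not> c < lam r"]
      by (cases "r < k") (auto simp: k_def)
    then show ?thesis using conj by metis
  qed
  show ?thesis
  proof (intro equalityI subsetI)
    fix s assume "s \<in> T_set lam"
    then obtain c where c: "s = int (Suc c) - int (conj_part lam c)" "Suc c \<le> conj_part lam c"
      by (auto simp: T_set_def)
    have "int (lam r) - int r \<noteq> s" for r
      using conj_lt[of r c] c(1) by (cases "r < conj_part lam c") auto
    then have "s \<notin> maya lam" unfolding maya_def by blast
    then show "s \<in> {s. s \<le> 0 \<and> s \<notin> maya lam}" using c by simp
  next
    fix s assume s: "s \<in> {s. s \<le> 0 \<and> s \<notin> maya lam}"
    then have ne: "int (lam r) - int r \<noteq> s" for r by (auto simp: maya_def)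
    define n where "n = count_above (maya lam) s"
    have n: "r < n \<longleftrightarrow> s < int (lam r) - int r" for r
      unfolding n_def by (rule maya_beads(2)[OF lam])
    have ge: "1 - s \<le> int n"
    proof -
      have "nat (- s) < n" unfolding n using ne[of "nat (- s)"] s by auto
      then show ?thesis using s by auto
    qed
    define c where "c = nat (s - 1 + int n)"
    have c: "int c = s - 1 + int n" using ge by (simp add: c_def)
    have "c < lam r \<longleftrightarrow> r < n" for r
    proof
      assume "r < n"
      then have "lam (n - 1) \<le> lam r" by (intro partition_antimono[OF lam]) simp
      moreover have "s < int (lam (n - 1)) - int (n - 1)" using n[of "n - 1"] \<open>r < n\<close> by simp
      ultimately show "c < lam r" using c \<open>r < n\<close> by simp
    next
      assume "c < lam r"
      show "r < n"
      proof (rule ccontr)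
        assume "\<not> r < n"
        then have "lam r \<le> lam n" by (intro partition_antimono[OF lam]) simp
        then show False using n[of n] ne[of n] c \<open>c < lam r\<close> by simp
      qed
    qed
    then have "conj_part lam c = n" by (rule conj)
    then show "s \<in> T_set lam" using c s unfolding T_set_def by (intro CollectI exI[of _ c]) auto
  qed
qed

section \<open>The two identities\<close>

lemma ket_in_box:
  assumes "is_partition lam"
  obtains L where "in_box L (ket lam)"
proof -
  obtain N where N: "N \<ge> 0" "\<And>c. c \<le> - N \<Longrightarrow> int (count_above (maya lam) c) = - c"
    by (rule maya_charge[OF assms]) (rule that)
  define L where "L = N + int (lam 0) + 1"
  have "s \<in> maya lam" if "s < - L" for s
  proof -
    have "int (count_above (maya lam) (s - 1)) = 1 - s" "int (count_above (maya lam) s) = - s"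
      using N that by (simp_all add: L_def)
    then show ?thesis using count_above_step[OF maya_beads(1)[OF assms], of s] by (simp split: if_splits)
  qed
  moreover have "s \<le> L" if s: "s \<in> maya lam" for s
  proof -
    obtain r where "s = int (lam r) - int r" using s by (auto simp: maya_def)
    then show ?thesis using partition_antimono[OF assms, of 0 r] N(1) by (simp add: L_def)
  qed
  ultimately have "maya lam \<in> box L" by (simp add: box_def)
  then have "in_box L (ket lam)" using N(1) by (auto simp: in_box_def ket_def L_def)
  then show ?thesis by (rule that)
qed

lemma coeff_functional_scale:
  assumes "in_box L v"
  shows "coeff_functional \<alpha> \<beta> M (\<lambda>S. c * v S) = c * coeff_functional \<alpha> \<beta> M v"
  using coeff_functional_sum[of L "{()}" "\<lambda>_. v" \<alpha> \<beta> M "\<lambda>_. c"] assms by (simp add: in_box_def)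

lemma schur_coeff_functional: "schur \<alpha> \<beta> lam M = coeff_functional \<alpha> \<beta> M (ket lam)"
  by (simp add: schur_def coeff_functional_def)

lemma mode_array_diag:
  assumes "is_partition lam"
  shows "mode_array \<alpha> \<beta> M (ket lam) i i =
    ((if i \<in> S_set lam then 1 else 0) - (if i \<in> T_set lam then 1 else 0)) * schur \<alpha> \<beta> lam M"
proof -
  obtain L where L: "in_box L (ket lam)" by (rule ket_in_box[OF assms])
  have "normal_ordered i i (ket lam) = (\<lambda>S. ((if i \<in> S_set lam then 1 else 0) - (if i \<in> T_set lam then 1 else 0)) * ket lam S)"
  proof
    fix S
    show "normal_ordered i i (ket lam) S = ((if i \<in> S_set lam then 1 else 0) - (if i \<in> T_set lam then 1 else 0)) * ket lam S"
      unfolding normal_ordered_diag[OF in_box_bounded[OF L]] S_set_maya T_set_maya[OF assms]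
      by (cases "S = maya lam") (simp_all add: ket_def)
  qed
  then show ?thesis
    by (simp only: mode_array_def coeff_functional_scale[OF L] schur_coeff_functional)
qed

text \<open>Both signs count beads of the same set with j removed, beyond i and beyond j. Beads
  beyond both cancel in parity, leaving those strictly between.\<close>

lemma move_sign:
  assumes S: "bounded_above S" and "i \<notin> S" "j \<in> S"
  shows "wedge_sign i (insert i (S - {j})) * wedge_sign j (S - {j})
    = (- 1) ^ card {s \<in> S. min i j < s \<and> s < max i j}"
proof -
  let ?C = "S - {j}"
  have C: "finite {s \<in> ?C. p < s}" for p using S bounded_above_remove[of S j] unfolding bounded_above_def by blast
  have i: "wedge_sign i (insert i ?C) = wedge_sign i ?C"
    using assms by (subst wedge_sign_insert) auto
  have split: "card {s \<in> ?C. p < s} = card {s \<in> ?C. p < s \<and> s < q} + card {s \<in> ?C. q < s}"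
    if "p < q" "q \<notin> ?C" for p q
  proof -
    have "s \<noteq> q" if "s \<in> ?C" for s using that \<open>q \<notin> ?C\<close> by blast
    then have e: "{s \<in> ?C. p < s} = {s \<in> ?C. p < s \<and> s < q} \<union> {s \<in> ?C. q < s}"
      using that(1) by fastforce
    show ?thesis unfolding e
      by (rule card_Un_disjoint) (use C[of p] C[of q] in \<open>auto elim: rev_finite_subset\<close>)
  qed
  have sq: "(- 1) ^ (n + m) * (- 1) ^ m = ((- 1) ^ n :: complex)" "(- 1) ^ m * (- 1) ^ (n + m) = ((- 1) ^ n :: complex)" for n m
    by (simp_all add: power_add minus_one_power_square mult.assoc mult.left_commute)
  have "i \<noteq> j" using assms by blast
  then show ?thesis
  proof (cases "i < j")
    case True
    have "{s \<in> ?C. i < s \<and> s < j} = {s \<in> S. min i j < s \<and> s < max i j}" using True by auto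
    moreover have "j \<notin> ?C" by blast
    then have "wedge_sign i ?C * wedge_sign j ?C = (- 1) ^ card {s \<in> ?C. i < s \<and> s < j}"
      unfolding wedge_sign_def split[OF True \<open>j \<notin> ?C\<close>] by (simp only: sq)
    ultimately show ?thesis unfolding i by simp
  next
    case False
    then have "j < i" using \<open>i \<noteq> j\<close> by simp
    then have "{s \<in> ?C. j < s \<and> s < i} = {s \<in> S. min i j < s \<and> s < max i j}" by auto
    moreover have "i \<notin> ?C" using assms(2) by blast
    then have "wedge_sign i ?C * wedge_sign j ?C = (- 1) ^ card {s \<in> ?C. j < s \<and> s < i}"
      unfolding wedge_sign_def split[OF \<open>j < i\<close> \<open>i \<notin> ?C\<close>] by (simp only: sq)
    ultimately show ?thesis unfolding i by simp
  qed
qed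

text \<open>psi_i psi_star_j moves a bead from j to i, or gives 0 if there is no bead at j or no gap
  at i.\<close>

lemma mode_array_offdiag:
  assumes lam: "is_partition lam" and "i \<noteq> j"
  shows "\<not> (i \<notin> maya lam \<and> j \<in> maya lam) \<Longrightarrow> mode_array \<alpha> \<beta> M (ket lam) i j = 0"
    and "is_partition nu \<Longrightarrow> i \<notin> maya lam \<Longrightarrow> j \<in> maya lam \<Longrightarrow> maya nu = insert i (maya lam - {j}) \<Longrightarrow>
      mode_array \<alpha> \<beta> M (ket lam) i j
        = (- 1) ^ card {s \<in> maya lam. min i j < s \<and> s < max i j} * schur \<alpha> \<beta> nu M"
proof -
  obtain L where L: "in_box L (ket lam)" by (rule ket_in_box[OF lam])
  note off = normal_ordered_offdiag[OF assms(2) in_box_bounded[OF L]]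
  {
    assume *: "\<not> (i \<notin> maya lam \<and> j \<in> maya lam)"
    have "insert j (S - {i}) \<noteq> maya lam" for S
      using * assms(2) by blast
    then have "normal_ordered i j (ket lam) = (\<lambda>_. 0)"
      by (intro ext, unfold off) (simp add: ket_def)
    then show "mode_array \<alpha> \<beta> M (ket lam) i j = 0"
      by (simp add: mode_array_def coeff_functional_zero)
  }
  {
    assume nu: "is_partition nu" "i \<notin> maya lam" "j \<in> maya lam" "maya nu = insert i (maya lam - {j})"
    obtain K where K: "in_box K (ket nu)" by (rule ket_in_box[OF nu(1)])
    let ?s = "(- 1) ^ card {s \<in> maya lam. min i j < s \<and> s < max i j} :: complex"
    have "normal_ordered i j (ket lam) S = ?s * ket nu S" for S
    proof (cases "S = maya nu")
      case True
      have 1: "S - {i} = maya lam - {j}" "insert j (S - {i}) = maya lam" "i \<in> S" "j \<notin> S"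
        using True nu assms(2) by auto
      then have "normal_ordered i j (ket lam) S = wedge_sign i S * wedge_sign j (S - {i})"
        by (unfold off) (simp add: ket_def)
      also have "\<dots> = ?s"
        unfolding 1(1) using move_sign[OF maya_beads(1)[OF lam] nu(2,3)] True nu(4) by simp
      finally show ?thesis using True by (simp add: ket_def)
    next
      case False
      have "\<not> (i \<in> S \<and> j \<notin> S \<and> insert j (S - {i}) = maya lam)"
        using False nu(4) by auto
      then show ?thesis using False by (unfold off) (auto simp: ket_def)
    qed
    then have "normal_ordered i j (ket lam) = (\<lambda>S. ?s * ket nu S)" by (rule ext)
    then show "mode_array \<alpha> \<beta> M (ket lam) i j = ?s * schur \<alpha> \<beta> nu M"
      by (simp only: mode_array_def coeff_functional_scale[OF K] schur_coeff_functional)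
  }
qed

lemma finite_S_T:
  assumes "is_partition lam"
  shows "finite (S_set lam)" "finite (T_set lam)"
proof -
  obtain L where "in_box L (ket lam)" by (rule ket_in_box[OF assms])
  then have "maya lam \<in> box L" by (force simp: in_box_def ket_def)
  then have "S_set lam \<subseteq> {0..L}" "T_set lam \<subseteq> {- L..0}"
    unfolding S_set_maya T_set_maya[OF assms] box_def by (auto simp: not_less[symmetric])
  then show "finite (S_set lam)" "finite (T_set lam)"
    by (auto intro: finite_subset)
qed

lemma sum_diag:
  assumes "is_partition lam" "finite B" "S_set lam \<union> T_set lam \<subseteq> B"
  shows "(\<Sum>i\<in>B. x i ^ k * mode_array \<alpha> \<beta> M (ket lam) i i) = super_power_sum k x (S_set lam) (T_set lam) * schur \<alpha> \<beta> lam M"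
proof -
  have "(\<Sum>i\<in>B. x i ^ k * mode_array \<alpha> \<beta> M (ket lam) i i)
    = (\<Sum>i\<in>B. (if i \<in> S_set lam then x i ^ k else 0) - (if i \<in> T_set lam then x i ^ k else 0)) * schur \<alpha> \<beta> lam M"
    unfolding sum_distrib_right by (rule sum.cong) (auto simp: mode_array_diag[OF assms(1)])
  also have "(\<Sum>i\<in>B. (if i \<in> S_set lam then x i ^ k else 0) - (if i \<in> T_set lam then x i ^ k else 0))
    = super_power_sum k x (S_set lam) (T_set lam)"
    using assms(2,3) by (simp add: sum_subtractf super_power_sum_def sum.If_cases Int_absorb1)
  finally show ?thesis .
qed

text \<open>The ends of the content interval determine the bead move and hence nu. The upper end
  comes first, so that pairs match the indices of the lower triangular A^(-k).\<close>

lemma bij_betw_added_ribbons: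
  assumes lam: "is_partition lam"
  shows "bij_betw (\<lambda>nu. (content_hi nu lam, content_lo nu lam)) {nu. is_partition nu \<and> nonempty_ribbon nu lam}
    {(i, j). j < i \<and> i \<notin> maya lam \<and> j \<in> maya lam}"
  unfolding bij_betw_def
proof
  show "inj_on (\<lambda>nu. (content_hi nu lam, content_lo nu lam)) {nu. is_partition nu \<and> nonempty_ribbon nu lam}"
  proof (rule inj_onI)
    fix x y
    assume x: "x \<in> {nu. is_partition nu \<and> nonempty_ribbon nu lam}"
      and y: "y \<in> {nu. is_partition nu \<and> nonempty_ribbon nu lam}"
      and e: "(content_hi x lam, content_lo x lam) = (content_hi y lam, content_lo y lam)"
    have "maya x = maya y"
      using ribbon_imp_move(4)[OF lam, of x] ribbon_imp_move(4)[OF lam, of y] x y e by simp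
    then show "x = y" using maya_inject x y by blast
  qed
  show "(\<lambda>nu. (content_hi nu lam, content_lo nu lam)) ` {nu. is_partition nu \<and> nonempty_ribbon nu lam}
    = {(i, j). j < i \<and> i \<notin> maya lam \<and> j \<in> maya lam}"
  proof (intro equalityI subsetI)
    fix p assume "p \<in> {(i, j). j < i \<and> i \<notin> maya lam \<and> j \<in> maya lam}"
    then obtain i j where p: "p = (i, j)" "j < i" "i \<notin> maya lam" "j \<in> maya lam" by auto
    obtain nu where nu: "is_partition nu" "maya nu = insert i (maya lam - {j})"
      by (rule partition_of_move[OF lam p(4,3)])
    note m = move_imp_ribbon[OF lam nu(1) p(2,4,3) nu(2)]
    show "p \<in> (\<lambda>nu. (content_hi nu lam, content_lo nu lam)) ` {nu. is_partition nu \<and> nonempty_ribbon nu lam}"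
      by (rule image_eqI[of _ _ nu]) (use m nu p in auto)
  qed (use ribbon_imp_move(1-3)[OF lam] in auto)
qed

text \<open>Removing a ribbon from lam is adding it to mu, viewed from the larger diagram. The lower
  end comes first, matching the upper triangular A^k.\<close>

lemma bij_betw_removed_ribbons:
  assumes lam: "is_partition lam"
  shows "bij_betw (\<lambda>mu. (content_lo lam mu, content_hi lam mu)) {mu. is_partition mu \<and> nonempty_ribbon lam mu}
    {(i, j). i < j \<and> i \<notin> maya lam \<and> j \<in> maya lam}"
  unfolding bij_betw_def
proof
  have move: "content_lo lam mu \<notin> maya lam \<and> content_hi lam mu \<in> maya lam \<and> content_lo lam mu < content_hi lam mu
      \<and> maya mu = insert (content_lo lam mu) (maya lam - {content_hi lam mu})"
    if "is_partition mu \<and> nonempty_ribbon lam mu" for mu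
    using ribbon_imp_move[of mu lam] lam that by auto
  show "inj_on (\<lambda>mu. (content_lo lam mu, content_hi lam mu)) {mu. is_partition mu \<and> nonempty_ribbon lam mu}"
  proof (rule inj_onI)
    fix x y
    assume x: "x \<in> {mu. is_partition mu \<and> nonempty_ribbon lam mu}"
      and y: "y \<in> {mu. is_partition mu \<and> nonempty_ribbon lam mu}"
      and e: "(content_lo lam x, content_hi lam x) = (content_lo lam y, content_hi lam y)"
    have "maya x = maya y" using move[of x] move[of y] x y e by simp
    then show "x = y" using maya_inject x y by blast
  qed
  show "(\<lambda>mu. (content_lo lam mu, content_hi lam mu)) ` {mu. is_partition mu \<and> nonempty_ribbon lam mu}
    = {(i, j). i < j \<and> i \<notin> maya lam \<and> j \<in> maya lam}"
  proof (intro equalityI subsetI)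
    fix p assume "p \<in> {(i, j). i < j \<and> i \<notin> maya lam \<and> j \<in> maya lam}"
    then obtain i j where p: "p = (i, j)" "i < j" "i \<notin> maya lam" "j \<in> maya lam" by auto
    obtain mu where mu: "is_partition mu" "maya mu = insert i (maya lam - {j})"
      by (rule partition_of_move[OF lam p(4,3)])
    have i: "i \<in> maya mu" "j \<notin> maya mu" "maya lam = insert j (maya mu - {i})"
      using mu(2) p by auto
    note m = move_imp_ribbon[OF mu(1) lam p(2) i]
    show "p \<in> (\<lambda>mu. (content_lo lam mu, content_hi lam mu)) ` {mu. is_partition mu \<and> nonempty_ribbon lam mu}"
      by (rule image_eqI[of _ _ mu]) (use m mu p in auto)
  qed (use move in auto)
qed

lemma mode_array_added:
  assumes lam: "is_partition lam" and nu: "is_partition nu" "nonempty_ribbon nu lam"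
  shows "mode_array \<alpha> \<beta> M (ket lam) (content_hi nu lam) (content_lo nu lam)
    = (- 1) ^ (height nu lam - 1) * schur \<alpha> \<beta> nu M"
proof -
  note m = ribbon_imp_move[OF lam nu]
  have "{s \<in> maya lam. min (content_hi nu lam) (content_lo nu lam) < s \<and> s < max (content_hi nu lam) (content_lo nu lam)}
    = {s \<in> maya lam. content_lo nu lam < s \<and> s < content_hi nu lam}"
    using m(1) by auto
  then show ?thesis
    using mode_array_offdiag(2)[OF lam _ nu(1) m(3,2,4)] move_imp_ribbon(4)[OF lam nu(1) m] m(1) by simp
qed

lemma mode_array_removed:
  assumes lam: "is_partition lam" and mu: "is_partition mu" "nonempty_ribbon lam mu"
  shows "mode_array \<alpha> \<beta> M (ket lam) (content_lo lam mu) (content_hi lam mu)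
    = (- 1) ^ (height lam mu - 1) * schur \<alpha> \<beta> mu M"
proof -
  note m = ribbon_imp_move[OF mu(1) lam mu(2)]
  have r: "content_lo lam mu \<notin> maya lam" "content_hi lam mu \<in> maya lam"
    "maya mu = insert (content_lo lam mu) (maya lam - {content_hi lam mu})"
    using m by auto
  have "{s \<in> maya lam. min (content_lo lam mu) (content_hi lam mu) < s \<and> s < max (content_lo lam mu) (content_hi lam mu)}
    = {s \<in> maya mu. content_lo lam mu < s \<and> s < content_hi lam mu}"
    using m(1) r by auto
  then show ?thesis
    using mode_array_offdiag(2)[OF lam _ mu(1) r] move_imp_ribbon(4)[OF mu(1) lam m] m(1) by simp
qed

text \<open>The derivative becomes J_k applied to the basis vector of lam, a finite sum over a box.
  Its nonzero entries lie on the diagonal, giving the power sums, or at i < j with a gap at i and a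
  bead at j, giving removed ribbons.\<close>

lemma derivative_identity:
  assumes k: "k > 0" and lam: "is_partition lam"
  shows "of_nat k * p_deriv k (schur \<alpha> \<beta> lam) M =
    super_power_sum k \<beta> (S_set lam) (T_set lam) * schur \<alpha> \<beta> lam M
      + (\<Sum>mu | is_partition mu \<and> nonempty_ribbon lam mu.
           (- 1) ^ (height lam mu - 1) * A \<alpha> \<beta> (int k) (content_lo lam mu) (content_hi lam mu) * schur \<alpha> \<beta> mu M)"
proof -
  obtain L0 where L0: "in_box L0 (ket lam)" by (rule ket_in_box[OF lam])
  have fin: "finite (S_set lam \<union> T_set lam)" using finite_S_T[OF lam] by simp
  \<comment> \<open>The box is enlarged to contain S and T, so that its diagonal sums to the full
    super power sum.\<close>
  define L where "L = max L0 (Max (insert 0 (abs ` (S_set lam \<union> T_set lam))))"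
  have L: "in_box L (ket lam)" using L0 by (rule in_box_mono) (simp add: L_def)
  have "\<bar>s\<bar> \<le> L" if "s \<in> S_set lam \<union> T_set lam" for s
    using fin that unfolding L_def by (intro max.coboundedI2 Max_ge) auto
  then have ST: "S_set lam \<union> T_set lam \<subseteq> {- L..L}" by force
  let ?B = "{- L..L}"
  let ?X = "mode_array \<alpha> \<beta> M (ket lam)"
  let ?P = "{(i, j). i < j \<and> i \<notin> maya lam \<and> j \<in> maya lam}"
  let ?T = "tri \<alpha> \<beta> (\<lambda>_. 1) (defect \<alpha> \<beta>) k"
  have X0: "?X i j = 0" if "i < - L \<or> j > L" for i j by (rule mode_array_outside[OF L that])
  have "of_nat k * p_deriv k (schur \<alpha> \<beta> lam) M = coeff_functional \<alpha> \<beta> M (Jk \<alpha> \<beta> k (ket lam))"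
    using coeff_functional_add[OF L, of k M \<alpha> \<beta>] k by (simp add: p_deriv_def schur_coeff_functional mult.assoc)
  also have "Jk \<alpha> \<beta> k (ket lam) = (\<lambda>S. \<Sum>p\<in>?B \<times> ?B. ?T (fst p) (snd p) * normal_ordered (fst p) (snd p) (ket lam) S)"
    using current_box[OF upper_tri L] by (simp add: fun_eq_iff case_prod_unfold)
  also have "coeff_functional \<alpha> \<beta> M \<dots> = (\<Sum>p\<in>?B \<times> ?B. ?T (fst p) (snd p) * ?X (fst p) (snd p))"
    unfolding mode_array_def
    using L in_box_normal_ordered[OF L] by (intro coeff_functional_sum[of L]) (auto simp: in_box_def)
  also have "\<dots> = (\<Sum>p\<in>(\<lambda>i. (i, i)) ` ?B \<union> (?P \<inter> ?B \<times> ?B). ?T (fst p) (snd p) * ?X (fst p) (snd p))"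
  proof (rule sum.mono_neutral_right)
    show "\<forall>p\<in>?B \<times> ?B - ((\<lambda>i. (i, i)) ` ?B \<union> (?P \<inter> ?B \<times> ?B)). ?T (fst p) (snd p) * ?X (fst p) (snd p) = 0"
    proof
      fix p assume p: "p \<in> ?B \<times> ?B - ((\<lambda>i. (i, i)) ` ?B \<union> (?P \<inter> ?B \<times> ?B))"
      obtain i j where ij: "p = (i, j)" by (cases p)
      with p have "i \<noteq> j" "j < i \<or> \<not> (i \<notin> maya lam \<and> j \<in> maya lam)" by auto
      then show "?T (fst p) (snd p) * ?X (fst p) (snd p) = 0"
        using mode_array_offdiag(1)[OF lam, of i j] ij by auto
    qed
  qed auto
  also have "\<dots> = (\<Sum>p\<in>(\<lambda>i. (i, i)) ` ?B. ?T (fst p) (snd p) * ?X (fst p) (snd p))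
      + (\<Sum>p\<in>?P \<inter> ?B \<times> ?B. ?T (fst p) (snd p) * ?X (fst p) (snd p))"
    by (rule sum.union_disjoint) auto
  also have "(\<Sum>p\<in>(\<lambda>i. (i, i)) ` ?B. ?T (fst p) (snd p) * ?X (fst p) (snd p)) = (\<Sum>i\<in>?B. \<beta> i ^ k * ?X i i)"
    by (subst sum.reindex) (auto simp: inj_on_def tri_def)
  also have "\<dots> = super_power_sum k \<beta> (S_set lam) (T_set lam) * schur \<alpha> \<beta> lam M"
    by (rule sum_diag[OF lam _ ST]) simp
  also have "?P \<inter> ?B \<times> ?B = ?P"
  proof -
    have "maya lam \<in> box L" using L by (force simp: in_box_def ket_def)
    then have "i \<in> ?B \<and> j \<in> ?B" if "i < j" "i \<notin> maya lam" "j \<in> maya lam" for i j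
    proof -
      have "- L \<le> i" "j \<le> L" using that \<open>maya lam \<in> box L\<close> unfolding box_def by (blast intro: leI, blast)
      then show ?thesis using that(1) by simp
    qed
    then show ?thesis by blast
  qed
  also have "(\<Sum>p\<in>?P. ?T (fst p) (snd p) * ?X (fst p) (snd p))
    = (\<Sum>mu\<in>{mu. is_partition mu \<and> nonempty_ribbon lam mu}. ?T (content_lo lam mu) (content_hi lam mu) * ?X (content_lo lam mu) (content_hi lam mu))"
    using sum.reindex_bij_betw[OF bij_betw_removed_ribbons[OF lam], of "\<lambda>p. ?T (fst p) (snd p) * ?X (fst p) (snd p)"] by simp
  also have "\<dots> = (\<Sum>mu | is_partition mu \<and> nonempty_ribbon lam mu.
           (- 1) ^ (height lam mu - 1) * A \<alpha> \<beta> (int k) (content_lo lam mu) (content_hi lam mu) * schur \<alpha> \<beta> mu M)"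
    by (rule sum.cong) (auto simp: mode_array_removed[OF lam] A_pos[OF k] mult_ac)
  finally show ?thesis .
qed

text \<open>The trace of the mode array is an unconditional sum over all pairs (i, j). This permits
  discarding zero entries, subtracting the finite diagonal part and reindexing the rest, where i > j
  has a gap at i and a bead at j, by added ribbons.\<close>

lemma multiplication_identity:
  assumes vev: "vev_psi_psi_star \<alpha> \<beta>" "vev_psi_star_psi \<alpha> \<beta>" and k: "k > 0" and lam: "is_partition lam"
  shows "((\<lambda>nu. (- 1) ^ (height nu lam - 1) * A \<alpha> \<beta> (- int k) (content_hi nu lam) (content_lo nu lam) * schur \<alpha> \<beta> nu M)
    has_sum (p_mult k (schur \<alpha> \<beta> lam) M - super_power_sum k \<alpha> (S_set lam) (T_set lam) * schur \<alpha> \<beta> lam M))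
    {nu. is_partition nu \<and> nonempty_ribbon nu lam}"
proof -
  interpret two_sided \<alpha> \<beta> "\<lambda>_. 1" "defect \<alpha> \<beta>" by (rule two_sided_vacuum[OF vev])
  obtain L where L: "in_box L (ket lam)" by (rule ket_in_box[OF lam])
  let ?X = "mode_array \<alpha> \<beta> M (ket lam)"
  let ?Q = "{(i, j). j < i \<and> i \<notin> maya lam \<and> j \<in> maya lam}"
  define F where "F = (\<lambda>(i, j). low k i j * ?X i j)"
  define D where "D = (\<lambda>i::int. (i, i)) ` (S_set lam \<union> T_set lam)"
  obtain k' where k': "k = Suc k'" using k by (cases k) auto
  note tr = mode_array_trace[OF refl refl refl refl L, of M]
  have X: "?X \<in> arrs" using tr by blast
  have tr_k: "trace k ?X = p_mult k (schur \<alpha> \<beta> lam) M"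
    using tr by (simp add: k' schur_coeff_functional[abs_def])
  have UNIV: "(F has_sum p_mult k (schur \<alpha> \<beta> lam) M) UNIV"
    using has_sum_infsum[OF trace_summable[OF X, of k]] tr_k by (simp add: F_def trace_def)
  have DQ: "(F has_sum p_mult k (schur \<alpha> \<beta> lam) M) (D \<union> ?Q)"
  proof (rule iffD1[OF has_sum_cong_neutral UNIV])
    fix p assume p: "p \<in> UNIV - (D \<union> ?Q)"
    obtain i j where ij: "p = (i, j)" by (cases p)
    show "F p = 0"
    proof (cases "i = j")
      case True
      then have "i \<notin> S_set lam" "i \<notin> T_set lam" using p ij by (auto simp: D_def)
      then show ?thesis using True by (simp add: F_def ij mode_array_diag[OF lam])
    next
      case False
      then have "i < j \<or> \<not> (i \<notin> maya lam \<and> j \<in> maya lam)" using p ij by auto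
      then show ?thesis using mode_array_offdiag(1)[OF lam False] by (auto simp: F_def ij)
    qed
  qed auto
  have finD: "finite D" using finite_S_T[OF lam] by (simp add: D_def)
  have D: "sum F D = super_power_sum k \<alpha> (S_set lam) (T_set lam) * schur \<alpha> \<beta> lam M"
  proof -
    have "sum F D = (\<Sum>i\<in>S_set lam \<union> T_set lam. \<alpha> i ^ k * ?X i i)"
      unfolding D_def by (subst sum.reindex) (auto simp: inj_on_def F_def tri_def)
    then show ?thesis using sum_diag[OF lam _ order_refl] finite_S_T[OF lam] by simp
  qed
  have "(F has_sum (p_mult k (schur \<alpha> \<beta> lam) M - sum F D)) ((D \<union> ?Q) - D)"
    by (rule has_sum_Diff[OF DQ has_sum_finite[OF finD]]) auto
  moreover have "(D \<union> ?Q) - D = ?Q" by (auto simp: D_def)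
  ultimately have "(F has_sum (p_mult k (schur \<alpha> \<beta> lam) M - sum F D)) ?Q" by simp
  then have "((\<lambda>nu. F (content_hi nu lam, content_lo nu lam)) has_sum (p_mult k (schur \<alpha> \<beta> lam) M - sum F D))
      {nu. is_partition nu \<and> nonempty_ribbon nu lam}"
    using has_sum_reindex_bij_betw[OF bij_betw_added_ribbons[OF lam], of F] by simp
  then show ?thesis unfolding D
    by (rule iffD1[OF has_sum_cong, rotated])
       (auto simp: F_def mode_array_added[OF lam] A_neg[OF k] mult_ac)
qed

theorem theorem5p23:
  fixes \<alpha> \<beta> :: "int \<Rightarrow> complex" and k :: nat and lam :: "nat \<Rightarrow> nat"
  assumes "vev_psi_psi_star \<alpha> \<beta>" and "vev_psi_star_psi \<alpha> \<beta>"
    and "k > 0" and "is_partition lam"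
  shows "(\<forall>M. (\<lambda>\<nu>. (-1) ^ (height \<nu> lam - 1)
                 * A \<alpha> \<beta> (- int k) (content_hi \<nu> lam) (content_lo \<nu> lam) * schur \<alpha> \<beta> \<nu> M)
            summable_on {\<nu>. is_partition \<nu> \<and> nonempty_ribbon \<nu> lam})
     \<and> p_mult k (schur \<alpha> \<beta> lam) =
         (\<lambda>M. super_power_sum k \<alpha> (S_set lam) (T_set lam) * schur \<alpha> \<beta> lam M
            + (\<Sum>\<^sub>\<infinity>\<nu> | is_partition \<nu> \<and> nonempty_ribbon \<nu> lam.
                 (-1) ^ (height \<nu> lam - 1)
                 * A \<alpha> \<beta> (- int k) (content_hi \<nu> lam) (content_lo \<nu> lam) * schur \<alpha> \<beta> \<nu> M))
     \<and> (\<lambda>M. of_nat k * p_deriv k (schur \<alpha> \<beta> lam) M) =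
         (\<lambda>M. super_power_sum k \<beta> (S_set lam) (T_set lam) * schur \<alpha> \<beta> lam M
            + (\<Sum>\<mu> | is_partition \<mu> \<and> nonempty_ribbon lam \<mu>.
                 (-1) ^ (height lam \<mu> - 1)
                 * A \<alpha> \<beta> (int k) (content_lo lam \<mu>) (content_hi lam \<mu>) * schur \<alpha> \<beta> \<mu> M))"
proof (intro conjI allI)
  note mult = multiplication_identity[OF assms]
  show "(\<lambda>\<nu>. (-1) ^ (height \<nu> lam - 1)
      * A \<alpha> \<beta> (- int k) (content_hi \<nu> lam) (content_lo \<nu> lam) * schur \<alpha> \<beta> \<nu> M)
    summable_on {\<nu>. is_partition \<nu> \<and> nonempty_ribbon \<nu> lam}" for M
    using mult by (rule has_sum_imp_summable)
  show "p_mult k (schur \<alpha> \<beta> lam) =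
    (\<lambda>M. super_power_sum k \<alpha> (S_set lam) (T_set lam) * schur \<alpha> \<beta> lam M
       + (\<Sum>\<^sub>\<infinity>\<nu> | is_partition \<nu> \<and> nonempty_ribbon \<nu> lam. (-1) ^ (height \<nu> lam - 1)
            * A \<alpha> \<beta> (- int k) (content_hi \<nu> lam) (content_lo \<nu> lam) * schur \<alpha> \<beta> \<nu> M))"
    unfolding infsumI[OF mult] by (simp add: fun_eq_iff)
  show "(\<lambda>M. of_nat k * p_deriv k (schur \<alpha> \<beta> lam) M) =
    (\<lambda>M. super_power_sum k \<beta> (S_set lam) (T_set lam) * schur \<alpha> \<beta> lam M
       + (\<Sum>\<mu> | is_partition \<mu> \<and> nonempty_ribbon lam \<mu>. (-1) ^ (height lam \<mu> - 1)
            * A \<alpha> \<beta> (int k) (content_lo lam \<mu>) (content_hi lam \<mu>) * schur \<alpha> \<beta> \<mu> M))"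
    by (rule ext) (rule derivative_identity[OF assms(3,4)])
qed

end
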